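(* Let $P_d=\{A\in\mathrm{Her}_d(\mathbb C)\mid A\geqslant0\}$ and let $\mathcal C=(\mathcal C_s)_{s\geqslant1}$ be an abstract operator system on $\mathrm{Mat}_d(\mathbb C)$ over $P_d$, i.e. with $\mathcal C_1=P_d$. (i) If $\mathcal C$ is a free spectrahedron, defined by a linear matrix inequality of size at most $2d-2$, then $\mathcal C\subseteq\mathrm{Psd}_d$ or $\mathcal C\subseteq\mathrm{Psd}_d^\Gamma$. (ii) If $\mathcal C$ is a free numerical range, generated by an element from $\mathcal C_{2d-2}$, then $\mathrm{Psd}_d\subseteq\mathcal C$ or $\mathrm{Psd}_d^\Gamma\subseteq\mathcal C$.
   Context: $\mathrm{Her}_d(\mathbb C)$ is the real vector space of Hermitian $d\times d$ matrices; $\geqslant0$ means positive semidefinite. A convex cone is proper if it is closed, has nonempty interior and contains no full line. An abstract operator system on $\mathrm{Mat}_d(\mathbb C)$ is a family $\mathcal C=(\mathcal C_s)_{s\geqslant1}$ of proper convex cones $\mathcal C_s\subseteq\mathrm{Her}_s(\mathbb C)\otimes\mathrm{Her}_d(\mathbb C)=\mathrm{Her}_{sd}(\mathbb C)$ such that $A\in\mathcal C_s$ and $V\in\mathrm{Mat}_{s,t}(\mathbb C)$ imply $(V\otimes I_d)^*A(V\otimes I_d)\in\mathcal C_t$ (compression acts on the first tensor factor). Containment $\mathcal C\subseteq\mathcal D$ means $\mathcal C_s\subseteq\mathcal D_s$ for all $s\geqslant1$. $\mathcal C$ is a free spectrahedron defined by a linear matrix inequality of size $r$ if there is a $*$-linear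 map $\varphi:\mathrm{Mat}_d(\mathbb C)\to\mathrm{Mat}_r(\mathbb C)$ with $\varphi(u)=I_r$ for some interior point $u$ of $\mathcal C_1$, such that for all $s\geqslant1$ and $A\in\mathrm{Her}_s(\mathbb C)\otimes\mathrm{Her}_d(\mathbb C)$: $A\in\mathcal C_s\Leftrightarrow(\mathrm{id}\otimes\varphi)(A)\geqslant0$. $\mathcal C$ is a free numerical range generated by $M\in\mathcal C_r$ if it is the smallest abstract operator system containing $M$ at level $r$; then $\mathcal C_s=\{\sum_{j=1}^n(V_j\otimes I_d)^*M(V_j\otimes I_d)\mid n\geqslant1,\ V_j\in\mathrm{Mat}_{r,s}(\mathbb C)\}$ for all $s\geqslant1$. The systems $\mathrm{Psd}_d=(\mathrm{Psd}_{d,s})_{s\geqslant1}$ and $\mathrm{Psd}_d^\Gamma=(\mathrm{Psd}_{d,s}^\Gamma)_{s\geqslant1}$ are defined by $\mathrm{Psd}_{d,s}=\{A\in\mathrm{Her}_s(\mathbb C)\otimes\mathrm{Her}_d(\mathbb C)\mid A\geqslant0\}$ and $\mathrm{Psd}^\Gamma_{d,s}=\{\sum_iA_i\otimes B_i\in\mathrm{Her}_s(\mathbb C)\otimes\mathrm{Her}_d(\mathbb C)\mid\sum_iA_i\otimes B_i^T\geqslant0\}$. *)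

theory Defs
  imports
    "HOL-Analysis.Function_Topology"
    "Jordan_Normal_Form.Schur_Decomposition"
begin

section \<open>Hermitian and positive semidefinite matrices\<close>

definition Her :: "nat \<Rightarrow> complex mat set" where
  "Her n = {A \<in> carrier_mat n n. mat_adjoint A = A}"

definition positive_semidefinite :: "complex mat \<Rightarrow> bool" where
  "positive_semidefinite A \<longleftrightarrow>
     A \<in> Her (dim_row A) \<and> (\<forall>v \<in> carrier_vec (dim_row A). 0 \<le> Re ((A *\<^sub>v v) \<bullet>c v))"

text \<open>
  The type of matrices carries no topology, so the topology of the finite-dimensional real
  vector space of Hermitian matrices is pulled back along the entry coordinates.
\<close>

definition Her_topology :: "nat \<Rightarrow> complex mat topology" where
  "Her_topology n =
     pullback_topology (Her n)
       (\<lambda>A. restrict (\<lambda>ij. A $$ ij) ({..<n} \<times> {..<n}))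
       (product_topology (\<lambda>_. euclidean) ({..<n} \<times> {..<n}))"

definition convex_cone_Her :: "nat \<Rightarrow> complex mat set \<Rightarrow> bool" where
  "convex_cone_Her n K \<longleftrightarrow>
     K \<subseteq> Her n \<and> 0\<^sub>m n n \<in> K \<and>
     (\<forall>A\<in>K. \<forall>B\<in>K. A + B \<in> K) \<and>
     (\<forall>A\<in>K. \<forall>c\<ge>0. complex_of_real c \<cdot>\<^sub>m A \<in> K)"

definition proper_convex_cone :: "nat \<Rightarrow> complex mat set \<Rightarrow> bool" where
  "proper_convex_cone n K \<longleftrightarrow>
     convex_cone_Her n K \<and>
     closedin (Her_topology n) K \<and>
     Her_topology n interior_of K \<noteq> {} \<and>
     \<not> (\<exists>A\<in>Her n. \<exists>B\<in>Her n. B \<noteq> 0\<^sub>m n n \<and> (\<forall>t. A + complex_of_real t \<cdot>\<^sub>m B \<in> K))"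

section \<open>Tensor products\<close>

text \<open>
  The tensor product of the \<open>s \<times> s\<close> and the \<open>d \<times> d\<close> matrices is identified with the
  \<open>sd \<times> sd\<close> matrices through the Kronecker product: the first factor selects the
  \<open>d \<times> d\<close> block, the second one the entry within the block.
\<close>

definition kronecker :: "complex mat \<Rightarrow> complex mat \<Rightarrow> complex mat"  (infixl \<open>\<otimes>\<^sub>K\<close> 70) where
  "A \<otimes>\<^sub>K B = mat (dim_row A * dim_row B) (dim_col A * dim_col B)
     (\<lambda>(p, q). A $$ (p div dim_row B, q div dim_col B) * B $$ (p mod dim_row B, q mod dim_col B))"

definition tensor_block :: "nat \<Rightarrow> complex mat \<Rightarrow> nat \<Rightarrow> nat \<Rightarrow> complex mat" where
  "tensor_block d A i j = mat d d (\<lambda>(k, l). A $$ (i * d + k, j * d + l))"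

text \<open>
  \<open>id_tensor s d r \<phi>\<close> is the map \<open>id \<otimes> \<phi>\<close> on \<open>sd \<times> sd\<close> matrices, for a linear map
  \<open>\<phi>\<close> from \<open>d \<times> d\<close> to \<open>r \<times> r\<close> matrices: it applies \<open>\<phi>\<close> to every \<open>d \<times> d\<close> block.
\<close>

definition id_tensor ::
  "nat \<Rightarrow> nat \<Rightarrow> nat \<Rightarrow> (complex mat \<Rightarrow> complex mat) \<Rightarrow> complex mat \<Rightarrow> complex mat" where
  "id_tensor s d r \<phi> A = mat (s * r) (s * r)
     (\<lambda>(p, q). \<phi> (tensor_block d A (p div r) (q div r)) $$ (p mod r, q mod r))"

definition star_linear :: "nat \<Rightarrow> nat \<Rightarrow> (complex mat \<Rightarrow> complex mat) \<Rightarrow> bool" where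
  "star_linear d r \<phi> \<longleftrightarrow>
     (\<forall>A \<in> carrier_mat d d. \<phi> A \<in> carrier_mat r r) \<and>
     (\<forall>A \<in> carrier_mat d d. \<forall>B \<in> carrier_mat d d. \<phi> (A + B) = \<phi> A + \<phi> B) \<and>
     (\<forall>A \<in> carrier_mat d d. \<forall>c. \<phi> (c \<cdot>\<^sub>m A) = c \<cdot>\<^sub>m \<phi> A) \<and>
     (\<forall>A \<in> carrier_mat d d. \<phi> (mat_adjoint A) = mat_adjoint (\<phi> A))"

text \<open>
  The next two lemmas characterise \<open>id \<otimes> \<phi>\<close> as the additive map with
  \<open>A \<otimes> B \<mapsto> A \<otimes> \<phi>(B)\<close>; they also hold for the transposition in place of \<open>\<phi>\<close>.
\<close>

lemma id_tensor_kronecker: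
  assumes A: "A \<in> carrier_mat s s" and B: "B \<in> carrier_mat d d"
    and car: "\<phi> B \<in> carrier_mat r r"
    and smult: "\<And>c. \<phi> (c \<cdot>\<^sub>m B) = c \<cdot>\<^sub>m \<phi> B"
  shows "id_tensor s d r \<phi> (A \<otimes>\<^sub>K B) = A \<otimes>\<^sub>K \<phi> B"
proof -
  have *: "tensor_block d (A \<otimes>\<^sub>K B) i j = A $$ (i, j) \<cdot>\<^sub>m B" if "i < s" "j < s" for i j
  proof (rule eq_matI)
    fix k l assume kl: "k < dim_row (A $$ (i, j) \<cdot>\<^sub>m B)" "l < dim_col (A $$ (i, j) \<cdot>\<^sub>m B)"
    have lt: "i' * d + k' < s * d" if "i' < s" "k' < d" for i' k' :: nat
    proof -
      have "i' * d + k' < Suc i' * d" using that by simp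
      also have "\<dots> \<le> s * d" using that by (intro mult_right_mono) auto
      finally show ?thesis .
    qed
    show "tensor_block d (A \<otimes>\<^sub>K B) i j $$ (k, l) = (A $$ (i, j) \<cdot>\<^sub>m B) $$ (k, l)"
      using kl A B that lt[of i k] lt[of j l]
      by (auto simp: tensor_block_def kronecker_def)
  qed (use A B in \<open>auto simp: tensor_block_def\<close>)
  show ?thesis
  proof (rule eq_matI)
    fix p q assume pq: "p < dim_row (A \<otimes>\<^sub>K \<phi> B)" "q < dim_col (A \<otimes>\<^sub>K \<phi> B)"
    then have pq': "p < s * r" "q < s * r" using A car by (auto simp: kronecker_def)
    then have "r > 0" "p div r < s" "q div r < s" by (auto simp: less_mult_imp_div_less intro: gr0I)
    then have "id_tensor s d r \<phi> (A \<otimes>\<^sub>K B) $$ (p, q)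
        = A $$ (p div r, q div r) * \<phi> B $$ (p mod r, q mod r)"
      using pq' car by (simp add: id_tensor_def * smult)
    also have "\<dots> = (A \<otimes>\<^sub>K \<phi> B) $$ (p, q)"
      using pq' A car by (simp add: kronecker_def)
    finally show "id_tensor s d r \<phi> (A \<otimes>\<^sub>K B) $$ (p, q) = (A \<otimes>\<^sub>K \<phi> B) $$ (p, q)" .
  qed (use A car in \<open>auto simp: id_tensor_def kronecker_def\<close>)
qed

lemma id_tensor_add:
  assumes A: "A \<in> carrier_mat (s * d) (s * d)" and B: "B \<in> carrier_mat (s * d) (s * d)"
    and car: "\<And>X. X \<in> carrier_mat d d \<Longrightarrow> \<phi> X \<in> carrier_mat r r"
    and add: "\<And>X Y. X \<in> carrier_mat d d \<Longrightarrow> Y \<in> carrier_mat d d \<Longrightarrow> \<phi> (X + Y) = \<phi> X + \<phi> Y"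
  shows "id_tensor s d r \<phi> (A + B) = id_tensor s d r \<phi> A + id_tensor s d r \<phi> B"
proof -
  have bl: "tensor_block d X i j \<in> carrier_mat d d" for X i j
    by (auto simp: tensor_block_def)
  have *: "tensor_block d (A + B) i j = tensor_block d A i j + tensor_block d B i j"
    if "i < s" "j < s" for i j
  proof (rule eq_matI)
    fix k l assume "k < dim_row (tensor_block d A i j + tensor_block d B i j)"
      "l < dim_col (tensor_block d A i j + tensor_block d B i j)"
    then have kl: "k < d" "l < d" by (auto simp: tensor_block_def)
    have lt: "i' * d + k' < s * d" if "i' < s" "k' < d" for i' k' :: nat
    proof -
      have "i' * d + k' < Suc i' * d" using that by simp
      also have "\<dots> \<le> s * d" using that by (intro mult_right_mono) auto
      finally show ?thesis .
    qed
    show "tensor_block d (A + B) i j $$ (k, l) = (tensor_block d A i j + tensor_block d B i j) $$ (k, l)"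
      using kl A B that lt[of i k] lt[of j l] by (auto simp: tensor_block_def)
  qed (auto simp: tensor_block_def)
  show ?thesis
  proof (rule eq_matI)
    fix p q assume "p < dim_row (id_tensor s d r \<phi> A + id_tensor s d r \<phi> B)"
      "q < dim_col (id_tensor s d r \<phi> A + id_tensor s d r \<phi> B)"
    then have pq: "p < s * r" "q < s * r" by (auto simp: id_tensor_def)
    then have "r > 0" "p div r < s" "q div r < s" by (auto simp: less_mult_imp_div_less intro: gr0I)
    then show "id_tensor s d r \<phi> (A + B) $$ (p, q)
        = (id_tensor s d r \<phi> A + id_tensor s d r \<phi> B) $$ (p, q)"
      using pq car[OF bl, of A "p div r" "q div r"] car[OF bl, of B "p div r" "q div r"]
      by (auto simp: id_tensor_def * add[OF bl bl])
  qed (auto simp: id_tensor_def)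
qed

section \<open>Abstract operator systems\<close>

text \<open>
  A system is a function \<open>nat \<Rightarrow> complex mat set\<close> of which only the levels \<open>s \<ge> 1\<close> matter.
\<close>

definition abstract_operator_system :: "nat \<Rightarrow> (nat \<Rightarrow> complex mat set) \<Rightarrow> bool" where
  "abstract_operator_system d C \<longleftrightarrow>
     (\<forall>s\<ge>1. proper_convex_cone (s * d) (C s)) \<and>
     (\<forall>s\<ge>1. \<forall>t\<ge>1. \<forall>A \<in> C s. \<forall>V \<in> carrier_mat s t.
        mat_adjoint (V \<otimes>\<^sub>K 1\<^sub>m d) * A * (V \<otimes>\<^sub>K 1\<^sub>m d) \<in> C t)"

definition system_contained ::
  "(nat \<Rightarrow> complex mat set) \<Rightarrow> (nat \<Rightarrow> complex mat set) \<Rightarrow> bool" where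
  "system_contained C D \<longleftrightarrow> (\<forall>s\<ge>1. C s \<subseteq> D s)"

definition free_spectrahedron :: "nat \<Rightarrow> nat \<Rightarrow> (nat \<Rightarrow> complex mat set) \<Rightarrow> bool" where
  "free_spectrahedron d r C \<longleftrightarrow>
     (\<exists>\<phi>. star_linear d r \<phi> \<and>
        (\<exists>u \<in> Her_topology d interior_of C 1. \<phi> u = 1\<^sub>m r) \<and>
        (\<forall>s\<ge>1. \<forall>A \<in> Her (s * d).
           A \<in> C s \<longleftrightarrow> positive_semidefinite (id_tensor s d r \<phi> A)))"

definition free_numerical_range ::
  "nat \<Rightarrow> nat \<Rightarrow> complex mat \<Rightarrow> (nat \<Rightarrow> complex mat set) \<Rightarrow> bool" where
  "free_numerical_range d r M C \<longleftrightarrow>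
     r \<ge> 1 \<and> abstract_operator_system d C \<and> M \<in> C r \<and>
     (\<forall>D. abstract_operator_system d D \<and> M \<in> D r \<longrightarrow> system_contained C D)"

definition Psd :: "nat \<Rightarrow> nat \<Rightarrow> complex mat set" where
  "Psd d s = {A \<in> Her (s * d). positive_semidefinite A}"

definition Psd_Gamma :: "nat \<Rightarrow> nat \<Rightarrow> complex mat set" where
  "Psd_Gamma d s = {A \<in> Her (s * d). positive_semidefinite (id_tensor s d d transpose_mat A)}"

end

theory Submission
  imports Defs "HOL-Library.Function_Algebras"
begin

text \<open>
  Both statements reduce to one assertion about a biquadratic form. A star-linear map \<open>\<phi>\<close> from
  \<open>d \<times> d\<close> to \<open>r \<times> r\<close> matrices gives \<open>h w' w x y = w'\<^sup>* \<phi>(x y\<^sup>*) w\<close>, sesquilinear in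
  \<open>w', w \<in> \<complex>\<^sup>r\<close> and in \<open>y, x \<in> \<complex>\<^sup>d\<close>; a generator \<open>M\<close> gives such a form through its entries. That level
  one of the system is the whole positive semidefinite cone has two consequences: \<open>h w w x x\<close> is
  nonnegative, and \<open>\<phi>(X) \<ge> 0\<close> forces \<open>X \<ge> 0\<close>. The assertion
  (\<open>tensor_linear_or_antilinear_section\<close>) is that for \<open>r \<le> 2 d - 2\<close> there are vectors
  \<open>w\<^sub>1, \<dots>, w\<^sub>d\<close> in \<open>\<complex>\<^sup>r\<close> with \<open>w\<^sub>a\<^sup>* \<phi>(X) w\<^sub>b = X\<^sub>a\<^sub>b\<close> for all \<open>X\<close>, or with
  \<open>w\<^sub>a\<^sup>* \<phi>(X) w\<^sub>b = X\<^sub>b\<^sub>a\<close> for all \<open>X\<close>. In other words \<open>\<phi>\<close> compresses to the identity or to the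
  transposition.

  To prove it, let \<open>N\<^sub>z\<close> be the space of vectors killed by \<open>\<phi>(X)\<close> for all \<open>X \<ge> 0\<close> with \<open>X z = 0\<close>.
  Since \<open>\<phi>\<close> reflects positivity, \<open>N\<^sub>z\<close> never degenerates (\<open>exists_kernel_vector\<close>), and on
  \<open>N\<^sub>z\<close> the form is a multiple of \<open>z\<^sup>* X z\<close>. The spaces \<open>N\<^sub>z\<close> for the members \<open>z\<close> of a basis are
  independent, so \<open>r < 2 d\<close> leaves some standard basis vector \<open>e\<^sub>k\<close> with a one-dimensional space,
  spanned by \<open>w\<^sub>0\<close> say. Given any basis \<open>z\<close> containing \<open>e\<^sub>k\<close>, the analogous spaces for the planes
  spanned by \<open>e\<^sub>k\<close> and \<open>z\<^sub>j\<close> are independent modulo \<open>w\<^sub>0\<close>; as \<open>1 + 2 (d - 1) > r\<close>, one of them is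
  two-dimensional. There the form is governed by two complex numbers \<open>s\<close> and \<open>t\<close>, and positivity
  together with its reflection force \<open>s t = 0\<close> (\<open>unit_circle_alternative\<close>): the vector \<open>z\<^sub>j\<close> is
  represented linearly or antilinearly relative to \<open>w\<^sub>0\<close>. So every basis containing \<open>e\<^sub>k\<close> has another
  member that is represented in one of the two ways. The vectors represented in a fixed way form
  a subspace, and two proper subspaces can be avoided by a suitable basis
  \<open>e\<^sub>j + \<mu> y\<close>; hence one of them is everything (\<open>all_representable\<close>).

  For a free spectrahedron, compressing the linear matrix inequality by the \<open>w\<^sub>a\<close> gives the
  containment. For a numerical range, reflection of positivity comes from minimality: a positive
  matrix separated from the generator would leave a strictly smaller system
  (\<open>test_system\<close>) around the generator. Then the \<open>w\<^sub>a\<close> compress the generator to the projection onto the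
  maximally entangled vector (up to scale) or to the flip, and the compressions of these two matrices generate
  \<open>Psd\<close> and \<open>Psd_Gamma\<close>.
\<close>

section \<open>Positive semidefinite sesquilinear forms\<close>

locale psd_form = vector_space scale
  for scale :: "complex \<Rightarrow> 'v::ab_group_add \<Rightarrow> 'v"  (infixr \<open>*\<^sub>c\<close> 75) +
  fixes A :: "'v \<Rightarrow> 'v \<Rightarrow> complex"
  assumes add_right: "A u (v + w) = A u v + A u w"
    and scale_right: "A u (c *\<^sub>c v) = c * A u v"
    and herm: "A v u = cnj (A u v)"
    and nonneg: "0 \<le> Re (A v v)"
begin

lemma add_left: "A (u + v) w = A u w + A v w"
  by (metis add_right complex_cnj_add herm)

lemma scale_left: "A (c *\<^sub>c v) w = cnj c * A v w"
  by (metis scale_right complex_cnj_mult herm)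

lemma zero_right [simp]: "A u 0 = 0"
  using add_right[of u 0 0] by simp

lemma sum_right: "A u (\<Sum>k\<in>I. g k) = (\<Sum>k\<in>I. A u (g k))"
  by (induction I rule: infinite_finite_induct) (simp_all add: add_right)

lemma diff_right: "A u (v - w) = A u v - A u w"
  by (metis add_diff_cancel add_diff_eq add_right diff_add_cancel)

lemma diff_left: "A (u - v) w = A u w - A v w"
  by (metis complex_cnj_diff diff_right herm)

lemma diag_real: "A v v = of_real (Re (A v v))"
  using herm[of v v] by (simp add: complex_eq_iff)

lemmas expand = add_left add_right diff_left diff_right scale_left scale_right

text \<open>
  Otherwise \<open>A (w + c u) (w + c u)\<close> would be negative for a small multiple \<open>c\<close> of \<open>- A u w\<close>, because the
  linear term in \<open>c\<close> beats the quadratic one.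
\<close>

lemma isotropic_right:
  assumes "A w w = 0"
  shows "A u w = 0"
proof -
  define a z t where "a = Re (A u u)" and "z = A u w" and "t = 1 / (1 + a)"
  have a: "a \<ge> 0" by (simp add: a_def nonneg)
  have aa: "A u u = of_real a" using diag_real[of u] by (simp add: a_def)
  have wu: "A w u = cnj z" unfolding z_def by (rule herm)
  define c where "c = - of_real t * z"
  have "0 \<le> Re (A (w + c *\<^sub>c u) (w + c *\<^sub>c u))" by (rule nonneg)
  also have "A (w + c *\<^sub>c u) (w + c *\<^sub>c u) = c * cnj z + cnj c * z + c * cnj c * a"
    using assms by (simp add: expand wu aa algebra_simps flip: z_def)
  also have "\<dots> = of_real (- 2 * t + t^2 * a) * (z * cnj z)"
    by (simp add: c_def power2_eq_square algebra_simps)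
  also have "\<dots> = of_real (- 2 * t * (cmod z)^2 + t^2 * a * (cmod z)^2)"
    by (simp only: complex_norm_square[symmetric] of_real_mult[symmetric]) (simp add: algebra_simps)
  also have "- 2 * t * (cmod z)^2 + t^2 * a * (cmod z)^2 = t * (cmod z)^2 * (t * a - 2)"
    by (simp add: algebra_simps power2_eq_square)
  finally have *: "0 \<le> t * (cmod z)^2 * (t * a - 2)" by simp
  have "t > 0" "t * a < 2" using a by (auto simp: t_def field_simps)
  with * have "(cmod z)^2 \<le> 0"
    by (smt (verit) mult_pos_neg mult_pos_pos zero_less_power2)
  then show ?thesis by (simp add: z_def)
qed

lemma isotropic_left: "A w w = 0 \<Longrightarrow> A w u = 0"
  using isotropic_right[of w u] herm[of w u] by simp

lemma quadratic_add_le: "Re (A (u + v) (u + v)) \<le> 2 * Re (A u u) + 2 * Re (A v v)"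
proof -
  have "0 \<le> Re (A (u - v) (u - v))" by (rule nonneg)
  then show ?thesis by (simp add: expand)
qed

text \<open>
  The vector \<open>cnj \<beta> *\<^sub>c w - cnj \<alpha> *\<^sub>c w0\<close> is isotropic, so its product with \<open>w'\<close> vanishes: on the span
  of \<open>w\<close> and \<open>w0\<close> the form has rank one, which determines all remaining products.
\<close>

lemma rank_one_overlap:
  assumes "A w w = \<alpha> * cnj \<alpha>" "A w0 w0 = \<beta> * cnj \<beta>" "A w w0 = \<alpha> * cnj \<beta>"
    and "A w' w0 = \<alpha>' * cnj \<beta>" and "\<beta> \<noteq> 0"
  shows "A w w' = \<alpha> * cnj \<alpha>'"
proof -
  define v where "v = cnj \<beta> *\<^sub>c w - cnj \<alpha> *\<^sub>c w0"
  have "A w0 w = \<beta> * cnj \<alpha>" "A w0 w' = \<beta> * cnj \<alpha>'"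
    using herm[of w0 w] herm[of w0 w'] assms by simp_all
  note * = assms this
  have "A v v = 0" by (simp add: v_def expand * algebra_simps)
  then have "A v w' = 0" by (rule isotropic_left)
  then have "\<beta> * A w w' = \<beta> * (\<alpha> * cnj \<alpha>')" by (simp add: v_def expand * algebra_simps)
  then show ?thesis using assms(5) by simp
qed

end

text \<open>
  In finite dimensions a kernel inclusion \<open>ker A \<subseteq> ker B\<close> already gives an inequality \<open>B \<le> C A\<close>.
  The proof orthogonalises the spanning vectors with respect to \<open>A\<close> one at a time, so that no
  compactness or spectral theorem is involved.
\<close>

lemma psd_form_dominated:
  fixes scale :: "complex \<Rightarrow> 'v::ab_group_add \<Rightarrow> 'v"  (infixr \<open>*\<^sub>c\<close> 75) and g :: "nat \<Rightarrow> 'v"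
  assumes "psd_form scale A" and "psd_form scale B" and ker: "\<And>w. A w w = 0 \<Longrightarrow> B w w = 0"
  shows "\<exists>C. C \<ge> 0 \<and> (\<forall>c. Re (B (\<Sum>i<n. c i *\<^sub>c g i) (\<Sum>i<n. c i *\<^sub>c g i))
                  \<le> C * Re (A (\<Sum>i<n. c i *\<^sub>c g i) (\<Sum>i<n. c i *\<^sub>c g i)))"
proof (induction n arbitrary: g)
  case 0
  interpret A: psd_form scale A by fact
  interpret B: psd_form scale B by fact
  show ?case by (auto intro!: exI[of _ 0])
next
  case (Suc n)
  interpret A: psd_form scale A by fact
  interpret B: psd_form scale B by fact
  define e a b where "e = g n" and "a = Re (A e e)" and "b = Re (B e e)"
  have ab: "A e e = of_real a" "B e e = of_real b" "a \<ge> 0" "b \<ge> 0"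
    using A.diag_real[of e] B.diag_real[of e] A.nonneg B.nonneg by (auto simp: a_def b_def)
  show ?case
  proof (cases "a = 0")
    case True
    then have "A e e = 0" using ab by simp
    then have [simp]: "A e u = 0" "A u e = 0" "B e u = 0" "B u e = 0" for u
      using ker A.isotropic_left A.isotropic_right B.isotropic_left B.isotropic_right by blast+
    have "A (w + c *\<^sub>c e) (w + c *\<^sub>c e) = A w w" "B (w + c *\<^sub>c e) (w + c *\<^sub>c e) = B w w" for c w
      by (simp_all add: A.expand B.expand)
    with Suc.IH[of g] show ?thesis by (simp flip: e_def)
  next
    case False
    then have a: "a > 0" using ab by simp
    \<comment> \<open>the \<open>A\<close>-orthogonal projections of the remaining vectors to the complement of \<open>e\<close>\<close>
    define g' where "g' i = g i - (A e (g i) / a) *\<^sub>c e" for i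
    obtain C where C: "C \<ge> 0" "\<And>c. Re (B (\<Sum>i<n. c i *\<^sub>c g' i) (\<Sum>i<n. c i *\<^sub>c g' i))
                  \<le> C * Re (A (\<Sum>i<n. c i *\<^sub>c g' i) (\<Sum>i<n. c i *\<^sub>c g' i))"
      using Suc.IH[of g'] by blast
    have orth: "A e (\<Sum>i<n. c i *\<^sub>c g' i) = 0" for c
      using a ab by (simp add: A.sum_right A.expand g'_def)
    have "Re (B (\<Sum>i<Suc n. c i *\<^sub>c g i) (\<Sum>i<Suc n. c i *\<^sub>c g i))
       \<le> (2 * C + 2 * b / a) * Re (A (\<Sum>i<Suc n. c i *\<^sub>c g i) (\<Sum>i<Suc n. c i *\<^sub>c g i))" for c
    proof -
      define w where "w = (\<Sum>i<n. c i *\<^sub>c g' i)"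
      define k where "k = c n + (\<Sum>i<n. c i * A e (g i) / a)"
      have split: "(\<Sum>i<Suc n. c i *\<^sub>c g i) = w + k *\<^sub>c e"
        by (simp add: w_def k_def g'_def e_def A.scale_right_diff_distrib A.scale_left_distrib A.scale_sum_left
             sum_subtractf)
      have ew: "A e w = 0" "A w e = 0" using orth[of c] A.herm[of w e] by (auto simp: w_def)
      have "A (w + k *\<^sub>c e) (w + k *\<^sub>c e) = A w w + of_real ((cmod k)^2 * a)"
        by (simp add: A.expand ew ab complex_norm_square del: of_real_power)
      then have 1: "Re (A (w + k *\<^sub>c e) (w + k *\<^sub>c e)) = Re (A w w) + (cmod k)^2 * a" by simp
      have "B (k *\<^sub>c e) (k *\<^sub>c e) = of_real ((cmod k)^2 * b)"
        by (simp add: B.expand ab complex_norm_square del: of_real_power)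
      then have "Re (B (w + k *\<^sub>c e) (w + k *\<^sub>c e)) \<le> 2 * Re (B w w) + 2 * ((cmod k)^2 * b)"
        using B.quadratic_add_le[of w "k *\<^sub>c e"] by simp
      also have "\<dots> \<le> 2 * (C * Re (A w w)) + 2 * ((cmod k)^2 * b)"
        using C(2)[of c] by (simp add: w_def)
      also have "\<dots> \<le> 2 * (C * Re (A w w)) + 2 * ((cmod k)^2 * b)
          + (2 * b / a * Re (A w w) + 2 * C * ((cmod k)^2 * a))"
        using a ab C(1) A.nonneg[of w] by simp
      also have "\<dots> = (2 * C + 2 * b / a) * (Re (A w w) + (cmod k)^2 * a)"
        using a by (simp add: field_simps)
      finally show ?thesis by (simp only: split 1)
    qed
    then show ?thesis using a ab C(1) by (intro exI[of _ "2 * C + 2 * b / a"]) auto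
  qed
qed

section \<open>Underdetermined systems and points of the unit circle\<close>

lemma underdetermined_system:
  fixes g :: "'k \<Rightarrow> nat \<Rightarrow> complex"
  assumes "finite J" and "card J > r"
  obtains c where "\<exists>k\<in>J. c k \<noteq> 0" and "\<And>i. i < r \<Longrightarrow> (\<Sum>k\<in>J. c k * g k i) = 0"
proof -
  have "\<exists>c. (\<exists>k\<in>J. c k \<noteq> 0) \<and> (\<forall>i<r. (\<Sum>k\<in>J. c k * g k i) = 0)"
    using assms
  proof (induction r arbitrary: J g)
    case 0
    then obtain k where "k \<in> J" by fastforce
    then show ?case by (intro exI[of _ "\<lambda>_. 1"]) auto
  next
    case (Suc r)
    show ?case
    proof (cases "\<exists>k\<in>J. g k r \<noteq> 0")
      case False
      obtain c where "\<exists>k\<in>J. c k \<noteq> 0" "\<forall>i<r. (\<Sum>k\<in>J. c k * g k i) = 0"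
        using Suc.IH[of J g] Suc.prems by auto
      moreover have "(\<Sum>k\<in>J. c k * g k r) = 0" using False by (intro sum.neutral) auto
      ultimately show ?thesis by (intro exI[of _ c]) (auto simp: less_Suc_eq)
    next
      case True
      then obtain m where m: "m \<in> J" "g m r \<noteq> 0" by blast
      define g' where "g' k i = g k i - g k r / g m r * g m i" for k i
      have "card (J - {m}) > r" using Suc.prems m by simp
      then obtain c where c: "\<exists>k\<in>J-{m}. c k \<noteq> 0" "\<And>i. i < r \<Longrightarrow> (\<Sum>k\<in>J-{m}. c k * g' k i) = 0"
        using Suc.IH[of "J - {m}" g'] Suc.prems by auto
      define c' where "c' k = (if k = m then - (\<Sum>k\<in>J-{m}. c k * (g k r / g m r)) else c k)" for k
      have eq: "(\<Sum>k\<in>J. c' k * g k i) = (\<Sum>k\<in>J-{m}. c k * g' k i)" for i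
      proof -
        have "(\<Sum>k\<in>J. c' k * g k i) = c' m * g m i + (\<Sum>k\<in>J-{m}. c' k * g k i)"
          using Suc.prems m by (simp add: sum.remove)
        also have "(\<Sum>k\<in>J-{m}. c' k * g k i) = (\<Sum>k\<in>J-{m}. c k * g k i)"
          by (rule sum.cong) (auto simp: c'_def)
        finally show ?thesis
          by (simp add: g'_def c'_def algebra_simps sum_subtractf sum_distrib_left)
      qed
      have "(\<Sum>k\<in>J. c' k * g k i) = 0" if "i < Suc r" for i
      proof (cases "i = r")
        case True
        then show ?thesis using m by (simp add: eq g'_def)
      next
        case False
        then show ?thesis using that c(2)[of i] by (simp add: eq)
      qed
      moreover have "\<exists>k\<in>J. c' k \<noteq> 0" using c(1) by (auto simp: c'_def)
      ultimately show ?thesis by blast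
    qed
  qed
  then show ?thesis using that by blast
qed

text \<open>
  As \<open>\<beta>\<close> runs through the unit circle, \<open>\<beta> s + cnj \<beta> cnj t\<close> runs through an ellipse with semi-axes
  \<open>|s| + |t|\<close> and \<open>||s| - |t||\<close>. It covers the unit circle without leaving the unit disc only if
  it is the unit circle itself.
\<close>

lemma unit_circle_alternative:
  fixes s t :: complex
  assumes le: "\<And>\<beta>. cmod \<beta> = 1 \<Longrightarrow> cmod (\<beta> * s + cnj \<beta> * cnj t) \<le> 1"
    and attained: "\<And>\<zeta>. cmod \<zeta> = 1 \<Longrightarrow> \<exists>\<beta>. cmod \<beta> = 1 \<and> \<beta> * s + cnj \<beta> * cnj t = cnj \<zeta>"
  shows "(t = 0 \<and> cmod s = 1) \<or> (s = 0 \<and> cmod t = 1)"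
proof -
  define c where "c = s * t"
  have expand: "(cmod (\<beta> * s + cnj \<beta> * cnj t))^2 = (cmod s)^2 + (cmod t)^2 + 2 * Re (\<beta>^2 * c)"
    if "cmod \<beta> = 1" for \<beta>
  proof -
    have "(cmod (u + v))^2 = (cmod u)^2 + (cmod v)^2 + 2 * Re (u * cnj v)" for u v :: complex
      unfolding cmod_power2 by (simp add: power2_eq_square algebra_simps)
    then have "(cmod (\<beta> * s + cnj \<beta> * cnj t))^2
        = (cmod (\<beta> * s))^2 + (cmod (cnj \<beta> * cnj t))^2 + 2 * Re (\<beta> * s * cnj (cnj \<beta> * cnj t))" .
    then show ?thesis using that by (simp add: norm_mult c_def power2_eq_square mult_ac)
  qed
  have "c = 0"
  proof (rule ccontr)
    assume c: "c \<noteq> 0"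
    \<comment> \<open>the direction of the major semi-axis, where the bound gives \<open>|s| + |t| \<le> 1\<close>\<close>
    define \<beta>0 where "\<beta>0 = csqrt (cnj c / of_real (cmod c))"
    have b0: "\<beta>0^2 = cnj c / of_real (cmod c)" by (simp add: \<beta>0_def)
    then have "(cmod \<beta>0)^2 = 1" using c by (simp add: norm_divide flip: norm_power)
    then have n0: "cmod \<beta>0 = 1" by (simp add: power2_eq_1_iff) (smt (verit) norm_ge_zero)
    have "\<beta>0^2 * c = of_real (cmod c)"
      using c complex_norm_square[of c] unfolding b0 by (simp add: field_simps power2_eq_square)
    then have "(cmod s)^2 + (cmod t)^2 + 2 * cmod c \<le> 1"
      using expand[OF n0] power_le_one[OF norm_ge_zero le[OF n0], of 2] by simp
    then have aligned: "\<beta>^2 * c = of_real (cmod c)"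
      if "cmod \<beta> = 1" "cmod (\<beta> * s + cnj \<beta> * cnj t) = 1" for \<beta>
    proof -
      have "cmod c \<le> Re (\<beta>^2 * c)"
        using expand[OF that(1)] that(2) \<open>_ \<le> 1\<close> by simp
      moreover have n: "cmod (\<beta>^2 * c) = cmod c" by (simp add: norm_mult norm_power that)
      ultimately have "Re (\<beta>^2 * c) = cmod (\<beta>^2 * c)"
        using complex_Re_le_cmod[of "\<beta>^2 * c"] by linarith
      moreover from this have "Im (\<beta>^2 * c) = 0"
        by (metis cmod_power2 add_cancel_right_right power_eq_0_iff zero_neq_numeral)
      ultimately show ?thesis using n by (simp add: complex_eq_iff)
    qed
    obtain \<beta> where \<beta>: "cmod \<beta> = 1" "\<beta> * s + cnj \<beta> * cnj t = cnj 1"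
      using attained[of 1] by auto
    obtain \<gamma> where \<gamma>: "cmod \<gamma> = 1" "\<gamma> * s + cnj \<gamma> * cnj t = cnj \<i>"
      using attained[of \<i>] by auto
    \<comment> \<open>both values \<open>1\<close> and \<open>- \<i>\<close> would be attained at an end of the same axis\<close>
    have "\<beta>^2 * c = \<gamma>^2 * c" using aligned[of \<beta>] aligned[of \<gamma>] \<beta> \<gamma> by simp
    then have "\<gamma> = \<beta> \<or> \<gamma> = - \<beta>" using c by (auto simp: power2_eq_iff)
    then show False
    proof
      assume "\<gamma> = \<beta>"
      then show False using \<beta> \<gamma> by (auto simp: complex_eq_iff)
    next
      assume "\<gamma> = - \<beta>"
      then have "- (\<beta> * s + cnj \<beta> * cnj t) = cnj \<i>" using \<gamma>(2) by simp
      then have "- cnj 1 = cnj \<i>" by (simp only: \<beta>(2))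
      then show False by (simp add: complex_eq_iff)
    qed
  qed
  obtain \<beta> where \<beta>: "cmod \<beta> = 1" "\<beta> * s + cnj \<beta> * cnj t = cnj 1"
    using attained[of 1] by auto
  with \<open>c = 0\<close> expand[OF \<beta>(1)] have "(cmod s)^2 + (cmod t)^2 = 1" by simp
  with \<open>c = 0\<close> show ?thesis
    by (auto simp: c_def power2_eq_1_iff) (smt (verit) norm_ge_zero)+
qed

section \<open>Biquadratic forms\<close>

text \<open>
  The model is \<open>h w' w x y = w'\<^sup>* \<phi>(x y\<^sup>*) w\<close> for a positive map \<open>\<phi>\<close>. The two arguments \<open>w', w\<close> and the
  two arguments \<open>y, x\<close> play symmetric roles, and fixing either pair on the diagonal leaves a
  positive semidefinite form in the other.
\<close>

locale biquadratic_form = W: vector_space sw + V: vector_space sv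
  for sw :: "complex \<Rightarrow> 'w::ab_group_add \<Rightarrow> 'w"  (infixr \<open>\<cdot>\<^sub>w\<close> 75)
    and sv :: "complex \<Rightarrow> 'v::ab_group_add \<Rightarrow> 'v"  (infixr \<open>\<cdot>\<^sub>v\<close> 75) +
  fixes h :: "'w \<Rightarrow> 'w \<Rightarrow> 'v \<Rightarrow> 'v \<Rightarrow> complex"
  assumes add_W: "h w (u + v) x y = h w u x y + h w v x y"
    and scale_W: "h w (c \<cdot>\<^sub>w u) x y = c * h w u x y"
    and add_V: "h w u (x + x') y = h w u x y + h w u x' y"
    and scale_V: "h w u (c \<cdot>\<^sub>v x) y = c * h w u x y"
    and herm: "h u w y x = cnj (h w u x y)"
    and nonneg: "0 \<le> Re (h w w x x)"
begin

sublocale psd_W: psd_form sw "\<lambda>u w. h u w x x" for x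
  by unfold_locales (auto simp: add_W scale_W nonneg intro: herm)

sublocale psd_V: psd_form sv "\<lambda>y x. h w w x y" for w
  by unfold_locales (auto simp: add_V scale_V nonneg intro: herm)

lemma add_W': "h (u + v) w x y = h u w x y + h v w x y"
  by (metis add_W complex_cnj_add herm)

lemma scale_W': "h (c \<cdot>\<^sub>w u) w x y = cnj c * h u w x y"
  by (metis scale_W complex_cnj_mult herm)

lemma add_V': "h w u x (y + y') = h w u x y + h w u x y'"
  by (metis add_V complex_cnj_add herm)

lemma scale_V': "h w u x (c \<cdot>\<^sub>v y) = cnj c * h w u x y"
  by (metis scale_V complex_cnj_mult herm)

lemma diff_V: "h w u (x - x') y = h w u x y - h w u x' y"
  by (metis add_V add_diff_cancel diff_add_cancel)

lemma diff_V': "h w u x (y - y') = h w u x y - h w u x y'"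
  by (metis diff_V complex_cnj_diff herm)

lemma zero_V: "h w u 0 y = 0"
  using add_V[of w u 0 0 y] by simp

lemma sum_V: "h w u (\<Sum>i\<in>I. x i) y = (\<Sum>i\<in>I. h w u (x i) y)"
  by (induction I rule: infinite_finite_induct) (auto simp: add_V zero_V)

lemmas expand_W = add_W add_W' scale_W scale_W'
lemmas expand_V = add_V add_V' scale_V scale_V' diff_V diff_V'

lemma polarization:
  assumes "\<And>c. h w u (x + c \<cdot>\<^sub>v y) (x + c \<cdot>\<^sub>v y) = 0" and "h w u y y = 0"
  shows "h w u x y = 0"
proof -
  have *: "cnj c * h w u x y + c * h w u y x = 0" for c
    using assms(1)[of c] assms(1)[of 0] assms(2) by (simp add: expand_V add.commute)
  from *[of 1] *[of \<i>] have "h w u x y + h w u y x = 0" "h w u y x = h w u x y"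
    by (auto simp: field_simps)
  then show ?thesis by simp
qed

text \<open>
  Null vectors are those annihilated by \<open>\<phi>(X)\<close> for every \<open>X\<close>. They may occur in the applications to
  numerical ranges, so independence below is always understood modulo null vectors.
\<close>

definition null :: "'w \<Rightarrow> bool" where
  "null w \<longleftrightarrow> (\<forall>w' x y. h w' w x y = 0)"

lemma nullI_diagonal: "(\<And>x. h w w x x = 0) \<Longrightarrow> null w"
  unfolding null_def by (intro allI, rule polarization) (auto intro: psd_W.isotropic_right)

end

section \<open>Kernels at a vector\<close>

text \<open>
  Faithfulness is the axiom \<open>separation\<close>. With \<open>X = (\<Sum>i\<in>I. f\<^sub>i f\<^sub>i\<^sup>*) - \<epsilon> v v\<^sup>*\<close>, its hypotheses
  make \<open>z\<^sup>* X z\<close> negative and its conclusion says that \<open>\<phi>(X)\<close> is not positive semidefinite. The vectors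
  \<open>b\<close> bound the dimension of the first space modulo null vectors, and \<open>e\<close> is an orthonormal basis of the
  second one as far as \<open>h\<close> and \<open>ip\<close> can see, which allows functions on all of \<open>nat\<close> as a model.
\<close>

locale faithful_biquadratic_form = biquadratic_form sw sv h + inner: psd_form sv ip
  for sw :: "complex \<Rightarrow> 'w::ab_group_add \<Rightarrow> 'w"  (infixr \<open>\<cdot>\<^sub>w\<close> 75)
    and sv :: "complex \<Rightarrow> 'v::ab_group_add \<Rightarrow> 'v"  (infixr \<open>\<cdot>\<^sub>v\<close> 75) and h ip +
  fixes r d :: nat and b :: "nat \<Rightarrow> 'w" and e :: "nat \<Rightarrow> 'v"
  assumes span_W: "\<exists>c. \<forall>w' x y. h w' w x y = (\<Sum>i<r. c i * h w' (b i) x y)"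
    and orthonormal: "i < d \<Longrightarrow> j < d \<Longrightarrow> ip (e i) (e j) = of_bool (i = j)"
    and span_V: "h w' w x y = (\<Sum>i<d. ip (e i) x * h w' w (e i) y)"
    and parseval: "ip y x = (\<Sum>i<d. ip y (e i) * ip (e i) x)"
    and separation: "finite (I :: nat set) \<Longrightarrow> (\<And>i. i \<in> I \<Longrightarrow> ip z (f i) = 0) \<Longrightarrow> ip z v \<noteq> 0 \<Longrightarrow> 0 < \<epsilon> \<Longrightarrow>
      \<exists>w. (\<Sum>i\<in>I. Re (h w w (f i) (f i))) < \<epsilon> * Re (h w w v v)"
begin

text \<open>
  If every common zero of the forms at the \<open>f i\<close> were a zero of the form at \<open>v\<close>, domination would
  give \<open>\<phi>(v v\<^sup>*) \<le> C \<phi>(\<Sum>i\<in>I. f\<^sub>i f\<^sub>i\<^sup>*)\<close>, contradicting separation for a small \<open>\<epsilon>\<close>.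
\<close>

lemma exists_kernel_vector:
  fixes f :: "nat \<Rightarrow> 'v"
  assumes I: "finite I" and orth: "\<And>i. i \<in> I \<Longrightarrow> ip z (f i) = 0" and v: "ip z v \<noteq> 0"
  shows "\<exists>w. (\<forall>i\<in>I. h w w (f i) (f i) = 0) \<and> h w w v v \<noteq> 0"
proof (rule ccontr)
  assume neg: "\<not> ?thesis"
  define A where "A u w = (\<Sum>i\<in>I. h u w (f i) (f i))" for u w
  define B where "B u w = h u w v v" for u w
  interpret A: psd_form sw A
    by unfold_locales (auto simp: A_def sum.distrib sum_distrib_left expand_W nonneg sum_nonneg
        intro: sum.cong herm)
  have B: "psd_form sw B"
    unfolding B_def by (rule psd_W.psd_form_axioms)
  have ker: "B w w = 0" if "A w w = 0" for w
  proof -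
    have "(\<Sum>i\<in>I. Re (h w w (f i) (f i))) = 0"
      using that by (metis A_def Re_sum zero_complex.simps(1))
    then have "Re (h w w (f i) (f i)) = 0" if "i \<in> I" for i
      using I that by (subst (asm) sum_nonneg_eq_0_iff) (auto simp: nonneg)
    then have "h w w (f i) (f i) = 0" if "i \<in> I" for i
      using that psd_W.diag_real[of w "f i"] by simp
    then show ?thesis using neg by (auto simp: B_def)
  qed
  obtain C where C: "C \<ge> 0" "\<And>c. Re (B (\<Sum>i<r. c i \<cdot>\<^sub>w b i) (\<Sum>i<r. c i \<cdot>\<^sub>w b i))
                  \<le> C * Re (A (\<Sum>i<r. c i \<cdot>\<^sub>w b i) (\<Sum>i<r. c i \<cdot>\<^sub>w b i))"
    using psd_form_dominated[OF A.psd_form_axioms B ker] by blast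
  obtain w where w: "(\<Sum>i\<in>I. Re (h w w (f i) (f i))) < 1 / (C + 1) * Re (h w w v v)"
    using separation[of I z f v "1 / (C + 1)"] I orth v C(1) by auto
  obtain c where c: "\<And>w' x y. h w' w x y = (\<Sum>i<r. c i * h w' (b i) x y)"
    using span_W[of w] by blast
  define w0 where "w0 = (\<Sum>i<r. c i \<cdot>\<^sub>w b i)"
  have "h w' w x x = h w' w0 x x" for w' x
    by (simp add: c w0_def psd_W.sum_right scale_W)
  then have eq: "h w w x x = h w0 w0 x x" for x
    by (metis psd_W.herm)
  have "Re (h w w v v) \<le> C * (\<Sum>i\<in>I. Re (h w w (f i) (f i)))"
    using C(2)[of c] by (simp add: A_def B_def eq flip: w0_def)
  moreover have "0 \<le> (\<Sum>i\<in>I. Re (h w w (f i) (f i)))"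
    by (intro sum_nonneg nonneg)
  moreover have "(C + 1) * (\<Sum>i\<in>I. Re (h w w (f i) (f i))) < Re (h w w v v)"
    using w C(1) by (simp add: field_simps)
  ultimately show False by (simp add: algebra_simps)
qed

text \<open>
  In the model, \<open>w\<close> is killed by \<open>\<phi>(X)\<close> for all positive semidefinite \<open>X\<close> with \<open>X z = 0\<close>.
\<close>

definition kernel_at :: "'v \<Rightarrow> 'w \<Rightarrow> bool" where
  "kernel_at z w \<longleftrightarrow> (\<forall>p. ip z p = 0 \<longrightarrow> h w w p p = 0)"

lemma kernel_at_orthogonal:
  assumes "kernel_at z w" "ip z p = 0" "ip z q = 0"
  shows "h w' w p q = 0" "h w w' p q = 0"
proof -
  have *: "h w' w p q = 0" if "ip z p = 0" "ip z q = 0" for p q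
    by (rule polarization; rule psd_W.isotropic_right)
      (use that assms(1) in \<open>auto simp: kernel_at_def inner.expand\<close>)
  show "h w' w p q = 0" "h w w' p q = 0"
    using *[of p q] *[of q p] assms herm[of w w' p q] by simp_all
qed

text \<open>
  A positive form in \<open>x\<close> that vanishes on the hyperplane orthogonal to \<open>z\<close> depends only on the
  coordinate \<open>ip z x\<close>.
\<close>

lemma kernel_at_form:
  assumes "kernel_at z w" "ip z f = 1"
  shows "h w w x y = h w w f f * ip z x * ip y z"
proof -
  have dec: "h w w u y = ip z u * h w w f y" for u y
  proof -
    have "ip z (u - ip z u \<cdot>\<^sub>v f) = 0" using assms(2) by (simp add: inner.expand)
    then have "h w w (u - ip z u \<cdot>\<^sub>v f) (u - ip z u \<cdot>\<^sub>v f) = 0"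
      using assms(1) by (simp add: kernel_at_def)
    then have "h w w (u - ip z u \<cdot>\<^sub>v f) y = 0" by (rule psd_V.isotropic_right)
    then show ?thesis by (simp add: expand_V)
  qed
  have "h w w f y = cnj (ip z y) * h w w f f"
    by (metis dec herm complex_cnj_mult)
  then show ?thesis using dec[of x y] inner.herm[of y z] by (simp add: mult_ac)
qed

lemma null_if_kernel_at:
  assumes "kernel_at z w" "ip z f = 1" "h w w f f = 0"
  shows "null w"
  by (rule nullI_diagonal) (subst kernel_at_form[OF assms(1,2)], simp add: assms(3))

text \<open>
  The coordinates with respect to \<open>b\<close> turn this into a homogeneous system of \<open>r\<close> equations in more
  than \<open>r\<close> unknowns.
\<close>

lemma exists_relation:
  assumes "finite J" "card J > r"
  obtains c where "\<exists>k\<in>J. c k \<noteq> 0" and "\<And>w' x y. (\<Sum>k\<in>J. c k * h w' (g k) x y) = 0"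
proof -
  have "\<forall>w. \<exists>c. \<forall>w' x y. h w' w x y = (\<Sum>i<r. c i * h w' (b i) x y)"
    using span_W by blast
  from choice[OF this] obtain \<rho>
    where \<rho>: "\<forall>w w' x y. h w' w x y = (\<Sum>i<r. \<rho> w i * h w' (b i) x y)" by blast
  obtain c where c: "\<exists>k\<in>J. c k \<noteq> 0" "\<And>i. i < r \<Longrightarrow> (\<Sum>k\<in>J. c k * \<rho> (g k) i) = 0"
    using underdetermined_system[OF assms, where g = "\<lambda>k. \<rho> (g k)"] by blast
  have "(\<Sum>k\<in>J. c k * h w' (g k) x y) = 0" for w' x y
  proof -
    have "(\<Sum>k\<in>J. c k * h w' (g k) x y) = (\<Sum>k\<in>J. \<Sum>i<r. c k * \<rho> (g k) i * h w' (b i) x y)"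
    proof (intro sum.cong[OF refl])
      fix k
      have "h w' (g k) x y = (\<Sum>i<r. \<rho> (g k) i * h w' (b i) x y)" using \<rho> by blast
      then show "c k * h w' (g k) x y = (\<Sum>i<r. c k * \<rho> (g k) i * h w' (b i) x y)"
        by (simp add: sum_distrib_left mult.assoc)
    qed
    also have "\<dots> = (\<Sum>i<r. (\<Sum>k\<in>J. c k * \<rho> (g k) i) * h w' (b i) x y)"
      by (subst sum.swap) (simp add: sum_distrib_right)
    also have "\<dots> = 0" using c(2) by simp
    finally show ?thesis .
  qed
  then show ?thesis using that c(1) by blast
qed

text \<open>
  The second clause is the expansion \<open>x = (\<Sum>i<d. ip (z i) x \<cdot>\<^sub>v f i)\<close>, required only as far as \<open>h\<close>
  can see it.
\<close>

definition dual_bases :: "(nat \<Rightarrow> 'v) \<Rightarrow> (nat \<Rightarrow> 'v) \<Rightarrow> bool" where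
  "dual_bases f z \<longleftrightarrow> (\<forall>i<d. \<forall>j<d. ip (z i) (f j) = of_bool (i = j)) \<and>
     (\<forall>w' w x y. h w' w x y = (\<Sum>i<d. ip (z i) x * h w' w (f i) y))"

lemma kernel_atI:
  assumes "dual_bases f z" "k < d" "\<And>i. i < d \<Longrightarrow> i \<noteq> k \<Longrightarrow> h w w (f i) (f i) = 0"
  shows "kernel_at (z k) w"
  unfolding kernel_at_def
proof (intro allI impI)
  fix p assume p: "ip (z k) p = 0"
  have "h w w p p = (\<Sum>i<d. ip (z i) p * h w w (f i) p)"
    using assms(1) unfolding dual_bases_def by blast
  also have "\<dots> = 0"
  proof (intro sum.neutral ballI)
    fix i assume "i \<in> {..<d}"
    then show "ip (z i) p * h w w (f i) p = 0"
      using p assms(3)[of i] psd_V.isotropic_left[of w "f i" p] psd_V.isotropic_right[of w "f i" p]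
      by (cases "i = k") auto
  qed
  finally show "h w w p p = 0" .
qed

lemma kernel_atD:
  assumes "dual_bases f z" "k < d" "kernel_at (z k) w" "i < d" "i \<noteq> k"
  shows "h w w (f i) (f i) = 0"
proof -
  have "ip (z k) (f i) = 0" using assms(1,2,4,5) unfolding dual_bases_def by auto
  then show ?thesis using assms(3) unfolding kernel_at_def by blast
qed

lemma exists_kernel_at:
  assumes "dual_bases f z" "k < d"
  shows "\<exists>w. kernel_at (z k) w \<and> \<not> null w"
proof -
  have "\<exists>w. (\<forall>i\<in>{..<d} - {k}. h w w (f i) (f i) = 0) \<and> h w w (f k) (f k) \<noteq> 0"
  proof (rule exists_kernel_vector[where z = "z k"])
    have "\<forall>i<d. ip (z k) (f i) = of_bool (k = i)" using assms unfolding dual_bases_def by blast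
    then show "ip (z k) (f i) = 0" if "i \<in> {..<d} - {k}" for i using that by auto
    show "ip (z k) (f k) \<noteq> 0" using assms \<open>\<forall>i<d. _\<close> by simp
  qed simp
  then obtain w where w: "\<forall>i\<in>{..<d} - {k}. h w w (f i) (f i) = 0" "h w w (f k) (f k) \<noteq> 0" by blast
  then have "kernel_at (z k) w" by (intro kernel_atI[OF assms]) auto
  with w(2) show ?thesis unfolding null_def by blast
qed

lemma dual_bases_orthonormal: "dual_bases e e"
  unfolding dual_bases_def by (intro conjI allI impI; rule orthonormal span_V)

lemma normalize_kernel_at:
  assumes "kernel_at z w" "ip z f = 1" "\<not> null w"
  obtains c where "c \<noteq> 0" "\<And>x y. h (c \<cdot>\<^sub>w w) (c \<cdot>\<^sub>w w) x y = ip z x * ip y z"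
proof -
  define a where "a = Re (h w w f f)"
  have a: "h w w f f = of_real a" unfolding a_def by (rule psd_W.diag_real)
  have "a \<noteq> 0" using null_if_kernel_at[OF assms(1,2)] assms(3) a by auto
  moreover have "a \<ge> 0" unfolding a_def by (rule nonneg)
  ultimately have "a > 0" by simp
  then have "(1 / sqrt a) * ((1 / sqrt a) * a) = 1" by (simp add: field_simps)
  then have *: "complex_of_real (1 / sqrt a) * (complex_of_real (1 / sqrt a) * of_real a) = 1"
    by (metis of_real_1 of_real_mult)
  show ?thesis
  proof (rule that[of "complex_of_real (1 / sqrt a)"])
    show "complex_of_real (1 / sqrt a) \<noteq> 0" using \<open>a > 0\<close> by simp
    fix x y
    have "h (of_real (1 / sqrt a) \<cdot>\<^sub>w w) (of_real (1 / sqrt a) \<cdot>\<^sub>w w) x y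
       = (complex_of_real (1 / sqrt a) * (complex_of_real (1 / sqrt a) * of_real a)) * (ip z x * ip y z)"
      by (simp add: expand_W kernel_at_form[OF assms(1,2), of x y] a)
    then show "h (of_real (1 / sqrt a) \<cdot>\<^sub>w w) (of_real (1 / sqrt a) \<cdot>\<^sub>w w) x y = ip z x * ip y z"
      by (simp only: *) simp
  qed
qed

lemma kernel_at_combination:
  assumes "kernel_at z u" "kernel_at z v"
  shows "kernel_at z (a \<cdot>\<^sub>w u + c \<cdot>\<^sub>w v)"
  unfolding kernel_at_def
proof (intro allI impI)
  fix p assume p: "ip z p = 0"
  show "h (a \<cdot>\<^sub>w u + c \<cdot>\<^sub>w v) (a \<cdot>\<^sub>w u + c \<cdot>\<^sub>w v) p p = 0"
    using kernel_at_orthogonal[OF assms(1) p p] kernel_at_orthogonal[OF assms(2) p p]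
    by (simp add: expand_W)
qed

lemma null_combinationD:
  assumes "null (a \<cdot>\<^sub>w w + c \<cdot>\<^sub>w u)" "c \<noteq> 0"
  shows "h w' u x y = - a / c * h w' w x y"
proof -
  have "a * h w' w x y + c * h w' u x y = 0"
    using assms(1) by (simp add: null_def expand_W)
  then have "c * h w' u x y = - a * h w' w x y" by (simp add: add_eq_0_iff)
  then show ?thesis using assms(2) by (simp add: field_simps)
qed

lemma null_scaleD: "null (c \<cdot>\<^sub>w w) \<Longrightarrow> c \<noteq> 0 \<Longrightarrow> null w"
  by (simp add: null_def expand_W)

text \<open>
  The kernels at the standard basis vectors are independent: in a relation between their elements,
  evaluation at \<open>e m\<close> isolates the component at \<open>e m\<close>. If each of them had dimension at least two
  modulo null vectors, there would be \<open>2 * d\<close> independent vectors in a space of dimension \<open>r\<close>.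
\<close>

lemma exists_simple_direction:
  assumes "r < 2 * d"
  shows "\<exists>k<d. \<exists>w. kernel_at (e k) w \<and> \<not> null w \<and>
    (\<forall>u. kernel_at (e k) u \<longrightarrow> (\<exists>c. \<forall>w' x y. h w' u x y = c * h w' w x y))"
proof (rule ccontr)
  assume neg: "\<not> ?thesis"
  have "\<forall>k. \<exists>wu. k < d \<longrightarrow> kernel_at (e k) (fst wu) \<and> \<not> null (fst wu) \<and> kernel_at (e k) (snd wu) \<and>
      (\<nexists>c. \<forall>w' x y. h w' (snd wu) x y = c * h w' (fst wu) x y)"
  proof
    fix k
    show "\<exists>wu. k < d \<longrightarrow> kernel_at (e k) (fst wu) \<and> \<not> null (fst wu) \<and> kernel_at (e k) (snd wu) \<and>
      (\<nexists>c. \<forall>w' x y. h w' (snd wu) x y = c * h w' (fst wu) x y)"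
    proof (cases "k < d")
      case True
      then obtain w where w: "kernel_at (e k) w" "\<not> null w"
        using exists_kernel_at[OF dual_bases_orthonormal] by blast
      with neg True obtain u where u: "kernel_at (e k) u" "\<nexists>c. \<forall>w' x y. h w' u x y = c * h w' w x y"
        by blast
      show ?thesis by (rule exI[of _ "(w, u)"]) (use w u in simp)
    qed simp
  qed
  from choice[OF this] obtain wu where wu: "\<And>k. k < d \<Longrightarrow> kernel_at (e k) (fst (wu k))"
    "\<And>k. k < d \<Longrightarrow> \<not> null (fst (wu k))" "\<And>k. k < d \<Longrightarrow> kernel_at (e k) (snd (wu k))"
    "\<And>k. k < d \<Longrightarrow> \<nexists>c. \<forall>w' x y. h w' (snd (wu k)) x y = c * h w' (fst (wu k)) x y"
    by blast
  define g where "g i = (if snd i then fst (wu (fst i)) else snd (wu (fst i)))" for i :: "nat \<times> bool"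
  define J :: "(nat \<times> bool) set" where "J = {..<d} \<times> UNIV"
  have J: "finite J" "card J > r" using assms by (auto simp: J_def card_cartesian_product)
  obtain c where c: "\<exists>i\<in>J. c i \<noteq> 0" "\<And>w' x y. (\<Sum>i\<in>J. c i * h w' (g i) x y) = 0"
    using exists_relation[OF J] by blast
  have "c (m, True) = 0 \<and> c (m, False) = 0" if m: "m < d" for m
  proof -
    define v where "v = c (m, True) \<cdot>\<^sub>w fst (wu m) + c (m, False) \<cdot>\<^sub>w snd (wu m)"
    have ker: "kernel_at (e m) v" unfolding v_def by (intro kernel_at_combination wu m)
    have zero: "h v (g i) (e m) (e m) = 0" if "i \<in> J" "fst i \<noteq> m" for i
    proof -
      have "kernel_at (e (fst i)) (g i)" "ip (e (fst i)) (e m) = 0"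
        using that wu m by (auto simp: g_def J_def orthonormal)
      then show ?thesis by (auto intro: kernel_at_orthogonal)
    qed
    have "0 = (\<Sum>i\<in>J. c i * h v (g i) (e m) (e m))" using c(2) by simp
    also have "\<dots> = (\<Sum>i\<in>{(m, True), (m, False)}. c i * h v (g i) (e m) (e m))"
      using m J(1) zero by (intro sum.mono_neutral_right) (auto simp: J_def)
    also have "\<dots> = h v (c (m, True) \<cdot>\<^sub>w fst (wu m) + c (m, False) \<cdot>\<^sub>w snd (wu m)) (e m) (e m)"
      by (simp add: g_def add_W scale_W)
    also have "\<dots> = h v v (e m) (e m)" by (simp only: v_def)
    finally have "null v" using null_if_kernel_at[OF ker, of "e m"] m by (simp add: orthonormal)
    then have nv: "null (c (m, True) \<cdot>\<^sub>w fst (wu m) + c (m, False) \<cdot>\<^sub>w snd (wu m))" by (simp add: v_def)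
    have F: "c (m, False) = 0"
      using null_combinationD[OF nv] wu(4)[OF m] by blast
    with nv have "null (c (m, True) \<cdot>\<^sub>w fst (wu m))" by simp
    then have "c (m, True) = 0" using null_scaleD wu(2)[OF m] by blast
    with F show ?thesis by simp
  qed
  then have "c i = 0" if "i \<in> J" for i
    using that by (cases i; cases "snd i") (auto simp: J_def)
  with c(1) show False by blast
qed

end

section \<open>Vectors represented linearly or antilinearly\<close>

locale simple_direction = faithful_biquadratic_form sw sv h ip r d b e
  for sw :: "complex \<Rightarrow> 'w::ab_group_add \<Rightarrow> 'w"  (infixr \<open>\<cdot>\<^sub>w\<close> 75)
    and sv :: "complex \<Rightarrow> 'v::ab_group_add \<Rightarrow> 'v"  (infixr \<open>\<cdot>\<^sub>v\<close> 75) and h ip r d b e +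
  fixes k :: nat and w0 :: 'w
  assumes k: "k < d"
    and w0: "h w0 w0 x y = ip (e k) x * ip y (e k)"
    and simple: "kernel_at (e k) u \<Longrightarrow> \<exists>c. \<forall>w' x y. h w' u x y = c * h w' w0 x y"
begin

lemma kernel_at_w0: "kernel_at (e k) w0"
  by (simp add: kernel_at_def w0)

text \<open>
  The flag \<open>s\<close> selects the linear (\<open>True\<close>) or the antilinear (\<open>False\<close>) type. It lets one argument
  treat both types, which differ only by a conjugation of coordinates.
\<close>

definition coord :: "bool \<Rightarrow> 'v \<Rightarrow> 'v \<Rightarrow> complex" where
  "coord s x p = (if s then ip x p else ip p x)"

text \<open>
  For both types this says \<open>w\<^sup>* \<phi>(X) w = x\<^sup>* X x\<close>; moreover \<open>w\<^sup>* \<phi>(X) w\<^sub>0\<close> is \<open>x\<^sup>* X e\<^sub>k\<close> for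
  \<open>s = True\<close> and \<open>e\<^sub>k\<^sup>* X x\<close> for \<open>s = False\<close>. Only \<open>X = p p\<^sup>*\<close> is mentioned, since these matrices span
  all others.
\<close>

definition represents :: "bool \<Rightarrow> 'v \<Rightarrow> 'w \<Rightarrow> bool" where
  "represents s x w \<longleftrightarrow> (\<forall>p. h w w p p = coord s x p * cnj (coord s x p) \<and>
     h w w0 p p = coord s x p * cnj (coord s (e k) p))"

definition representable :: "bool \<Rightarrow> 'v \<Rightarrow> bool" where
  "representable s x \<longleftrightarrow> (\<exists>w. represents s x w)"

lemma coord_add_left: "coord s (x + x') p = coord s x p + coord s x' p"
  and coord_add_right: "coord s x (p + q) = coord s x p + coord s x q"
  and coord_diff_right: "coord s x (p - q) = coord s x p - coord s x q"
  by (simp_all add: coord_def inner.expand)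

lemma coord_e [simp]: "coord s (e k) (e k) = 1"
  using k by (simp add: coord_def orthonormal)

text \<open>
  If the \<open>e k\<close>-coordinate of \<open>p\<close> is nonzero, the overlap is forced by positivity, because relative
  to \<open>w0\<close> the form at \<open>p\<close> has rank one. The excluded hyperplane is reached by the parallelogram law
  for \<open>p + e k\<close> and \<open>p - e k\<close>.
\<close>

lemma represents_overlap:
  assumes w: "represents s x w" and w': "represents s x' w'"
  shows "h w w' p p = coord s x p * cnj (coord s x' p)"
proof -
  define G where "G p = h w w' p p - coord s x p * cnj (coord s x' p)" for p
  have G: "G p = 0" if "coord s (e k) p \<noteq> 0" for p
  proof -
    have 1: "h w w p p = coord s x p * cnj (coord s x p)"
      "h w w0 p p = coord s x p * cnj (coord s (e k) p)"
      using w unfolding represents_def by blast+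
    have 2: "h w' w0 p p = coord s x' p * cnj (coord s (e k) p)"
      using w' unfolding represents_def by blast
    have "ip p (e k) = cnj (ip (e k) p)" by (rule inner.herm)
    then have 3: "h w0 w0 p p = coord s (e k) p * cnj (coord s (e k) p)"
      by (simp add: w0 coord_def)
    have "h w w' p p = coord s x p * cnj (coord s x' p)"
      by (rule psd_W.rank_one_overlap[OF 1(1) 3 1(2) 2 that])
    then show ?thesis by (simp add: G_def)
  qed
  have "G p = 0"
  proof (cases "coord s (e k) p = 0")
    case True
    then have "G (p + e k) = 0" "G (p - e k) = 0" "G (e k) = 0"
      by (auto intro!: G simp: coord_add_right coord_diff_right)
    moreover have "G (p + e k) + G (p - e k) = 2 * G p + 2 * G (e k)"
      by (simp add: G_def coord_add_right coord_diff_right expand_V algebra_simps)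
    ultimately show ?thesis by simp
  qed (rule G)
  then show ?thesis by (simp add: G_def)
qed

lemma representable_add:
  assumes "representable s x" "representable s x'"
  shows "representable s (x + x')"
proof -
  obtain w w' where w: "represents s x w" "represents s x' w'"
    using assms by (auto simp: representable_def)
  have "represents s (x + x') (w + w')"
    unfolding represents_def
    using represents_overlap[OF w] represents_overlap[OF w(2,1)] w
    by (simp add: represents_def expand_W coord_add_left algebra_simps)
  then show ?thesis by (auto simp: representable_def)
qed

lemma representable_scale:
  assumes "representable s x"
  shows "representable s (c \<cdot>\<^sub>v x)"
proof -
  obtain w where w: "represents s x w" using assms by (auto simp: representable_def)
  define a where "a = (if s then c else cnj c)"
  have coord: "coord s (c \<cdot>\<^sub>v x) p = cnj a * coord s x p" for p
    by (simp add: a_def coord_def inner.expand)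
  have "represents s (c \<cdot>\<^sub>v x) (a \<cdot>\<^sub>w w)"
    unfolding represents_def
  proof
    fix p
    have "h w w p p = coord s x p * cnj (coord s x p)"
      "h w w0 p p = coord s x p * cnj (coord s (e k) p)"
      using w unfolding represents_def by blast+
    then show "h (a \<cdot>\<^sub>w w) (a \<cdot>\<^sub>w w) p p = coord s (c \<cdot>\<^sub>v x) p * cnj (coord s (c \<cdot>\<^sub>v x) p) \<and>
        h (a \<cdot>\<^sub>w w) w0 p p = coord s (c \<cdot>\<^sub>v x) p * cnj (coord s (e k) p)"
      by (simp add: coord expand_W)
  qed
  then show ?thesis by (auto simp: representable_def)
qed

lemma representable_diff:
  assumes "representable s x" "representable s x'"
  shows "representable s (x - x')"
proof -
  have "x - x' = x + (-1) \<cdot>\<^sub>v x'" by (simp add: V.scale_minus_left)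
  then show ?thesis using representable_add[OF assms(1) representable_scale[OF assms(2)]] by metis
qed

section \<open>The two-dimensional case\<close>

lemma representable_if_unit:
  assumes ww: "\<And>p. h w w p p = coord s x p * cnj (coord s x p)"
    and ww0: "\<And>p. h w w0 p p = \<sigma> * (coord s x p * cnj (coord s (e k) p))" and "cmod \<sigma> = 1"
  shows "representable s x"
proof -
  have \<sigma>: "\<sigma> * cnj \<sigma> = 1" using assms(3) complex_norm_square[of \<sigma>] by simp
  have "represents s x (\<sigma> \<cdot>\<^sub>w w)"
    unfolding represents_def
  proof
    fix p
    have "h (\<sigma> \<cdot>\<^sub>w w) (\<sigma> \<cdot>\<^sub>w w) p p = (\<sigma> * cnj \<sigma>) * (coord s x p * cnj (coord s x p))"
      by (simp add: expand_W ww)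
    moreover have "h (\<sigma> \<cdot>\<^sub>w w) w0 p p = (\<sigma> * cnj \<sigma>) * (coord s x p * cnj (coord s (e k) p))"
      by (simp add: expand_W ww0)
    ultimately show "h (\<sigma> \<cdot>\<^sub>w w) (\<sigma> \<cdot>\<^sub>w w) p p = coord s x p * cnj (coord s x p) \<and>
        h (\<sigma> \<cdot>\<^sub>w w) w0 p p = coord s x p * cnj (coord s (e k) p)"
      by (simp add: \<sigma>)
  qed
  then show ?thesis unfolding representable_def by blast
qed

text \<open>
  Products involving the part of \<open>p\<close> or \<open>q\<close> orthogonal to \<open>z k\<close> and \<open>z j\<close> vanish, because
  \<open>w0\<close> lies in the kernel at \<open>z k\<close> and \<open>w\<close> in the kernel at \<open>z j\<close>; so do the diagonal products at
  \<open>f k\<close> and at \<open>f j\<close>. Two coefficients remain.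
\<close>

lemma cross_term:
  assumes dual: "dual_bases f z" and zk: "z k = e k" and j: "j < d" "j \<noteq> k"
    and w: "kernel_at (z j) w"
  shows "h w w0 p q = ip (z j) p * ip q (z k) * h w w0 (f j) (f k)
           + ip (z k) p * ip q (z j) * h w w0 (f k) (f j)"
proof -
  have zf: "ip (z i) (f l) = of_bool (i = l)" if "i < d" "l < d" for i l
    using dual that unfolding dual_bases_def by blast
  define rest where "rest u = u - ip (z k) u \<cdot>\<^sub>v f k - ip (z j) u \<cdot>\<^sub>v f j" for u
  have rest: "ip (z k) (rest u) = 0" "ip (z j) (rest u) = 0" for u
    using j k by (simp_all add: rest_def inner.expand zf)
  have w0': "kernel_at (z k) w0" unfolding zk by (rule kernel_at_w0)
  have orth_k: "h w w0 p q = 0" if "ip (z k) p = 0" "ip (z k) q = 0" for p q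
    by (rule kernel_at_orthogonal[OF w0' that])
  have orth_j: "h w w0 p q = 0" if "ip (z j) p = 0" "ip (z j) q = 0" for p q
    by (rule kernel_at_orthogonal[OF w that])
  have dec: "u = rest u + (ip (z k) u \<cdot>\<^sub>v f k + ip (z j) u \<cdot>\<^sub>v f j)" for u
    by (simp add: rest_def)
  have 0: "h w w0 (rest p) (rest q) = 0" "h w w0 (rest p) (f j) = 0" "h w w0 (f j) (rest q) = 0"
     "h w w0 (f j) (f j) = 0"
    by (rule orth_k; use j k in \<open>simp add: rest zf\<close>)+
  have 1: "h w w0 (rest p) (f k) = 0" "h w w0 (f k) (rest q) = 0" "h w w0 (f k) (f k) = 0"
    by (rule orth_j; use j k in \<open>simp add: rest zf\<close>)+
  have "h w w0 p q = h w w0 (rest p + (ip (z k) p \<cdot>\<^sub>v f k + ip (z j) p \<cdot>\<^sub>v f j))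
     (rest q + (ip (z k) q \<cdot>\<^sub>v f k + ip (z j) q \<cdot>\<^sub>v f j))"
    using dec[of p] dec[of q] by simp
  also have "\<dots> = ip (z j) p * cnj (ip (z k) q) * h w w0 (f j) (f k)
           + ip (z k) p * cnj (ip (z j) q) * h w w0 (f k) (f j)"
    by (simp add: add_V add_V' scale_V scale_V' 0 1)
  finally show ?thesis by (simp add: inner.herm[of "z k" q] inner.herm[of "z j" q])
qed

text \<open>
  On the plane spanned by \<open>w0\<close> and the normalised kernel vector, the form is \<open>2 \<times> 2\<close>, with off-diagonal
  entry \<open>s X\<^sub>j\<^sub>k + t X\<^sub>k\<^sub>j\<close>. Positivity bounds \<open>\<beta> s + cnj \<beta> cnj t\<close> by one. Conversely, for every unit
  \<open>\<zeta>\<close> there is a kernel vector at \<open>z k + \<zeta> z j\<close>, it lies in the same plane, and the quotient of its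
  two coefficients is a \<open>\<beta>\<close> with \<open>\<beta> s + cnj \<beta> cnj t = cnj \<zeta>\<close>. Hence one of \<open>s\<close> and \<open>t\<close> vanishes.
\<close>

lemma representable_if_plane:
  assumes dual: "dual_bases f z" and zk: "z k = e k" and j: "j < d" "j \<noteq> k"
    and ker: "kernel_at (z j) w" "\<not> null w"
    and plane: "\<And>u. (\<And>i. i < d \<Longrightarrow> i \<noteq> k \<Longrightarrow> i \<noteq> j \<Longrightarrow> h u u (f i) (f i) = 0) \<Longrightarrow>
      \<exists>a c. \<forall>w' x y. h w' u x y = a * h w' w0 x y + c * h w' w x y"
  shows "representable True (z j) \<or> representable False (z j)"
proof -
  have zf: "ip (z i) (f l) = of_bool (i = l)" if "i < d" "l < d" for i l
    using dual that unfolding dual_bases_def by blast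
  have "ip (z j) (f j) = 1" using j by (simp add: zf)
  from normalize_kernel_at[OF ker(1) this ker(2)]
  obtain m where m: "m \<noteq> 0" "\<And>x y. h (m \<cdot>\<^sub>w w) (m \<cdot>\<^sub>w w) x y = ip (z j) x * ip y (z j)" by blast
  define w1 where "w1 = m \<cdot>\<^sub>w w"
  have w1: "h w1 w1 x y = ip (z j) x * ip y (z j)" for x y unfolding w1_def by (rule m(2))
  have ker1: "kernel_at (z j) w1" by (simp add: kernel_at_def w1)
  have w0z: "h w0 w0 x y = ip (z k) x * ip y (z k)" for x y by (simp add: w0 zk)
  define s t where "s = h w1 w0 (f j) (f k)" and "t = h w1 w0 (f k) (f j)"
  have cross: "h w1 w0 p q = ip (z j) p * ip q (z k) * s + ip (z k) p * ip q (z j) * t" for p q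
    unfolding s_def t_def by (rule cross_term[OF dual zk j ker1])
  have cross': "h w0 w1 p q = ip p (z j) * 0 + cnj (ip (z j) q * ip p (z k) * s + ip (z k) q * ip p (z j) * t)" for p q
    using herm[of w0 w1 p q] by (simp add: cross)
  have fz: "ip (f l) (z i) = of_bool (i = l)" if "i < d" "l < d" for i l
    using inner.herm[of "f l" "z i"] zf[OF that] by simp
  define \<tau> where "\<tau> a c = cnj c * a * s + cnj a * c * cnj t" for a c
  have quad: "h u u (f k) (f k) = a * cnj a" "h u u (f j) (f j) = c * cnj c"
      "h u u (f j) (f k) = \<tau> a c" "h u u (f k) (f j) = cnj (\<tau> a c)"
    if u: "\<And>w' x y. h w' u x y = a * h w' w0 x y + c * h w' w1 x y" for u a c
  proof -
    have u': "h u w' x y = cnj a * h w0 w' x y + cnj c * h w1 w' x y" for w' x y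
      using u[of w' y x] herm[of u w' x y] herm[of w0 w' x y] herm[of w1 w' x y] by simp
    show "h u u (f k) (f k) = a * cnj a" "h u u (f j) (f j) = c * cnj c"
      "h u u (f j) (f k) = \<tau> a c" "h u u (f k) (f j) = cnj (\<tau> a c)"
      using j k by (simp_all add: u u' w0z w1 cross cross' zf fz \<tau>_def)
  qed
  have le: "cmod (\<beta> * s + cnj \<beta> * cnj t) \<le> 1" if \<beta>: "cmod \<beta> = 1" for \<beta>
  proof (cases "\<beta> * s + cnj \<beta> * cnj t = 0")
    case False
    define \<kappa> where "\<kappa> = \<beta> * s + cnj \<beta> * cnj t"
    \<comment> \<open>the phase for which the positive value at \<open>f k + \<xi> \<cdot>\<^sub>v f j\<close> becomes \<open>2 - 2 * cmod \<kappa>\<close>\<close>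
    define \<xi> where "\<xi> = cnj \<kappa> / of_real (cmod \<kappa>)"
    have \<kappa>: "\<xi> * \<kappa> = of_real (cmod \<kappa>)" "cnj \<xi> * \<xi> = 1"
      using False complex_norm_square[of \<kappa>]
      by (auto simp: \<xi>_def \<kappa>_def[symmetric] field_simps power2_eq_square)
    define u where "u = w0 + (- cnj \<beta>) \<cdot>\<^sub>w w1"
    have bb: "\<beta> * cnj \<beta> = 1" using \<beta> complex_norm_square[of \<beta>] by simp
    have "h w' u x y = 1 * h w' w0 x y + (- cnj \<beta>) * h w' w1 x y" for w' x y
      by (simp only: u_def add_W scale_W mult_1)
    note q = quad[OF this]
    have "h u u (f k + \<xi> \<cdot>\<^sub>v f j) (f k + \<xi> \<cdot>\<^sub>v f j)
       = h u u (f k) (f k) + cnj \<xi> * \<xi> * h u u (f j) (f j) + \<xi> * h u u (f j) (f k) + cnj \<xi> * h u u (f k) (f j)"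
      by (simp add: expand_V algebra_simps)
    also have "\<dots> = 2 - (\<xi> * \<kappa> + cnj (\<xi> * \<kappa>))"
    proof -
      have "\<tau> 1 (- cnj \<beta>) = - \<kappa>" by (simp add: \<tau>_def \<kappa>_def)
      moreover have "- cnj \<beta> * cnj (- cnj \<beta>) = 1" using bb by (simp add: mult.commute)
      ultimately show ?thesis unfolding q \<kappa>(2) by simp
    qed
    also have "\<dots> = of_real (2 - 2 * cmod \<kappa>)" unfolding \<kappa>(1) by simp
    finally have "0 \<le> 2 - 2 * cmod \<kappa>"
      using nonneg[of u "f k + \<xi> \<cdot>\<^sub>v f j"] by simp
    then show ?thesis by (simp add: \<kappa>_def)
  qed simp
  have attained: "\<exists>\<beta>. cmod \<beta> = 1 \<and> \<beta> * s + cnj \<beta> * cnj t = cnj \<zeta>" if \<zeta>: "cmod \<zeta> = 1" for \<zeta>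
  proof -
    have zz: "\<zeta> * cnj \<zeta> = 1" "cnj \<zeta> * \<zeta> = 1" using \<zeta> complex_norm_square[of \<zeta>] by (simp_all add: mult.commute)
    \<comment> \<open>spans, with the \<open>f i\<close> for other \<open>i\<close>, the complement of \<open>z k + \<zeta> \<cdot>\<^sub>v z j\<close>\<close>
    define g where "g = f k - \<zeta> \<cdot>\<^sub>v f j"
    have "\<exists>u. (\<forall>i\<in>{..<d} - {j}. h u u ((f(k := g)) i) ((f(k := g)) i) = 0) \<and>
       h u u (f k + \<zeta> \<cdot>\<^sub>v f j) (f k + \<zeta> \<cdot>\<^sub>v f j) \<noteq> 0"
    proof (rule exists_kernel_vector[where z = "z k + \<zeta> \<cdot>\<^sub>v z j"])
      show "ip (z k + \<zeta> \<cdot>\<^sub>v z j) ((f(k := g)) i) = 0" if "i \<in> {..<d} - {j}" for i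
        using that j k by (auto simp: g_def inner.expand zf zz)
      show "ip (z k + \<zeta> \<cdot>\<^sub>v z j) (f k + \<zeta> \<cdot>\<^sub>v f j) \<noteq> 0"
        using j k by (simp add: inner.expand zf zz)
    qed simp
    then obtain u where u: "\<And>i. i \<in> {..<d} - {j} \<Longrightarrow> h u u ((f(k := g)) i) ((f(k := g)) i) = 0"
      "h u u (f k + \<zeta> \<cdot>\<^sub>v f j) (f k + \<zeta> \<cdot>\<^sub>v f j) \<noteq> 0" by blast
    have "h u u (f i) (f i) = 0" if "i < d" "i \<noteq> k" "i \<noteq> j" for i
      using u(1)[of i] that by simp
    from plane[OF this] obtain a c' where ac': "\<And>w' x y. h w' u x y = a * h w' w0 x y + c' * h w' w x y"
      by blast
    define c where "c = c' / m"
    have "h w' u x y = a * h w' w0 x y + c * h w' w1 x y" for w' x y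
      using m(1) ac' by (simp add: w1_def c_def expand_W)
    note q = quad[OF this]
    have "h u u g g = 0" using u(1)[of k] k j by simp
    then have "h u u g (f k) = 0" "h u u g (f j) = 0" using psd_V.isotropic_right[of u g] by blast+
    then have 1: "\<zeta> * \<tau> a c = a * cnj a" and 2: "cnj (\<tau> a c) = \<zeta> * (c * cnj c)"
      using q by (auto simp: g_def expand_V)
    have "a \<noteq> 0"
    proof
      assume "a = 0"
      then have "\<tau> a c = 0" by (simp add: \<tau>_def)
      then have "c = 0" using 2 \<zeta> by auto
      then show False using u(2) \<open>a = 0\<close> by (simp add: expand_V q \<tau>_def)
    qed
    have \<tau>: "\<tau> a c = cnj \<zeta> * (a * cnj a)"
      using arg_cong[OF 1, of "\<lambda>x. cnj \<zeta> * x"] zz by (simp add: mult.assoc[symmetric])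
    have "\<zeta> * (a * cnj a) = \<zeta> * (c * cnj c)" using 2 \<tau> by (simp add: mult.commute)
    then have cc: "c * cnj c = a * cnj a" using \<zeta> by auto
    define \<beta> where "\<beta> = cnj c * a / (a * cnj a)"
    have "cmod c = cmod a"
      using cc by (metis complex_mod_cnj complex_norm_square norm_ge_zero of_real_eq_iff power2_eq_iff_nonneg)
    then have "cmod \<beta> = 1" using \<open>a \<noteq> 0\<close> by (simp add: \<beta>_def norm_mult norm_divide)
    moreover have "\<beta> * s + cnj \<beta> * cnj t = \<tau> a c / (a * cnj a)"
      using \<open>a \<noteq> 0\<close> by (simp add: \<beta>_def \<tau>_def field_simps)
    then have "\<beta> * s + cnj \<beta> * cnj t = cnj \<zeta>" using \<tau> \<open>a \<noteq> 0\<close> by simp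
    ultimately show ?thesis by blast
  qed
  from unit_circle_alternative[OF le attained]
  show ?thesis
  proof
    assume st: "t = 0 \<and> cmod s = 1"
    have "representable True (z j)"
      by (rule representable_if_unit[of w1 _ _ s])
        (use st inner.herm[of "z j"] in \<open>simp_all add: coord_def w1 cross zk flip: inner.herm\<close>)
    then show ?thesis ..
  next
    assume st: "s = 0 \<and> cmod t = 1"
    have "representable False (z j)"
      by (rule representable_if_unit[of w1 _ _ t])
        (use st in \<open>simp_all add: coord_def w1 cross zk flip: inner.herm\<close>)
    then show ?thesis ..
  qed
qed

section \<open>Counting dimensions and shearing the basis\<close>

text \<open>
  If none of the planes were two-dimensional modulo null vectors, choose in each a kernel vector at \<open>z j\<close>
  and a vector independent of it and of \<open>w0\<close>. Together with \<open>w0\<close> these are \<open>2 * d - 1\<close> vectors. They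
  are independent, because evaluation at \<open>f j\<close> isolates the \<open>j\<close>-th component of a relation and so puts
  that component into the kernel at \<open>e k\<close>, which is spanned by \<open>w0\<close>.
\<close>

lemma exists_representable_in_basis:
  assumes dual: "dual_bases f z" and zk: "z k = e k" and r: "r < 2 * d - 1"
  shows "\<exists>j<d. j \<noteq> k \<and> (representable True (z j) \<or> representable False (z j))"
proof (rule ccontr)
  assume neg: "\<not> ?thesis"
  have zf: "ip (z i) (f l) = of_bool (i = l)" if "i < d" "l < d" for i l
    using dual that unfolding dual_bases_def by blast
  define plane where "plane j u \<longleftrightarrow> (\<forall>i<d. i \<noteq> k \<longrightarrow> i \<noteq> j \<longrightarrow> h u u (f i) (f i) = 0)" for j u
  have "\<forall>j. \<exists>wu. j < d \<and> j \<noteq> k \<longrightarrow> kernel_at (z j) (fst wu) \<and> \<not> null (fst wu) \<and> plane j (snd wu) \<and>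
      (\<nexists>a c. \<forall>w' x y. h w' (snd wu) x y = a * h w' w0 x y + c * h w' (fst wu) x y)"
  proof
    fix j
    show "\<exists>wu. j < d \<and> j \<noteq> k \<longrightarrow> kernel_at (z j) (fst wu) \<and> \<not> null (fst wu) \<and> plane j (snd wu) \<and>
      (\<nexists>a c. \<forall>w' x y. h w' (snd wu) x y = a * h w' w0 x y + c * h w' (fst wu) x y)"
    proof (cases "j < d \<and> j \<noteq> k")
      case True
      then obtain w where w: "kernel_at (z j) w" "\<not> null w"
        using exists_kernel_at[OF dual] by blast
      obtain u where u: "plane j u" "\<nexists>a c. \<forall>w' x y. h w' u x y = a * h w' w0 x y + c * h w' w x y"
        using representable_if_plane[OF dual zk _ _ w] neg True unfolding plane_def by blast
      show ?thesis by (rule exI[of _ "(w, u)"]) (use w u in simp)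
    qed blast
  qed
  from choice[OF this] obtain wu where wu:
    "\<And>j. j < d \<Longrightarrow> j \<noteq> k \<Longrightarrow> kernel_at (z j) (fst (wu j))"
    "\<And>j. j < d \<Longrightarrow> j \<noteq> k \<Longrightarrow> \<not> null (fst (wu j))"
    "\<And>j. j < d \<Longrightarrow> j \<noteq> k \<Longrightarrow> plane j (snd (wu j))"
    "\<And>j. j < d \<Longrightarrow> j \<noteq> k \<Longrightarrow>
       \<nexists>a c. \<forall>w' x y. h w' (snd (wu j)) x y = a * h w' w0 x y + c * h w' (fst (wu j)) x y"
    by blast
  have plane_fst: "plane j (fst (wu j))" if "j < d" "j \<noteq> k" for j
    using kernel_atD[OF dual that(1) wu(1)[OF that]] by (simp add: plane_def)
  define g where "g i = (if fst i = k then w0 else if snd i then fst (wu (fst i)) else snd (wu (fst i)))"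
    for i :: "nat \<times> bool"
  \<comment> \<open>one index \<open>(k, False)\<close> for \<open>w0\<close>, two for every other direction\<close>
  define J :: "(nat \<times> bool) set" where "J = {..<d} \<times> UNIV - {(k, True)}"
  have "card J = 2 * d - 1" using k by (simp add: J_def card_Diff_singleton card_cartesian_product)
  then have J: "finite J" "card J > r" using r by (auto simp: J_def)
  obtain c where c: "\<exists>i\<in>J. c i \<noteq> 0" "\<And>w' x y. (\<Sum>i\<in>J. c i * h w' (g i) x y) = 0"
    using exists_relation[OF J] by blast
  have off: "h w' (g i) (f j) (f j) = 0" if "i \<in> J" "fst i \<noteq> j" "j < d" "j \<noteq> k" for w' i j
  proof (cases "fst i = k")
    case True
    then show ?thesis
      using kernel_at_orthogonal[OF kernel_at_w0, of "f j" "f j"] that k zf[of k j] by (simp add: g_def zk)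
  next
    case False
    then have "plane (fst i) (g i)" using that plane_fst wu(3) by (auto simp: g_def J_def)
    then have "h (g i) (g i) (f j) (f j) = 0" using that by (simp add: plane_def)
    then show ?thesis by (rule psd_W.isotropic_right)
  qed
  have zero: "c (j, True) = 0 \<and> c (j, False) = 0" if j: "j < d" "j \<noteq> k" for j
  proof -
    define v where "v = c (j, True) \<cdot>\<^sub>w fst (wu j) + c (j, False) \<cdot>\<^sub>w snd (wu j)"
    have "h v v (f i) (f i) = 0" if "i < d" "i \<noteq> k" for i
    proof (cases "i = j")
      case True
      have "0 = (\<Sum>i\<in>J. c i * h v (g i) (f j) (f j))" using c(2) by simp
      also have "\<dots> = (\<Sum>i\<in>{(j, True), (j, False)}. c i * h v (g i) (f j) (f j))"
      proof (rule sum.mono_neutral_right[OF J(1)])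
        show "{(j, True), (j, False)} \<subseteq> J" using j by (auto simp: J_def)
        show "\<forall>i\<in>J - {(j, True), (j, False)}. c i * h v (g i) (f j) (f j) = 0"
        proof
          fix i assume i: "i \<in> J - {(j, True), (j, False)}"
          then have "fst i \<noteq> j" by (cases i; cases "snd i") auto
          then show "c i * h v (g i) (f j) (f j) = 0" using off[of i j v] i j by simp
        qed
      qed
      also have "\<dots> = h v (c (j, True) \<cdot>\<^sub>w fst (wu j) + c (j, False) \<cdot>\<^sub>w snd (wu j)) (f j) (f j)"
        using j by (simp add: g_def add_W scale_W)
      also have "\<dots> = h v v (f j) (f j)" by (simp only: v_def)
      finally show ?thesis using True by simp
    next
      case False
      have "h (fst (wu j)) (fst (wu j)) (f i) (f i) = 0" "h (snd (wu j)) (snd (wu j)) (f i) (f i) = 0"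
        using plane_fst[OF j] wu(3)[OF j] that False by (auto simp: plane_def)
      then have "h w' (fst (wu j)) (f i) (f i) = 0" "h w' (snd (wu j)) (f i) (f i) = 0" for w'
        using psd_W.isotropic_right by blast+
      then have "h v (c (j, True) \<cdot>\<^sub>w fst (wu j) + c (j, False) \<cdot>\<^sub>w snd (wu j)) (f i) (f i) = 0"
        by (simp add: add_W scale_W)
      then show ?thesis by (simp only: v_def)
    qed
    then have "kernel_at (e k) v" using kernel_atI[OF dual k] by (simp add: zk)
    then obtain a where "\<And>w' x y. h w' v x y = a * h w' w0 x y" using simple by blast
    then have rel: "c (j, True) * h w' (fst (wu j)) x y + c (j, False) * h w' (snd (wu j)) x y = a * h w' w0 x y"
      for w' x y by (simp add: v_def add_W scale_W)
    have F: "c (j, False) = 0"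
    proof (rule ccontr)
      assume F: "c (j, False) \<noteq> 0"
      have "h w' (snd (wu j)) x y = a / c (j, False) * h w' w0 x y
          + (- c (j, True) / c (j, False)) * h w' (fst (wu j)) x y" for w' x y
        using rel[of w' x y] F by (simp add: field_simps)
      then show False using wu(4)[OF j] by blast
    qed
    have "c (j, True) = 0"
    proof (rule ccontr)
      assume T: "c (j, True) \<noteq> 0"
      have "h w0 (fst (wu j)) (f k) (f k) = 0"
        using kernel_at_orthogonal[OF wu(1)[OF j], of "f k" "f k"] zf[of j k] j k by simp
      then have "a * h w0 w0 (f k) (f k) = 0" using rel[of w0 "f k" "f k"] F by simp
      moreover have "h w0 w0 (f k) (f k) = 1"
        using zf[OF k k] inner.herm[of "f k" "z k"] by (simp add: w0 flip: zk)
      ultimately have "a = 0" by simp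
      then have "null (fst (wu j))" using rel F T by (simp add: null_def)
      then show False using wu(2)[OF j] by blast
    qed
    with F show ?thesis by simp
  qed
  have zero': "c i = 0" if "i \<in> J" "i \<noteq> (k, False)" for i
    using that zero[of "fst i"] by (cases i; cases "snd i") (auto simp: J_def)
  have "0 = (\<Sum>i\<in>J. c i * h w0 (g i) (e k) (e k))" using c(2) by simp
  also have "\<dots> = (\<Sum>i\<in>{(k, False)}. c i * h w0 (g i) (e k) (e k))"
    using k J(1) zero' by (intro sum.mono_neutral_right) (auto simp: J_def)
  also have "\<dots> = c (k, False)" using k by (simp add: g_def w0 orthonormal)
  finally show False using c(1) zero' by (metis)
qed

text \<open>
  The basis change is a rank-one perturbation of the identity; the dual basis is given by the
  Sherman-Morrison formula for its inverse.
\<close>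

lemma dual_bases_sheared:
  fixes \<mu> :: complex and y :: 'v
  defines "\<nu> \<equiv> cnj \<mu> / (1 + cnj \<mu> * (\<Sum>i\<in>{..<d}-{k}. ip y (e i)))"
  assumes nz: "1 + cnj \<mu> * (\<Sum>i\<in>{..<d}-{k}. ip y (e i)) \<noteq> 0"
  shows "dual_bases (\<lambda>j. e j - ip y (e j) \<cdot>\<^sub>v \<nu> \<cdot>\<^sub>v (\<Sum>i\<in>{..<d}-{k}. e i))
     (\<lambda>i. if i = k then e k else e i + \<mu> \<cdot>\<^sub>v y)"
proof -
  define \<sigma> where "\<sigma> = (\<Sum>i\<in>{..<d}-{k}. ip y (e i))"
  define N where "N = (\<Sum>i\<in>{..<d}-{k}. e i)"
  have \<nu>: "\<nu> * (1 + cnj \<mu> * \<sigma>) = cnj \<mu>" using nz by (simp add: \<nu>_def \<sigma>_def)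
  have eN: "ip (e i) N = of_bool (i \<noteq> k)" if "i < d" for i
  proof -
    have "ip (e i) N = (\<Sum>j\<in>{..<d}-{k}. of_bool (i = j))"
      unfolding N_def inner.sum_right using that by (intro sum.cong) (auto simp: orthonormal)
    also have "\<dots> = of_bool (i \<noteq> k)" using that by (auto simp: of_bool_def sum.delta')
    finally show ?thesis .
  qed
  have yN: "ip y N = \<sigma>" by (simp add: N_def \<sigma>_def inner.sum_right)
  show ?thesis
    unfolding dual_bases_def N_def[symmetric]
  proof (intro conjI allI impI)
    fix i j assume ij: "i < d" "j < d"
    show "ip (if i = k then e k else e i + \<mu> \<cdot>\<^sub>v y) (e j - ip y (e j) \<cdot>\<^sub>v \<nu> \<cdot>\<^sub>v N) = of_bool (i = j)"
    proof (cases "i = k")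
      case True
      then show ?thesis using ij by (simp add: inner.expand orthonormal eN)
    next
      case False
      have "ip (e i + \<mu> \<cdot>\<^sub>v y) (e j - ip y (e j) \<cdot>\<^sub>v \<nu> \<cdot>\<^sub>v N)
         = of_bool (i = j) + ip y (e j) * (cnj \<mu> - \<nu> * (1 + cnj \<mu> * \<sigma>))"
        using ij False by (simp add: inner.expand orthonormal eN yN algebra_simps)
      then show ?thesis using False by (simp add: \<nu>)
    qed
  next
    fix w' w x y'
    define S where "S = h w' w N y'"
    define K where "K = {..<d} - {k}"
    have S: "S = (\<Sum>i\<in>K. h w' w (e i) y')" by (simp add: S_def N_def sum_V K_def)
    define \<chi> :: "nat \<Rightarrow> complex" where "\<chi> i = of_bool (i \<noteq> k)" for i
    have split: "(\<Sum>i<d. F i) = F k + (\<Sum>i\<in>K. F i)" for F :: "nat \<Rightarrow> complex"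
      using k by (simp add: K_def sum.remove)
    have "(\<Sum>i<d. ip (if i = k then e k else e i + \<mu> \<cdot>\<^sub>v y) x * h w' w (e i - ip y (e i) \<cdot>\<^sub>v \<nu> \<cdot>\<^sub>v N) y')
       = (\<Sum>i<d. (ip (e i) x + cnj \<mu> * ip y x * \<chi> i) * (h w' w (e i) y' - ip y (e i) * (\<nu> * S)))"
      by (intro sum.cong) (auto simp: inner.expand expand_V S_def \<chi>_def)
    also have "\<dots> = (\<Sum>i<d. ip (e i) x * h w' w (e i) y') - (\<Sum>i<d. ip y (e i) * ip (e i) x) * (\<nu> * S)
        + cnj \<mu> * ip y x * (\<Sum>i<d. \<chi> i * h w' w (e i) y')
        - cnj \<mu> * ip y x * (\<Sum>i<d. \<chi> i * ip y (e i)) * (\<nu> * S)"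
      by (simp add: algebra_simps sum.distrib sum_subtractf sum_distrib_left sum_distrib_right)
    also have "(\<Sum>i<d. \<chi> i * h w' w (e i) y') = S"
      unfolding split S by (simp add: K_def \<chi>_def)
    also have "(\<Sum>i<d. \<chi> i * ip y (e i)) = \<sigma>"
      unfolding split \<sigma>_def by (simp add: K_def \<chi>_def)
    also have "(\<Sum>i<d. ip (e i) x * h w' w (e i) y') = h w' w x y'" by (rule span_V[symmetric])
    also have "(\<Sum>i<d. ip y (e i) * ip (e i) x) = ip y x" by (rule parseval[symmetric])
    also have "h w' w x y' - ip y x * (\<nu> * S) + cnj \<mu> * ip y x * S - cnj \<mu> * ip y x * \<sigma> * (\<nu> * S)
       = h w' w x y' + ip y x * S * (cnj \<mu> - \<nu> * (1 + cnj \<mu> * \<sigma>))"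
      by (simp add: algebra_simps)
    finally show "h w' w x y' = (\<Sum>i<d. ip (if i = k then e k else e i + \<mu> \<cdot>\<^sub>v y) x *
        h w' w (e i - ip y (e i) \<cdot>\<^sub>v \<nu> \<cdot>\<^sub>v N) y')" by (simp add: \<nu>)
  qed
qed

text \<open>
  A vector \<open>y\<close> outside both subspaces of representable vectors makes \<open>e j + \<mu> y\<close> representable of either
  type for at most one \<open>\<mu>\<close>. All but finitely many \<open>\<mu>\<close> therefore give a basis whose members, except
  \<open>e k\<close>, are not representable, contrary to the preceding count.
\<close>

lemma all_representable:
  assumes r: "r < 2 * d - 1"
  shows "\<exists>s. \<forall>x. representable s x"
proof (rule ccontr)
  assume neg: "\<not> ?thesis"
  then obtain x1 x2 where x: "\<not> representable True x1" "\<not> representable False x2" by blast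
  have "\<exists>y. \<not> representable True y \<and> \<not> representable False y"
  proof (cases "representable False x1 \<and> representable True x2")
    case True
    then have "\<not> representable True (x1 + x2)" "\<not> representable False (x1 + x2)"
      using x representable_diff[of True "x1 + x2" x2] representable_diff[of False "x1 + x2" x1] by auto
    then show ?thesis by blast
  qed (use x in blast)
  then obtain y where y: "\<And>s. \<not> representable s y" by (metis (full_types))
  define bad where "bad s j = {\<mu>. representable s (e j + \<mu> \<cdot>\<^sub>v y)}" for s j
  have "finite (bad s j)" for s j
  proof (rule ccontr)
    assume "infinite (bad s j)"
    then obtain \<mu> where \<mu>: "\<mu> \<in> bad s j" by fastforce
    have "infinite (bad s j - {\<mu>})" using \<open>infinite _\<close> by simp
    then obtain \<mu>' where \<mu>': "\<mu>' \<in> bad s j" "\<mu>' \<noteq> \<mu>"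
      using infinite_imp_nonempty by blast
    have "representable s ((e j + \<mu> \<cdot>\<^sub>v y) - (e j + \<mu>' \<cdot>\<^sub>v y))"
      using \<mu> \<mu>' by (intro representable_diff) (auto simp: bad_def)
    then have "representable s ((\<mu> - \<mu>') \<cdot>\<^sub>v y)" by (simp add: V.scale_left_diff_distrib)
    then have "representable s ((1 / (\<mu> - \<mu>')) \<cdot>\<^sub>v ((\<mu> - \<mu>') \<cdot>\<^sub>v y))" by (rule representable_scale)
    then show False using y \<mu>' by simp
  qed
  then have "finite (\<Union>j<d. bad True j \<union> bad False j)" by blast
  moreover define \<sigma> where "\<sigma> = (\<Sum>i\<in>{..<d}-{k}. ip y (e i))"
  have "finite {\<mu>. 1 + cnj \<mu> * \<sigma> = 0}"
  proof (cases "\<sigma> = 0")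
    case False
    have "{\<mu>. 1 + cnj \<mu> * \<sigma> = 0} \<subseteq> {cnj (- 1 / \<sigma>)}"
    proof
      fix \<mu> assume "\<mu> \<in> {\<mu>. 1 + cnj \<mu> * \<sigma> = 0}"
      then have "cnj \<mu> * \<sigma> = - 1" by (simp add: add_eq_0_iff)
      then have "cnj \<mu> = - 1 / \<sigma>" using False by (simp add: field_simps)
      then have "cnj (cnj \<mu>) = cnj (- 1 / \<sigma>)" by (simp only:)
      then show "\<mu> \<in> {cnj (- 1 / \<sigma>)}" by simp
    qed
    then show ?thesis using finite_subset by blast
  qed simp
  ultimately have "finite ((\<Union>j<d. bad True j \<union> bad False j) \<union> {\<mu>. 1 + cnj \<mu> * \<sigma> = 0})" by blast
  then obtain \<mu> where \<mu>: "\<mu> \<notin> (\<Union>j<d. bad True j \<union> bad False j) \<union> {\<mu>. 1 + cnj \<mu> * \<sigma> = 0}"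
    using ex_new_if_finite[OF infinite_UNIV_char_0] by blast
  then have "1 + cnj \<mu> * (\<Sum>i\<in>{..<d}-{k}. ip y (e i)) \<noteq> 0" by (simp add: \<sigma>_def)
  from exists_representable_in_basis[OF dual_bases_sheared[OF this] _ r]
  obtain j where "j < d" "j \<noteq> k" "representable True (e j + \<mu> \<cdot>\<^sub>v y) \<or> representable False (e j + \<mu> \<cdot>\<^sub>v y)"
    by auto
  then show False using \<mu> by (auto simp: bad_def)
qed

end

text \<open>
  The two alternatives are \<open>w\<^sub>i\<^sup>* \<phi>(X) w\<^sub>j = X\<^sub>i\<^sub>j\<close> and
  \<open>w\<^sub>i\<^sup>* \<phi>(X) w\<^sub>j = X\<^sub>j\<^sub>i\<close>, evaluated at \<open>X = p p\<^sup>*\<close>.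
\<close>

theorem (in faithful_biquadratic_form) linear_or_antilinear_section:
  assumes "r < 2 * d - 1"
  shows "\<exists>s w. \<forall>i<d. \<forall>j<d. \<forall>p. h (w i) (w j) p p =
    (if s then ip (e i) p * ip p (e j) else ip p (e i) * ip (e j) p)"
proof -
  obtain k w where k: "k < d" and w: "kernel_at (e k) w" "\<not> null w"
    and simple: "\<And>u. kernel_at (e k) u \<Longrightarrow> \<exists>c. \<forall>w' x y. h w' u x y = c * h w' w x y"
    using exists_simple_direction assms by fastforce
  obtain m where m: "m \<noteq> 0" "\<And>x y. h (m \<cdot>\<^sub>w w) (m \<cdot>\<^sub>w w) x y = ip (e k) x * ip y (e k)"
    using normalize_kernel_at[OF w(1) _ w(2), of "e k"] k by (auto simp: orthonormal)
  interpret simple_direction sw sv h ip r d b e k "m \<cdot>\<^sub>w w"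
  proof unfold_locales
    fix u assume "kernel_at (e k) u"
    then obtain c where c: "\<And>w' x y. h w' u x y = c * h w' w x y" using simple by blast
    then have "h w' u x y = c / m * h w' (m \<cdot>\<^sub>w w) x y" for w' x y using m(1) by (simp add: scale_W)
    then show "\<exists>c. \<forall>w' x y. h w' u x y = c * h w' (m \<cdot>\<^sub>w w) x y" by blast
  qed (use k m in auto)
  obtain s where "\<And>x. representable s x" using all_representable[OF assms] by blast
  then have "\<forall>i. \<exists>w. represents s (e i) w" by (simp add: representable_def)
  from choice[OF this] obtain v where v: "\<And>i. represents s (e i) (v i)" by blast
  have "h (v i) (v j) p p = (if s then ip (e i) p * ip p (e j) else ip p (e i) * ip (e j) p)" for i j p
    using represents_overlap[OF v v] by (simp add: coord_def flip: inner.herm)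
  then show ?thesis by blast
qed

section \<open>Forms with a coefficient tensor\<close>

text \<open>
  Vectors of length \<open>n\<close> are modelled by functions on \<open>nat\<close> of which only the values below \<open>n\<close> matter,
  so that they form a vector space as a type, for every \<open>n\<close> at once.
\<close>

type_synonym cvec = "nat \<Rightarrow> complex"

definition cscale :: "complex \<Rightarrow> cvec \<Rightarrow> cvec" where
  "cscale c v = (\<lambda>i. c * v i)"

definition unit_cvec :: "nat \<Rightarrow> cvec" where
  "unit_cvec i = (\<lambda>j. of_bool (j = i))"

definition cinner :: "nat \<Rightarrow> cvec \<Rightarrow> cvec \<Rightarrow> complex" where
  "cinner d x y = (\<Sum>a<d. cnj (x a) * y a)"

text \<open>
  The form \<open>u\<^sup>* \<phi>(x y\<^sup>*) w\<close> for the map \<open>\<phi>\<close> with \<open>\<phi>(X)\<^sub>i\<^sub>j = (\<Sum>a b. X\<^sub>a\<^sub>b \<Phi> i j a b)\<close>. The nesting of the sums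
  exhibits the linearity in \<open>w\<close>.
\<close>

definition tensor_form :: "nat \<Rightarrow> nat \<Rightarrow> (nat \<Rightarrow> nat \<Rightarrow> nat \<Rightarrow> nat \<Rightarrow> complex) \<Rightarrow>
    cvec \<Rightarrow> cvec \<Rightarrow> cvec \<Rightarrow> cvec \<Rightarrow> complex" where
  "tensor_form r d \<Phi> u w x y =
     (\<Sum>j<r. w j * (\<Sum>i<r. cnj (u i) * (\<Sum>a<d. x a * (\<Sum>b<d. cnj (y b) * \<Phi> i j a b))))"

lemma sum_unit_cvec [simp]:
  "(\<Sum>i<n. unit_cvec a i * F i) = (if a < n then F a else 0)"
  "(\<Sum>i<n. cnj (unit_cvec a i) * F i) = (if a < n then F a else 0)"
  "(\<Sum>i<n. F i * unit_cvec a i) = (if a < n then F a else 0)"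
  by (simp_all add: unit_cvec_def of_bool_def if_distrib[where f = cnj] if_distribR
      if_distrib[where f = "\<lambda>x. x * _"] if_distrib[where f = "\<lambda>x. _ * x"] cong: if_cong)

lemma cinner_unit_cvec [simp]:
  "cinner d x (unit_cvec a) = (if a < d then cnj (x a) else 0)"
  "cinner d (unit_cvec a) x = (if a < d then x a else 0)"
  by (simp_all add: cinner_def)

lemma vector_space_cscale: "vector_space cscale"
  by unfold_locales (auto simp: cscale_def fun_eq_iff algebra_simps)

lemma psd_form_cinner: "psd_form cscale (cinner d)"
proof -
  interpret vector_space cscale by (rule vector_space_cscale)
  show ?thesis
  proof unfold_locales
    fix u v w :: cvec and c :: complex
    show "cinner d u (v + w) = cinner d u v + cinner d u w"
      by (simp add: cinner_def algebra_simps sum.distrib)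
    show "cinner d u (cscale c v) = c * cinner d u v"
      by (simp add: cinner_def cscale_def sum_distrib_left mult_ac)
    show "cinner d v u = cnj (cinner d u v)"
      by (simp add: cinner_def mult.commute)
    show "0 \<le> Re (cinner d v v)"
      unfolding cinner_def Re_sum by (rule sum_nonneg) auto
  qed
qed

lemma sum_rotate3:
  fixes F :: "nat \<Rightarrow> nat \<Rightarrow> nat \<Rightarrow> complex"
  shows "(\<Sum>j\<in>J. \<Sum>i\<in>I. \<Sum>a\<in>A. F j i a) = (\<Sum>a\<in>A. \<Sum>j\<in>J. \<Sum>i\<in>I. F j i a)"
proof -
  have "(\<Sum>j\<in>J. \<Sum>i\<in>I. \<Sum>a\<in>A. F j i a) = (\<Sum>j\<in>J. \<Sum>a\<in>A. \<Sum>i\<in>I. F j i a)"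
    by (intro sum.cong[OF refl] sum.swap)
  also have "\<dots> = (\<Sum>a\<in>A. \<Sum>j\<in>J. \<Sum>i\<in>I. F j i a)" by (rule sum.swap)
  finally show ?thesis .
qed

lemma tensor_form_flat:
  "tensor_form r d \<Phi> u w x y =
     (\<Sum>i<r. \<Sum>j<r. \<Sum>a<d. \<Sum>b<d. cnj (u i) * w j * x a * cnj (y b) * \<Phi> i j a b)"
  unfolding tensor_form_def by (subst sum.swap) (simp add: sum_distrib_left mult_ac)

lemma tensor_form_by_matrix:
  "tensor_form r d \<Phi> u w x y =
     (\<Sum>a<d. \<Sum>b<d. x a * cnj (y b) * (\<Sum>i<r. \<Sum>j<r. cnj (u i) * w j * \<Phi> i j a b))"
proof -
  have "tensor_form r d \<Phi> u w x y =
     (\<Sum>i<r. \<Sum>j<r. \<Sum>a<d. \<Sum>b<d. x a * cnj (y b) * (cnj (u i) * w j * \<Phi> i j a b))"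
    unfolding tensor_form_flat by (simp add: mult_ac)
  also have "\<dots> = (\<Sum>a<d. \<Sum>i<r. \<Sum>j<r. \<Sum>b<d. x a * cnj (y b) * (cnj (u i) * w j * \<Phi> i j a b))"
    by (rule sum_rotate3)
  also have "\<dots> = (\<Sum>a<d. \<Sum>b<d. \<Sum>i<r. \<Sum>j<r. x a * cnj (y b) * (cnj (u i) * w j * \<Phi> i j a b))"
    by (intro sum.cong[OF refl] sum_rotate3)
  finally show ?thesis by (simp add: sum_distrib_left)
qed

lemma tensor_form_expand_x:
  "tensor_form r d \<Phi> u w x y = (\<Sum>a<d. x a * tensor_form r d \<Phi> u w (unit_cvec a) y)"
proof -
  have "tensor_form r d \<Phi> u w x y =
     (\<Sum>a<d. x a * (\<Sum>b<d. cnj (y b) * (\<Sum>i<r. \<Sum>j<r. cnj (u i) * w j * \<Phi> i j a b)))"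
    for x unfolding tensor_form_by_matrix by (simp add: sum_distrib_left mult.assoc)
  from this[of x] this[of "unit_cvec _"] show ?thesis by simp
qed

lemma biquadratic_form_tensor:
  assumes herm: "\<And>i j a b. i < r \<Longrightarrow> j < r \<Longrightarrow> a < d \<Longrightarrow> b < d \<Longrightarrow> \<Phi> j i b a = cnj (\<Phi> i j a b)"
    and nonneg: "\<And>w x. 0 \<le> Re (tensor_form r d \<Phi> w w x x)"
  shows "biquadratic_form cscale cscale (tensor_form r d \<Phi>)"
proof -
  interpret vector_space cscale by (rule vector_space_cscale)
  show ?thesis
  proof unfold_locales
    fix u v w x x' y :: cvec and c :: complex
    show "tensor_form r d \<Phi> w (u + v) x y = tensor_form r d \<Phi> w u x y + tensor_form r d \<Phi> w v x y"
      by (simp add: tensor_form_def distrib_right sum.distrib)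
    show "tensor_form r d \<Phi> w (cscale c u) x y = c * tensor_form r d \<Phi> w u x y"
      by (simp add: tensor_form_def cscale_def sum_distrib_left mult.assoc)
    show "tensor_form r d \<Phi> w u (x + x') y = tensor_form r d \<Phi> w u x y + tensor_form r d \<Phi> w u x' y"
      by (simp add: tensor_form_expand_x[of r d \<Phi> w u x] tensor_form_expand_x[of r d \<Phi> w u x']
          tensor_form_expand_x[of r d \<Phi> w u "x + x'"] distrib_right sum.distrib)
    show "tensor_form r d \<Phi> w u (cscale c x) y = c * tensor_form r d \<Phi> w u x y"
    proof -
      have "tensor_form r d \<Phi> w u (cscale c x) y
          = (\<Sum>a<d. cscale c x a * tensor_form r d \<Phi> w u (unit_cvec a) y)"
        by (rule tensor_form_expand_x)
      also have "\<dots> = c * (\<Sum>a<d. x a * tensor_form r d \<Phi> w u (unit_cvec a) y)"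
        by (simp add: cscale_def sum_distrib_left mult.assoc)
      finally show ?thesis by (simp only: tensor_form_expand_x[of r d \<Phi> w u x])
    qed
    show "tensor_form r d \<Phi> u w y x = cnj (tensor_form r d \<Phi> w u x y)"
    proof -
      have "cnj (tensor_form r d \<Phi> w u x y) =
          (\<Sum>i<r. \<Sum>j<r. \<Sum>a<d. \<Sum>b<d. w i * cnj (u j) * cnj (x a) * y b * \<Phi> j i b a)"
        unfolding tensor_form_flat cnj_sum by (intro sum.cong[OF refl]) (simp add: herm[symmetric])
      also have "\<dots> = (\<Sum>j<r. \<Sum>i<r. \<Sum>a<d. \<Sum>b<d. w i * cnj (u j) * cnj (x a) * y b * \<Phi> j i b a)"
        by (rule sum.swap)
      also have "\<dots> = (\<Sum>j<r. \<Sum>i<r. \<Sum>b<d. \<Sum>a<d. w i * cnj (u j) * cnj (x a) * y b * \<Phi> j i b a)"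
        by (rule sum.cong[OF refl], rule sum.cong[OF refl], rule sum.swap)
      also have "\<dots> = tensor_form r d \<Phi> u w y x"
        unfolding tensor_form_flat by (simp add: mult_ac)
      finally show ?thesis by simp
    qed
    show "0 \<le> Re (tensor_form r d \<Phi> w w x x)" by (rule nonneg)
  qed
qed

lemma sesquilinear_zeroD:
  fixes Y :: "nat \<Rightarrow> nat \<Rightarrow> complex"
  assumes zero: "\<And>p :: cvec. (\<Sum>a<d. \<Sum>b<d. p a * cnj (p b) * Y a b) = 0" and "m < d" "n < d"
  shows "Y m n = 0"
proof -
  define G where "G x y = (\<Sum>a<d. x a * (\<Sum>b<d. cnj (y b) * Y a b))" for x y :: cvec
  have G0: "G p p = 0" for p using zero[of p] by (simp add: G_def sum_distrib_left mult.assoc)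
  have Gunit: "G (unit_cvec i) (unit_cvec j) = Y i j" if "i < d" "j < d" for i j
    using that by (simp add: G_def)
  have "G (x + cscale c y) (x + cscale c y) = G x x + cnj c * G x y + c * G y x + c * cnj c * G y y"
    for x y c
    by (simp add: G_def cscale_def algebra_simps sum.distrib sum_distrib_left)
  then have *: "cnj c * G x y + c * G y x = 0" for x y c
    using G0[of "x + cscale c y"] by (simp add: G0)
  have "G x y = 0" for x y
    using *[of 1 x y] *[of \<i> x y] by (auto simp: algebra_simps)
  then show ?thesis using Gunit[of m n] assms(2,3) by simp
qed

text \<open>
  The section theorem with the coordinates \<open>\<Phi> i j a b = (\<phi>(E\<^sub>a\<^sub>b))\<^sub>i\<^sub>j\<close> of \<open>\<phi>\<close>, where \<open>E\<^sub>a\<^sub>b\<close> are the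
  matrix units. The values at \<open>X = p p\<^sup>*\<close> determine those at all \<open>X = E\<^sub>c\<^sub>e\<close> by polarization.
\<close>

lemma tensor_linear_or_antilinear_section:
  assumes herm: "\<And>i j a b. i < r \<Longrightarrow> j < r \<Longrightarrow> a < d \<Longrightarrow> b < d \<Longrightarrow> \<Phi> j i b a = cnj (\<Phi> i j a b)"
    and nonneg: "\<And>w x. 0 \<le> Re (tensor_form r d \<Phi> w w x x)"
    and separation: "\<And>(I :: nat set) z f v \<epsilon>. finite I \<Longrightarrow> (\<And>i. i \<in> I \<Longrightarrow> cinner d z (f i) = 0) \<Longrightarrow>
      cinner d z v \<noteq> 0 \<Longrightarrow> 0 < \<epsilon> \<Longrightarrow>
      \<exists>w. (\<Sum>i\<in>I. Re (tensor_form r d \<Phi> w w (f i) (f i))) < \<epsilon> * Re (tensor_form r d \<Phi> w w v v)"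
    and size: "r < 2 * d - 1"
  shows "\<exists>s (W :: nat \<Rightarrow> cvec). \<forall>a<d. \<forall>b<d. \<forall>c<d. \<forall>e<d.
    (\<Sum>i<r. \<Sum>j<r. cnj (W a i) * W b j * \<Phi> i j c e) =
      (if s then of_bool (c = a \<and> e = b) else of_bool (c = b \<and> e = a))"
proof -
  interpret biquadratic_form cscale cscale "tensor_form r d \<Phi>"
    by (rule biquadratic_form_tensor[OF herm nonneg])
  interpret inner: psd_form cscale "cinner d" by (rule psd_form_cinner)
  interpret faithful_biquadratic_form cscale cscale "tensor_form r d \<Phi>" "cinner d" r d unit_cvec unit_cvec
  proof unfold_locales
    fix w :: cvec
    have "tensor_form r d \<Phi> w' w x y = (\<Sum>i<r. w i * tensor_form r d \<Phi> w' (unit_cvec i) x y)" for w' x y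
      by (simp add: tensor_form_def)
    then show "\<exists>c. \<forall>w' x y. tensor_form r d \<Phi> w' w x y = (\<Sum>i<r. c i * tensor_form r d \<Phi> w' (unit_cvec i) x y)"
      by blast
  next
    fix i j assume "i < d" "j < d"
    then show "cinner d (unit_cvec i) (unit_cvec j) = of_bool (i = j)"
      by (simp, simp add: unit_cvec_def)
  next
    fix w' w x y
    show "tensor_form r d \<Phi> w' w x y = (\<Sum>i<d. cinner d (unit_cvec i) x * tensor_form r d \<Phi> w' w (unit_cvec i) y)"
      by (subst tensor_form_expand_x) simp
  next
    fix x y
    show "cinner d y x = (\<Sum>i<d. cinner d y (unit_cvec i) * cinner d (unit_cvec i) x)"
      by (simp add: cinner_def[of d y x])
  next
    fix I :: "nat set" and z v :: cvec and f :: "nat \<Rightarrow> cvec" and \<epsilon> :: real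
    assume "finite I" "\<And>i. i \<in> I \<Longrightarrow> cinner d z (f i) = 0" "cinner d z v \<noteq> 0" "0 < \<epsilon>"
    then show "\<exists>w. (\<Sum>i\<in>I. Re (tensor_form r d \<Phi> w w (f i) (f i))) < \<epsilon> * Re (tensor_form r d \<Phi> w w v v)"
      by (rule separation)
  qed
  obtain s w where w: "\<And>a b p. a < d \<Longrightarrow> b < d \<Longrightarrow> tensor_form r d \<Phi> (w a) (w b) p p =
      (if s then cinner d (unit_cvec a) p * cinner d p (unit_cvec b)
       else cinner d p (unit_cvec a) * cinner d (unit_cvec b) p)"
    using linear_or_antilinear_section[OF size] by blast
  have "(\<Sum>i<r. \<Sum>j<r. cnj (w a i) * w b j * \<Phi> i j c e) =
      (if s then of_bool (c = a \<and> e = b) else of_bool (c = b \<and> e = a))"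
    if abce: "a < d" "b < d" "c < d" "e < d" for a b c e
  proof -
    define Y where "Y c e = (\<Sum>i<r. \<Sum>j<r. cnj (w a i) * w b j * \<Phi> i j c e)" for c e
    define m n where "m = (if s then a else b)" and "n = (if s then b else a)"
    have mn: "m < d" "n < d" using abce by (auto simp: m_def n_def)
    have "(\<Sum>c<d. \<Sum>e<d. p c * cnj (p e) * (Y c e - unit_cvec m c * unit_cvec n e)) = 0" for p :: cvec
    proof -
      have "(\<Sum>c<d. \<Sum>e<d. p c * cnj (p e) * (unit_cvec m c * unit_cvec n e)) = p m * cnj (p n)"
      proof -
        have "(\<Sum>c<d. \<Sum>e<d. p c * cnj (p e) * (unit_cvec m c * unit_cvec n e))
          = (\<Sum>c<d. unit_cvec m c * (p c * (\<Sum>e<d. unit_cvec n e * cnj (p e))))"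
          by (simp add: sum_distrib_left mult_ac del: sum_unit_cvec)
        then show ?thesis using mn by simp
      qed
      moreover have "(\<Sum>c<d. \<Sum>e<d. p c * cnj (p e) * Y c e) = p m * cnj (p n)"
      proof -
        have "(\<Sum>c<d. \<Sum>e<d. p c * cnj (p e) * Y c e) = tensor_form r d \<Phi> (w a) (w b) p p"
          by (simp only: tensor_form_by_matrix Y_def)
        also have "\<dots> = p m * cnj (p n)"
          unfolding w[OF abce(1,2)] using abce by (cases s) (simp_all add: m_def n_def)
        finally show ?thesis .
      qed
      ultimately show ?thesis by (simp add: right_diff_distrib sum_subtractf)
    qed
    then have "Y c e - unit_cvec m c * unit_cvec n e = 0"
      using abce(3,4) by (rule sesquilinear_zeroD)
    then have "Y c e = of_bool (c = m) * of_bool (e = n)" by (simp add: unit_cvec_def)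
    then have "Y c e = (if s then of_bool (c = a \<and> e = b) else of_bool (c = b \<and> e = a))"
      by (cases s) (simp_all add: m_def n_def)
    then show ?thesis unfolding Y_def .
  qed
  then show ?thesis by (intro exI[of _ s] exI[of _ w]) blast
qed

section \<open>Hermitian matrices and their blocks\<close>

lemma dim_mat_adjoint [simp]: "dim_row (mat_adjoint A) = dim_col A" "dim_col (mat_adjoint A) = dim_row A"
  by (simp_all add: mat_adjoint_def)

lemma mat_adjoint_index [simp]:
  fixes A :: "complex mat"
  assumes "i < dim_col A" "j < dim_row A"
  shows "mat_adjoint A $$ (i, j) = cnj (A $$ (j, i))"
  using assms by (simp add: mat_adjoint_def mat_of_rows_index)

lemma Her_iff:
  "A \<in> Her n \<longleftrightarrow> A \<in> carrier_mat n n \<and> (\<forall>i<n. \<forall>j<n. cnj (A $$ (j, i)) = A $$ (i, j))"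
proof
  assume A: "A \<in> Her n"
  then have car: "A \<in> carrier_mat n n" and adj: "mat_adjoint A = A" by (auto simp: Her_def)
  have "cnj (A $$ (j, i)) = A $$ (i, j)" if "i < n" "j < n" for i j
    using mat_adjoint_index[of i A j] that car by (simp add: adj)
  with car show "A \<in> carrier_mat n n \<and> (\<forall>i<n. \<forall>j<n. cnj (A $$ (j, i)) = A $$ (i, j))" by blast
next
  assume A: "A \<in> carrier_mat n n \<and> (\<forall>i<n. \<forall>j<n. cnj (A $$ (j, i)) = A $$ (i, j))"
  have "mat_adjoint A = A"
  proof (rule eq_matI)
    fix i j assume ij: "i < dim_row A" "j < dim_col A"
    have "dim_row A = n" "dim_col A = n" using A by auto
    with ij A show "mat_adjoint A $$ (i, j) = A $$ (i, j)" by (subst mat_adjoint_index) auto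
  qed (use A in auto)
  with A show "A \<in> Her n" by (simp add: Her_def)
qed

definition quadratic_form :: "nat \<Rightarrow> complex mat \<Rightarrow> cvec \<Rightarrow> complex" where
  "quadratic_form n A v = (\<Sum>i<n. \<Sum>j<n. cnj (v i) * v j * A $$ (i, j))"

lemma positive_semidefinite_iff:
  assumes "A \<in> Her n"
  shows "positive_semidefinite A \<longleftrightarrow> (\<forall>v. 0 \<le> Re (quadratic_form n A v))"
proof -
  have A: "A \<in> carrier_mat n n" using assms by (simp add: Her_iff)
  have *: "(A *\<^sub>v vec n v) \<bullet>c vec n v = quadratic_form n A v" for v
  proof -
    have "(A *\<^sub>v vec n v) \<bullet>c vec n v = (\<Sum>i<n. (\<Sum>j<n. A $$ (i, j) * v j) * cnj (v i))"
      using A by (simp add: scalar_prod_def atLeast0LessThan)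
    also have "\<dots> = quadratic_form n A v"
      unfolding quadratic_form_def
      by (intro sum.cong[OF refl], subst sum_distrib_right, intro sum.cong[OF refl]) simp
    finally show ?thesis .
  qed
  have "(\<forall>v\<in>carrier_vec n. 0 \<le> Re ((A *\<^sub>v v) \<bullet>c v)) \<longleftrightarrow> (\<forall>v. 0 \<le> Re (quadratic_form n A v))"
  proof safe
    fix v :: cvec
    assume "\<forall>v\<in>carrier_vec n. 0 \<le> Re ((A *\<^sub>v v) \<bullet>c v)"
    then show "0 \<le> Re (quadratic_form n A v)" by (metis * vec_carrier)
  next
    fix v :: "complex vec"
    assume v: "\<forall>v. 0 \<le> Re (quadratic_form n A v)" "v \<in> carrier_vec n"
    have "vec n (\<lambda>i. v $ i) = v" using v(2) by auto
    then show "0 \<le> Re ((A *\<^sub>v v) \<bullet>c v)" using *[of "\<lambda>i. v $ i"] v(1) by metis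
  qed
  then show ?thesis using A assms by (simp add: positive_semidefinite_def)
qed

lemma block_index_less: "i < s \<Longrightarrow> a < d \<Longrightarrow> i * d + a < s * (d :: nat)"
proof -
  assume "i < s" "a < d"
  then have "i * d + a < Suc i * d" by simp
  also have "\<dots> \<le> s * d" using \<open>i < s\<close> by (intro mult_right_mono) auto
  finally show ?thesis .
qed

lemma block_index_exhaust:
  assumes "P < s * (d :: nat)"
  obtains i a where "i < s" "a < d" "P = i * d + a"
proof
  have "d > 0" using assms by (auto intro: gr0I)
  then show "P div d < s" "P mod d < d" "P = P div d * d + P mod d"
    using assms by (auto simp: less_mult_imp_div_less)
qed

lemma sum_blocks: "(\<Sum>P<s * d. F P) = (\<Sum>p<s. \<Sum>a<(d::nat). F (p * d + a))"
proof -
  have "sum F {p * d..<p * d + d} = (\<Sum>a<d. F (p * d + a))" for p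
    using sum.shift_bounds_nat_ivl[of F 0 "p * d" d]
    by (simp add: atLeast0LessThan add.commute)
  then show ?thesis using sum.nat_group[of F d s] by simp
qed

lemma sum_swap22:
  fixes F :: "nat \<Rightarrow> nat \<Rightarrow> nat \<Rightarrow> nat \<Rightarrow> complex"
  shows "(\<Sum>i\<in>I. \<Sum>j\<in>J. \<Sum>a\<in>A. \<Sum>b\<in>B. F i j a b) = (\<Sum>a\<in>A. \<Sum>b\<in>B. \<Sum>i\<in>I. \<Sum>j\<in>J. F i j a b)"
proof -
  have "(\<Sum>i\<in>I. \<Sum>j\<in>J. \<Sum>a\<in>A. \<Sum>b\<in>B. F i j a b) = (\<Sum>a\<in>A. \<Sum>i\<in>I. \<Sum>j\<in>J. \<Sum>b\<in>B. F i j a b)"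
    by (rule sum_rotate3)
  also have "\<dots> = (\<Sum>a\<in>A. \<Sum>b\<in>B. \<Sum>i\<in>I. \<Sum>j\<in>J. F i j a b)"
    by (rule sum.cong[OF refl], rule sum_rotate3)
  finally show ?thesis .
qed

lemma quadratic_form_blocks:
  "quadratic_form (s * d) A v =
     (\<Sum>p<s. \<Sum>q<s. \<Sum>a<d. \<Sum>b<d. cnj (v (p * d + a)) * v (q * d + b) * A $$ (p * d + a, q * d + b))"
  unfolding quadratic_form_def sum_blocks
  by (rule sum.cong[OF refl], rule sum.swap)

section \<open>The map id tensor phi in coordinates\<close>

definition unit_mat :: "nat \<Rightarrow> nat \<Rightarrow> nat \<Rightarrow> complex mat" where
  "unit_mat d a b = mat d d (\<lambda>(k, l). of_bool (k = a \<and> l = b))"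

lemma star_linear_expand:
  assumes \<phi>: "star_linear d r \<phi>" and X: "X \<in> carrier_mat d d" and ij: "i < r" "j < r"
  shows "\<phi> X $$ (i, j) = (\<Sum>a<d. \<Sum>b<d. X $$ (a, b) * \<phi> (unit_mat d a b) $$ (i, j))"
proof -
  define part where "part S = mat d d (\<lambda>(a, b). if (a, b) \<in> S then X $$ (a, b) else 0)" for S
  have car: "\<phi> A \<in> carrier_mat r r" if "A \<in> carrier_mat d d" for A
    using \<phi> that by (simp add: star_linear_def)
  have [simp]: "part S \<in> carrier_mat d d" "unit_mat d a b \<in> carrier_mat d d" for S a b
    by (simp_all add: part_def unit_mat_def)
  have "\<phi> (part S) $$ (i, j) = (\<Sum>(a, b)\<in>S. X $$ (a, b) * \<phi> (unit_mat d a b) $$ (i, j))"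
    if "finite S" "S \<subseteq> {..<d} \<times> {..<d}" for S
    using that
  proof (induction S rule: finite_induct)
    case empty
    have "part {} = 0 \<cdot>\<^sub>m part {}" by (rule eq_matI) (auto simp: part_def)
    then have "\<phi> (part {}) = 0 \<cdot>\<^sub>m \<phi> (part {})"
      using \<phi> by (metis \<open>\<And>S. part S \<in> carrier_mat d d\<close> star_linear_def)
    then have "\<phi> (part {}) $$ (i, j) = (0 \<cdot>\<^sub>m \<phi> (part {})) $$ (i, j)" by simp
    also have "\<dots> = 0" using car[of "part {}"] ij by simp
    finally show ?case by simp
  next
    case (insert ab S)
    obtain a b where ab: "ab = (a, b)" by (cases ab)
    have "part (insert ab S) = X $$ (a, b) \<cdot>\<^sub>m unit_mat d a b + part S"
      using insert ab by (intro eq_matI) (auto simp: part_def unit_mat_def)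
    then have "\<phi> (part (insert ab S)) = X $$ (a, b) \<cdot>\<^sub>m \<phi> (unit_mat d a b) + \<phi> (part S)"
      using \<phi> by (simp add: star_linear_def)
    then show ?case
      using insert ij ab car[of "unit_mat d a b"] car[of "part S"] by simp
  qed
  from this[of "{..<d} \<times> {..<d}"] have "\<phi> (part ({..<d} \<times> {..<d})) $$ (i, j)
      = (\<Sum>a<d. \<Sum>b<d. X $$ (a, b) * \<phi> (unit_mat d a b) $$ (i, j))"
    by (simp add: sum.cartesian_product)
  moreover have "part ({..<d} \<times> {..<d}) = X"
    using X by (intro eq_matI) (auto simp: part_def)
  ultimately show ?thesis by simp
qed

lemma id_tensor_index:
  assumes \<phi>: "star_linear d r \<phi>" and pq: "p < s" "q < s" and ij: "i < r" "j < r"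
  shows "id_tensor s d r \<phi> A $$ (p * r + i, q * r + j) =
    (\<Sum>a<d. \<Sum>b<d. A $$ (p * d + a, q * d + b) * \<phi> (unit_mat d a b) $$ (i, j))"
proof -
  have "id_tensor s d r \<phi> A $$ (p * r + i, q * r + j) = \<phi> (tensor_block d A p q) $$ (i, j)"
    using block_index_less[OF pq(1) ij(1)] block_index_less[OF pq(2) ij(2)] ij
    by (simp add: id_tensor_def)
  also have "\<dots> = (\<Sum>a<d. \<Sum>b<d. tensor_block d A p q $$ (a, b) * \<phi> (unit_mat d a b) $$ (i, j))"
    by (rule star_linear_expand[OF \<phi> _ ij]) (simp add: tensor_block_def)
  finally show ?thesis by (simp add: tensor_block_def)
qed

lemma star_linear_unit_mat_adjoint:
  assumes \<phi>: "star_linear d r \<phi>" and "i < r" "j < r" "a < d" "b < d"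
  shows "\<phi> (unit_mat d b a) $$ (j, i) = cnj (\<phi> (unit_mat d a b) $$ (i, j))"
proof -
  have "unit_mat d b a = mat_adjoint (unit_mat d a b)"
    by (rule eq_matI) (auto simp: unit_mat_def)
  then have "\<phi> (unit_mat d b a) = mat_adjoint (\<phi> (unit_mat d a b))"
    using \<phi> by (simp add: star_linear_def unit_mat_def)
  moreover have "\<phi> (unit_mat d a b) \<in> carrier_mat r r"
    using \<phi> by (simp add: star_linear_def unit_mat_def)
  ultimately show ?thesis using assms by simp
qed

lemma id_tensor_Her:
  assumes \<phi>: "star_linear d r \<phi>" and A: "A \<in> Her (s * d)"
  shows "id_tensor s d r \<phi> A \<in> Her (s * r)"
  unfolding Her_iff
proof (intro conjI allI impI)
  show "id_tensor s d r \<phi> A \<in> carrier_mat (s * r) (s * r)" by (simp add: id_tensor_def)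
  fix P Q assume "P < s * r" "Q < s * r"
  then obtain p i q j where *: "p < s" "i < r" "P = p * r + i" "q < s" "j < r" "Q = q * r + j"
    by (metis block_index_exhaust)
  have "cnj (id_tensor s d r \<phi> A $$ (Q, P)) =
      (\<Sum>b<d. \<Sum>a<d. cnj (A $$ (q * d + b, p * d + a)) * cnj (\<phi> (unit_mat d b a) $$ (j, i)))"
    using * by (simp add: id_tensor_index[OF \<phi>])
  also have "\<dots> = (\<Sum>b<d. \<Sum>a<d. A $$ (p * d + a, q * d + b) * \<phi> (unit_mat d a b) $$ (i, j))"
  proof (intro sum.cong[OF refl])
    fix a b assume "a \<in> {..<d}" "b \<in> {..<d}"
    then show "cnj (A $$ (q * d + b, p * d + a)) * cnj (\<phi> (unit_mat d b a) $$ (j, i))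
      = A $$ (p * d + a, q * d + b) * \<phi> (unit_mat d a b) $$ (i, j)"
      using A * block_index_less[of p s a d] block_index_less[of q s b d]
        star_linear_unit_mat_adjoint[OF \<phi>, of j i b a]
      by (simp add: Her_iff)
  qed
  also have "\<dots> = id_tensor s d r \<phi> A $$ (P, Q)"
    using * by (subst sum.swap) (simp add: id_tensor_index[OF \<phi>])
  finally show "cnj (id_tensor s d r \<phi> A $$ (Q, P)) = id_tensor s d r \<phi> A $$ (P, Q)" .
qed

lemma id_tensor_transpose_index:
  assumes "p < s" "q < s" "a < d" "b < d"
  shows "id_tensor s d d transpose_mat A $$ (p * d + a, q * d + b) = A $$ (p * d + b, q * d + a)"
  using block_index_less[OF assms(1,3)] block_index_less[OF assms(2,4)] assms
  by (simp add: id_tensor_def tensor_block_def)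

lemma id_tensor_transpose_Her:
  assumes A: "A \<in> Her (s * d)"
  shows "id_tensor s d d transpose_mat A \<in> Her (s * d)"
  unfolding Her_iff
proof (intro conjI allI impI)
  show "id_tensor s d d transpose_mat A \<in> carrier_mat (s * d) (s * d)" by (simp add: id_tensor_def)
  fix P Q assume "P < s * d" "Q < s * d"
  then obtain p i q j where *: "p < s" "i < d" "P = p * d + i" "q < s" "j < d" "Q = q * d + j"
    by (metis block_index_exhaust)
  then show "cnj (id_tensor s d d transpose_mat A $$ (Q, P)) = id_tensor s d d transpose_mat A $$ (P, Q)"
    using A block_index_less[of p s j d] block_index_less[of q s i d]
    by (simp add: id_tensor_transpose_index Her_iff)
qed

section \<open>Free spectrahedra\<close>

text \<open>
  Applied to the block \<open>K\<close> of a matrix on the tensor product, this computes the quadratic form of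
  \<open>id \<otimes> \<phi>\<close> at the image of \<open>x\<close> and \<open>y\<close> under the section \<open>W\<close>: the result is the form of the block
  itself or of its transpose.
\<close>

lemma section_pullback:
  fixes W :: "nat \<Rightarrow> cvec" and K :: "nat \<Rightarrow> nat \<Rightarrow> complex"
  assumes W: "\<And>a b c e. a < d \<Longrightarrow> b < d \<Longrightarrow> c < d \<Longrightarrow> e < d \<Longrightarrow>
    (\<Sum>i<r. \<Sum>j<r. cnj (W a i) * W b j * \<Phi> i j c e) =
      (if \<sigma> then of_bool (c = a \<and> e = b) else of_bool (c = b \<and> e = a))"
  shows "(\<Sum>i<r. \<Sum>j<r. cnj (\<Sum>a<d. x a * W a i) * (\<Sum>b<d. y b * W b j) *
           (\<Sum>c<d. \<Sum>e<d. K c e * \<Phi> i j c e))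
       = (\<Sum>a<d. \<Sum>b<d. cnj (x a) * y b * (if \<sigma> then K a b else K b a))"
proof -
  have inner: "(\<Sum>i<r. \<Sum>j<r. cnj (W a i) * W b j * (\<Sum>c<d. \<Sum>e<d. K c e * \<Phi> i j c e))
      = (if \<sigma> then K a b else K b a)" if ab: "a < d" "b < d" for a b
  proof -
    define m n where "m = (if \<sigma> then a else b)" and "n = (if \<sigma> then b else a)"
    have mn: "m < d" "n < d" using ab by (auto simp: m_def n_def)
    have "(\<Sum>i<r. \<Sum>j<r. cnj (W a i) * W b j * (\<Sum>c<d. \<Sum>e<d. K c e * \<Phi> i j c e))
       = (\<Sum>i<r. \<Sum>j<r. \<Sum>c<d. \<Sum>e<d. K c e * (cnj (W a i) * W b j * \<Phi> i j c e))"
      by (simp add: sum_distrib_left mult_ac)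
    also have "\<dots> = (\<Sum>c<d. \<Sum>e<d. K c e * (\<Sum>i<r. \<Sum>j<r. cnj (W a i) * W b j * \<Phi> i j c e))"
      by (subst sum_swap22) (simp add: sum_distrib_left)
    also have "\<dots> = (\<Sum>c<d. \<Sum>e<d. K c e * (unit_cvec m c * unit_cvec n e))"
    proof (intro sum.cong[OF refl])
      fix c e assume "c \<in> {..<d}" "e \<in> {..<d}"
      then have "(\<Sum>i<r. \<Sum>j<r. cnj (W a i) * W b j * \<Phi> i j c e)
          = (if \<sigma> then of_bool (c = a \<and> e = b) else of_bool (c = b \<and> e = a))"
        using ab by (intro W) auto
      also have "\<dots> = unit_cvec m c * unit_cvec n e"
        by (cases \<sigma>) (simp_all add: m_def n_def unit_cvec_def)
      finally show "K c e * (\<Sum>i<r. \<Sum>j<r. cnj (W a i) * W b j * \<Phi> i j c e)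
          = K c e * (unit_cvec m c * unit_cvec n e)" by simp
    qed
    also have "\<dots> = (\<Sum>c<d. unit_cvec m c * (\<Sum>e<d. unit_cvec n e * K c e))"
      by (simp add: sum_distrib_left mult_ac del: sum_unit_cvec)
    also have "\<dots> = K m n" using mn by simp
    finally show ?thesis by (simp add: m_def n_def)
  qed
  have "(\<Sum>i<r. \<Sum>j<r. cnj (\<Sum>a<d. x a * W a i) * (\<Sum>b<d. y b * W b j) * G i j)
      = (\<Sum>a<d. \<Sum>b<d. cnj (x a) * y b * (\<Sum>i<r. \<Sum>j<r. cnj (W a i) * W b j * G i j))"
    for G :: "nat \<Rightarrow> nat \<Rightarrow> complex"
  proof -
    have "(\<Sum>i<r. \<Sum>j<r. cnj (\<Sum>a<d. x a * W a i) * (\<Sum>b<d. y b * W b j) * G i j)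
      = (\<Sum>i<r. \<Sum>j<r. \<Sum>a<d. \<Sum>b<d. cnj (x a) * y b * (cnj (W a i) * W b j * G i j))"
      unfolding cnj_sum sum_product sum_distrib_right
      by (intro sum.cong[OF refl]) (simp add: sum_distrib_left sum_distrib_right mult_ac)
    also have "\<dots> = (\<Sum>a<d. \<Sum>b<d. cnj (x a) * y b * (\<Sum>i<r. \<Sum>j<r. cnj (W a i) * W b j * G i j))"
      by (subst sum_swap22) (simp add: sum_distrib_left)
    finally show ?thesis .
  qed
  then show ?thesis using inner by simp
qed

text \<open>
  The entries of \<open>(\<Sum>i\<in>I. f\<^sub>i f\<^sub>i\<^sup>*) - \<epsilon> v v\<^sup>*\<close>, the Hermitian matrices for which reflection of
  positivity has to be checked.
\<close>

definition rank_one_combination :: "nat set \<Rightarrow> (nat \<Rightarrow> cvec) \<Rightarrow> real \<Rightarrow> cvec \<Rightarrow> nat \<Rightarrow> nat \<Rightarrow> complex" where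
  "rank_one_combination I f \<epsilon> v a b = (\<Sum>i\<in>I. f i a * cnj (f i b)) - of_real \<epsilon> * (v a * cnj (v b))"

lemma sum_rank_one_combination:
  "(\<Sum>a<d. \<Sum>b<d. rank_one_combination I f \<epsilon> v a b * G a b) =
     (\<Sum>i\<in>I. \<Sum>a<d. \<Sum>b<d. f i a * cnj (f i b) * G a b) - of_real \<epsilon> * (\<Sum>a<d. \<Sum>b<d. v a * cnj (v b) * G a b)"
proof -
  have "(\<Sum>a<d. \<Sum>b<d. rank_one_combination I f \<epsilon> v a b * G a b) =
     (\<Sum>a<d. \<Sum>b<d. \<Sum>i\<in>I. f i a * cnj (f i b) * G a b) - of_real \<epsilon> * (\<Sum>a<d. \<Sum>b<d. v a * cnj (v b) * G a b)"
    by (simp add: rank_one_combination_def left_diff_distrib sum_subtractf sum_distrib_right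
        sum_distrib_left mult.assoc)
  also have "(\<Sum>a<d. \<Sum>b<d. \<Sum>i\<in>I. f i a * cnj (f i b) * G a b) =
     (\<Sum>i\<in>I. \<Sum>a<d. \<Sum>b<d. f i a * cnj (f i b) * G a b)"
    by (rule sum_rotate3)
  finally show ?thesis .
qed

lemma rank_one_quadratic:
  "(\<Sum>a<d. \<Sum>b<d. x a * cnj (x b) * (cnj (z a) * z b)) = of_real ((cmod (cinner d z x))^2)"
proof -
  have "(\<Sum>a<d. \<Sum>b<d. x a * cnj (x b) * (cnj (z a) * z b)) = cinner d z x * cnj (cinner d z x)"
    by (simp add: cinner_def sum_product mult_ac)
  then show ?thesis by (simp only: complex_norm_square)
qed

text \<open>
  At level one the matrix inequality makes \<open>\<phi>\<close> positive and positivity reflecting. The resulting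
  section \<open>W\<close> turns the quadratic form of \<open>A\<close>, or of its partial transpose, into a value of the
  quadratic form of \<open>(id \<otimes> \<phi>)(A)\<close>.
\<close>

theorem free_spectrahedron_contained:
  assumes C: "abstract_operator_system d C"
    and C1: "C 1 = {A \<in> Her d. positive_semidefinite A}"
    and r: "r < 2 * d - 1" and free: "free_spectrahedron d r C"
  shows "system_contained C (Psd d) \<or> system_contained C (Psd_Gamma d)"
proof -
  obtain \<phi> where \<phi>: "star_linear d r \<phi>"
    and lmi: "\<And>s A. s \<ge> 1 \<Longrightarrow> A \<in> Her (s * d) \<Longrightarrow> A \<in> C s \<longleftrightarrow> positive_semidefinite (id_tensor s d r \<phi> A)"
    using free unfolding free_spectrahedron_def by blast
  define \<Phi> where "\<Phi> i j a b = \<phi> (unit_mat d a b) $$ (i, j)" for i j a b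
  have quad1: "quadratic_form r (id_tensor 1 d r \<phi> X) w =
      (\<Sum>a<d. \<Sum>b<d. X $$ (a, b) * (\<Sum>i<r. \<Sum>j<r. cnj (w i) * w j * \<Phi> i j a b))"
    if "X \<in> carrier_mat d d" for X w
  proof -
    have "quadratic_form r (id_tensor 1 d r \<phi> X) w =
       (\<Sum>i<r. \<Sum>j<r. \<Sum>a<d. \<Sum>b<d. X $$ (a, b) * (cnj (w i) * w j * \<Phi> i j a b))"
      unfolding quadratic_form_def \<Phi>_def
      using id_tensor_index[OF \<phi>, of 0 1 0 _ _ X]
      by (intro sum.cong[OF refl]) (simp add: sum_distrib_left mult_ac)
    then show ?thesis by (subst (asm) sum_swap22) (simp add: sum_distrib_left)
  qed
  have lmi1: "positive_semidefinite X \<longleftrightarrow>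
      (\<forall>w. 0 \<le> Re (\<Sum>a<d. \<Sum>b<d. X $$ (a, b) * (\<Sum>i<r. \<Sum>j<r. cnj (w i) * w j * \<Phi> i j a b)))"
    if X: "X \<in> Her d" for X
  proof -
    have "id_tensor 1 d r \<phi> X \<in> Her r" using id_tensor_Her[OF \<phi>, of X 1] X by simp
    then have "positive_semidefinite (id_tensor 1 d r \<phi> X) \<longleftrightarrow>
        (\<forall>w. 0 \<le> Re (quadratic_form r (id_tensor 1 d r \<phi> X) w))"
      by (rule positive_semidefinite_iff)
    moreover have "positive_semidefinite X \<longleftrightarrow> positive_semidefinite (id_tensor 1 d r \<phi> X)"
      using lmi[of 1 X] X C1 by simp
    moreover have "X \<in> carrier_mat d d" using X by (simp add: Her_iff)
    ultimately show ?thesis using quad1 by simp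
  qed
  have quad_swap: "quadratic_form d X z = (\<Sum>a<d. \<Sum>b<d. X $$ (a, b) * (cnj (z a) * z b))" for X z
    by (simp add: quadratic_form_def mult.commute)
  have "\<exists>\<sigma> (W :: nat \<Rightarrow> cvec). \<forall>a<d. \<forall>b<d. \<forall>c<d. \<forall>e<d.
    (\<Sum>i<r. \<Sum>j<r. cnj (W a i) * W b j * \<Phi> i j c e) =
      (if \<sigma> then of_bool (c = a \<and> e = b) else of_bool (c = b \<and> e = a))"
  proof (rule tensor_linear_or_antilinear_section[OF _ _ _ r])
    show "\<Phi> j i b a = cnj (\<Phi> i j a b)" if "i < r" "j < r" "a < d" "b < d" for i j a b
      unfolding \<Phi>_def by (rule star_linear_unit_mat_adjoint[OF \<phi> that])
  next
    fix w x :: cvec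
    define X where "X = mat d d (\<lambda>(a, b). x a * cnj (x b))"
    have "X \<in> Her d" by (auto simp: X_def Her_iff)
    moreover have "positive_semidefinite X"
      unfolding positive_semidefinite_iff[OF \<open>X \<in> Her d\<close>] quad_swap
      using rank_one_quadratic[of x _ d] by (simp add: X_def)
    ultimately have "0 \<le> Re (\<Sum>a<d. \<Sum>b<d. X $$ (a, b) * (\<Sum>i<r. \<Sum>j<r. cnj (w i) * w j * \<Phi> i j a b))"
      using lmi1 by blast
    then show "0 \<le> Re (tensor_form r d \<Phi> w w x x)"
      by (simp add: tensor_form_by_matrix X_def)
  next
    fix I :: "nat set" and z v :: cvec and f :: "nat \<Rightarrow> cvec" and \<epsilon> :: real
    assume I: "finite I" and zf: "\<And>i. i \<in> I \<Longrightarrow> cinner d z (f i) = 0" and zv: "cinner d z v \<noteq> 0" and \<epsilon>: "0 < \<epsilon>"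
    show "\<exists>w. (\<Sum>i\<in>I. Re (tensor_form r d \<Phi> w w (f i) (f i))) < \<epsilon> * Re (tensor_form r d \<Phi> w w v v)"
    proof (rule ccontr)
      assume neg: "\<not> ?thesis"
      define X where "X = mat d d (\<lambda>(a, b). rank_one_combination I f \<epsilon> v a b)"
      have X: "X \<in> Her d" by (auto simp: X_def Her_iff rank_one_combination_def mult.commute)
      have "(\<Sum>a<d. \<Sum>b<d. X $$ (a, b) * G a b) =
        (\<Sum>i\<in>I. \<Sum>a<d. \<Sum>b<d. f i a * cnj (f i b) * G a b) - of_real \<epsilon> * (\<Sum>a<d. \<Sum>b<d. v a * cnj (v b) * G a b)"
        for G by (simp add: X_def sum_rank_one_combination[symmetric])
      note XG = this
      have "positive_semidefinite X"
        unfolding lmi1[OF X] XG using neg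
        by (auto simp: not_less tensor_form_by_matrix)
      then have "0 \<le> Re (quadratic_form d X z)" using positive_semidefinite_iff[OF X] by blast
      also have "quadratic_form d X z = of_real (- \<epsilon> * (cmod (cinner d z v))^2)"
        unfolding quad_swap XG rank_one_quadratic using zf by simp
      finally have "\<epsilon> * (cmod (cinner d z v))^2 \<le> 0" by simp
      then show False using \<epsilon> zv by (simp add: mult_le_0_iff)
    qed
  qed
  then obtain \<sigma> and W :: "nat \<Rightarrow> cvec" where W: "\<And>a b c e. a < d \<Longrightarrow> b < d \<Longrightarrow> c < d \<Longrightarrow> e < d \<Longrightarrow>
    (\<Sum>i<r. \<Sum>j<r. cnj (W a i) * W b j * \<Phi> i j c e) =
      (if \<sigma> then of_bool (c = a \<and> e = b) else of_bool (c = b \<and> e = a))"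
    by blast
  have pos: "0 \<le> Re (\<Sum>p<s. \<Sum>q<s. \<Sum>a<d. \<Sum>b<d. cnj (y (p * d + a)) * y (q * d + b) *
       (if \<sigma> then A $$ (p * d + a, q * d + b) else A $$ (p * d + b, q * d + a)))"
    if s: "s \<ge> 1" and A: "A \<in> C s" "A \<in> Her (s * d)" for s A and y :: cvec
  proof -
    define v where "v P = (\<Sum>a<d. y (P div r * d + a) * W a (P mod r))" for P
    have "0 \<le> Re (quadratic_form (s * r) (id_tensor s d r \<phi> A) v)"
      using lmi[OF s A(2)] A positive_semidefinite_iff[OF id_tensor_Her[OF \<phi> A(2)]] by blast
    also have "quadratic_form (s * r) (id_tensor s d r \<phi> A) v =
      (\<Sum>p<s. \<Sum>q<s. \<Sum>i<r. \<Sum>j<r. cnj (\<Sum>a<d. y (p * d + a) * W a i) * (\<Sum>b<d. y (q * d + b) * W b j) *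
         (\<Sum>c<d. \<Sum>e<d. A $$ (p * d + c, q * d + e) * \<Phi> i j c e))"
      unfolding quadratic_form_blocks
    proof (intro sum.cong[OF refl])
      fix p q i j assume "p \<in> {..<s}" "q \<in> {..<s}" "i \<in> {..<r}" "j \<in> {..<r}"
      then show "cnj (v (p * r + i)) * v (q * r + j) * id_tensor s d r \<phi> A $$ (p * r + i, q * r + j) =
        cnj (\<Sum>a<d. y (p * d + a) * W a i) * (\<Sum>b<d. y (q * d + b) * W b j) *
         (\<Sum>c<d. \<Sum>e<d. A $$ (p * d + c, q * d + e) * \<Phi> i j c e)"
        by (simp add: v_def id_tensor_index[OF \<phi>] \<Phi>_def)
    qed
    also have "\<dots> = (\<Sum>p<s. \<Sum>q<s. \<Sum>a<d. \<Sum>b<d. cnj (y (p * d + a)) * y (q * d + b) *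
       (if \<sigma> then A $$ (p * d + a, q * d + b) else A $$ (p * d + b, q * d + a)))"
      by (intro sum.cong[OF refl])
         (rule section_pullback[where K = "\<lambda>c e. A $$ (_ * d + c, _ * d + e)", OF W])
    finally show ?thesis .
  qed
  have Her: "A \<in> Her (s * d)" if "s \<ge> 1" "A \<in> C s" for s A
    using C that unfolding abstract_operator_system_def proper_convex_cone_def convex_cone_Her_def by blast
  show ?thesis
  proof (cases \<sigma>)
    case True
    have "system_contained C (Psd d)"
      unfolding system_contained_def
    proof (intro allI impI subsetI)
      fix s A assume s: "1 \<le> s" and A: "A \<in> C s"
      have H: "A \<in> Her (s * d)" by (rule Her[OF s A])
      have "positive_semidefinite A"
        unfolding positive_semidefinite_iff[OF H] quadratic_form_blocks
        using pos[OF s A H] True by simp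
      with H show "A \<in> Psd d s" by (simp add: Psd_def)
    qed
    then show ?thesis ..
  next
    case False
    have "system_contained C (Psd_Gamma d)"
      unfolding system_contained_def
    proof (intro allI impI subsetI)
      fix s A assume s: "1 \<le> s" and A: "A \<in> C s"
      have H: "A \<in> Her (s * d)" by (rule Her[OF s A])
      have HT: "id_tensor s d d transpose_mat A \<in> Her (s * d)"
        by (rule id_tensor_transpose_Her[OF H])
      have "positive_semidefinite (id_tensor s d d transpose_mat A)"
        unfolding positive_semidefinite_iff[OF HT] quadratic_form_blocks
        using pos[OF s A H] False by (simp add: id_tensor_transpose_index)
      with H show "A \<in> Psd_Gamma d s" by (simp add: Psd_Gamma_def)
    qed
    then show ?thesis ..
  qed
qed

section \<open>Compressions\<close>

definition compress :: "nat \<Rightarrow> complex mat \<Rightarrow> complex mat \<Rightarrow> complex mat" where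
  "compress d V A = mat_adjoint (V \<otimes>\<^sub>K 1\<^sub>m d) * A * (V \<otimes>\<^sub>K 1\<^sub>m d)"

lemma kronecker_one_index:
  assumes "V \<in> carrier_mat s t" "p < s" "i < t" "a < d" "b < d"
  shows "(V \<otimes>\<^sub>K 1\<^sub>m d) $$ (p * d + a, i * d + b) = V $$ (p, i) * unit_cvec b a"
  using assms block_index_less[of p s a d] block_index_less[of i t b d]
  by (simp add: kronecker_def unit_cvec_def)

lemma kronecker_one_carrier: "V \<in> carrier_mat s t \<Longrightarrow> V \<otimes>\<^sub>K 1\<^sub>m d \<in> carrier_mat (s * d) (t * d)"
  by (auto simp: kronecker_def)

lemma compress_carrier:
  assumes "V \<in> carrier_mat s t" "A \<in> carrier_mat (s * d) (s * d)"
  shows "compress d V A \<in> carrier_mat (t * d) (t * d)"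
  using kronecker_one_carrier[OF assms(1), of d] assms(2) by (auto simp: compress_def)

lemma compress_index:
  assumes V: "V \<in> carrier_mat s t" and A: "A \<in> carrier_mat (s * d) (s * d)"
    and ij: "i < t" "j < t" and ab: "a < d" "b < d"
  shows "compress d V A $$ (i * d + a, j * d + b) =
    (\<Sum>p<s. \<Sum>q<s. cnj (V $$ (p, i)) * V $$ (q, j) * A $$ (p * d + a, q * d + b))"
proof -
  define K where "K = V \<otimes>\<^sub>K 1\<^sub>m d"
  have K: "K \<in> carrier_mat (s * d) (t * d)" unfolding K_def by (rule kronecker_one_carrier[OF V])
  have P: "i * d + a < t * d" and Q: "j * d + b < t * d" using ij ab by (auto intro: block_index_less)
  have left: "(mat_adjoint K * A) $$ (i * d + a, R) = (\<Sum>p<s. cnj (V $$ (p, i)) * A $$ (p * d + a, R))"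
    if R: "R < s * d" for R
  proof -
    have "(mat_adjoint K * A) $$ (i * d + a, R) = (\<Sum>S<s * d. cnj (K $$ (S, i * d + a)) * A $$ (S, R))"
      using K A P R by (simp add: scalar_prod_def atLeast0LessThan)
    also have "\<dots> = (\<Sum>p<s. \<Sum>c<d. cnj (K $$ (p * d + c, i * d + a)) * A $$ (p * d + c, R))"
      by (rule sum_blocks)
    also have "\<dots> = (\<Sum>p<s. \<Sum>c<d. cnj (unit_cvec a c) * (cnj (V $$ (p, i)) * A $$ (p * d + c, R)))"
      unfolding K_def using ij ab
      by (intro sum.cong[OF refl]) (simp add: kronecker_one_index[OF V])
    also have "\<dots> = (\<Sum>p<s. cnj (V $$ (p, i)) * A $$ (p * d + a, R))" using ab by simp
    finally show ?thesis .
  qed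
  have "compress d V A $$ (i * d + a, j * d + b) =
      (\<Sum>R<s * d. (mat_adjoint K * A) $$ (i * d + a, R) * K $$ (R, j * d + b))"
  proof -
    have "mat_adjoint K * A \<in> carrier_mat (t * d) (s * d)" using K A by auto
    then show ?thesis using K P Q
      by (simp add: compress_def scalar_prod_def atLeast0LessThan flip: K_def) (auto intro!: sum.cong)
  qed
  also have "\<dots> = (\<Sum>R<s * d. (\<Sum>p<s. cnj (V $$ (p, i)) * A $$ (p * d + a, R)) * K $$ (R, j * d + b))"
    by (intro sum.cong[OF refl]) (simp add: left)
  also have "\<dots> = (\<Sum>q<s. \<Sum>c<d. (\<Sum>p<s. cnj (V $$ (p, i)) * A $$ (p * d + a, q * d + c)) * K $$ (q * d + c, j * d + b))"
    by (rule sum_blocks)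
  also have "\<dots> = (\<Sum>q<s. \<Sum>c<d. unit_cvec b c *
      ((\<Sum>p<s. cnj (V $$ (p, i)) * A $$ (p * d + a, q * d + c)) * V $$ (q, j)))"
    unfolding K_def using ij ab
    by (intro sum.cong[OF refl]) (simp add: kronecker_one_index[OF V])
  also have "\<dots> = (\<Sum>q<s. (\<Sum>p<s. cnj (V $$ (p, i)) * A $$ (p * d + a, q * d + b)) * V $$ (q, j))"
    using ab by simp
  also have "\<dots> = (\<Sum>q<s. \<Sum>p<s. cnj (V $$ (p, i)) * V $$ (q, j) * A $$ (p * d + a, q * d + b))"
    by (simp add: sum_distrib_left sum_distrib_right mult_ac)
  also have "\<dots> = (\<Sum>p<s. \<Sum>q<s. cnj (V $$ (p, i)) * V $$ (q, j) * A $$ (p * d + a, q * d + b))"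
    by (rule sum.swap)
  finally show ?thesis .
qed

lemma compress_Her:
  assumes V: "V \<in> carrier_mat s t" and A: "A \<in> Her (s * d)"
  shows "compress d V A \<in> Her (t * d)"
  unfolding Her_iff
proof (intro conjI allI impI)
  have car: "A \<in> carrier_mat (s * d) (s * d)" using A by (simp add: Her_iff)
  show "compress d V A \<in> carrier_mat (t * d) (t * d)" by (rule compress_carrier[OF V car])
  fix P Q assume "P < t * d" "Q < t * d"
  then obtain i a j b where *: "i < t" "a < d" "P = i * d + a" "j < t" "b < d" "Q = j * d + b"
    by (metis block_index_exhaust)
  have "cnj (compress d V A $$ (Q, P)) =
      (\<Sum>q<s. \<Sum>p<s. cnj (V $$ (p, i)) * V $$ (q, j) * A $$ (p * d + a, q * d + b))"
    unfolding * compress_index[OF V car *(4,1,5,2)] cnj_sum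
  proof (intro sum.cong[OF refl])
    fix p q assume "q \<in> {..<s}" "p \<in> {..<s}"
    then have "cnj (A $$ (q * d + b, p * d + a)) = A $$ (p * d + a, q * d + b)"
      using A * block_index_less[of p s a d] block_index_less[of q s b d] by (simp add: Her_iff)
    then show "cnj (cnj (V $$ (q, j)) * V $$ (p, i) * A $$ (q * d + b, p * d + a)) =
      cnj (V $$ (p, i)) * V $$ (q, j) * A $$ (p * d + a, q * d + b)" by simp
  qed
  also have "\<dots> = (\<Sum>p<s. \<Sum>q<s. cnj (V $$ (p, i)) * V $$ (q, j) * A $$ (p * d + a, q * d + b))"
    by (rule sum.swap)
  also have "\<dots> = compress d V A $$ (P, Q)"
    unfolding * by (rule compress_index[OF V car *(1,4,2,5), symmetric])
  finally show "cnj (compress d V A $$ (Q, P)) = compress d V A $$ (P, Q)" .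
qed

section \<open>Operator systems cut out by linear tests\<close>

text \<open>
  The \<open>d \<times> d\<close> matrix obtained by compressing \<open>A\<close> with a single column \<open>x\<close>, that is
  \<open>(x \<otimes> 1)\<^sup>* A (x \<otimes> 1)\<close>.
\<close>

definition slice :: "nat \<Rightarrow> nat \<Rightarrow> complex mat \<Rightarrow> cvec \<Rightarrow> nat \<Rightarrow> nat \<Rightarrow> complex" where
  "slice s d A x a b = (\<Sum>p<s. \<Sum>q<s. cnj (x p) * x q * A $$ (p * d + a, q * d + b))"

definition test_value :: "nat \<Rightarrow> nat \<Rightarrow> (nat \<Rightarrow> nat \<Rightarrow> complex) \<Rightarrow> cvec \<Rightarrow> complex mat \<Rightarrow> real" where
  "test_value s d T x A = Re (\<Sum>a<d. \<Sum>b<d. T a b * slice s d A x a b)"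

text \<open>
  The largest system whose level-one members satisfy the linear tests in \<open>\<T>\<close>: every slice has to pass
  every test.
\<close>

definition test_system :: "nat \<Rightarrow> (nat \<Rightarrow> nat \<Rightarrow> complex) set \<Rightarrow> nat \<Rightarrow> complex mat set" where
  "test_system d \<T> s = {A \<in> Her (s * d). \<forall>T\<in>\<T>. \<forall>x. 0 \<le> test_value s d T x A}"

lemma test_value_flat:
  "test_value s d T x A =
    (\<Sum>a<d. \<Sum>b<d. \<Sum>p<s. \<Sum>q<s. Re (T a b * (cnj (x p) * x q) * A $$ (p * d + a, q * d + b)))"
  unfolding test_value_def slice_def Re_sum[symmetric] by (simp add: sum_distrib_left mult.assoc)

lemma test_value_add:
  assumes "A \<in> carrier_mat (s * d) (s * d)" "B \<in> carrier_mat (s * d) (s * d)"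
  shows "test_value s d T x (A + B) = test_value s d T x A + test_value s d T x B"
proof -
  have "test_value s d T x (A + B) =
    (\<Sum>a<d. \<Sum>b<d. \<Sum>p<s. \<Sum>q<s. Re (T a b * (cnj (x p) * x q) * A $$ (p * d + a, q * d + b))
        + Re (T a b * (cnj (x p) * x q) * B $$ (p * d + a, q * d + b)))"
    unfolding test_value_flat
    by (intro sum.cong[OF refl]) (use assms block_index_less in \<open>simp add: ring_distribs\<close>)
  then show ?thesis unfolding test_value_flat by (simp add: sum.distrib)
qed

lemma Re_of_real_times: "Re (complex_of_real c * z) = c * Re z"
  by simp

lemma test_value_scale:
  assumes "A \<in> carrier_mat (s * d) (s * d)"
  shows "test_value s d T x (complex_of_real c \<cdot>\<^sub>m A) = c * test_value s d T x A"
proof -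
  have "test_value s d T x (complex_of_real c \<cdot>\<^sub>m A) =
    (\<Sum>a<d. \<Sum>b<d. \<Sum>p<s. \<Sum>q<s. c * Re (T a b * (cnj (x p) * x q) * A $$ (p * d + a, q * d + b)))"
    unfolding test_value_flat
  proof (intro sum.cong[OF refl])
    fix a b p q assume "a \<in> {..<d}" "b \<in> {..<d}" "p \<in> {..<s}" "q \<in> {..<s}"
    then have "(complex_of_real c \<cdot>\<^sub>m A) $$ (p * d + a, q * d + b) = of_real c * A $$ (p * d + a, q * d + b)"
      using assms block_index_less[of p s a d] block_index_less[of q s b d] by simp
    then have "T a b * (cnj (x p) * x q) * (complex_of_real c \<cdot>\<^sub>m A) $$ (p * d + a, q * d + b)
        = of_real c * (T a b * (cnj (x p) * x q) * A $$ (p * d + a, q * d + b))" by simp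
    then show "Re (T a b * (cnj (x p) * x q) * (complex_of_real c \<cdot>\<^sub>m A) $$ (p * d + a, q * d + b))
        = c * Re (T a b * (cnj (x p) * x q) * A $$ (p * d + a, q * d + b))"
      by (simp only: Re_of_real_times)
  qed
  then show ?thesis unfolding test_value_flat by (simp add: sum_distrib_left)
qed

text \<open>
  A slice of a compression is a slice of the original matrix, at the image of the column. This
  is why systems of tests are closed under compression.
\<close>

lemma slice_compress:
  assumes V: "V \<in> carrier_mat s t" and A: "A \<in> carrier_mat (s * d) (s * d)" and ab: "a < d" "b < d"
  shows "slice t d (compress d V A) x a b = slice s d A (\<lambda>p. \<Sum>i<t. V $$ (p, i) * x i) a b"
proof -
  have "slice t d (compress d V A) x a b = (\<Sum>i<t. \<Sum>j<t. \<Sum>p<s. \<Sum>q<s.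
      cnj (x i) * x j * (cnj (V $$ (p, i)) * V $$ (q, j) * A $$ (p * d + a, q * d + b)))"
    unfolding slice_def
    by (intro sum.cong[OF refl]) (simp add: compress_index[OF V A] ab sum_distrib_left)
  also have "\<dots> = (\<Sum>p<s. \<Sum>q<s. \<Sum>i<t. \<Sum>j<t.
      cnj (x i) * x j * (cnj (V $$ (p, i)) * V $$ (q, j) * A $$ (p * d + a, q * d + b)))"
    by (rule sum_swap22)
  also have "\<dots> = slice s d A (\<lambda>p. \<Sum>i<t. V $$ (p, i) * x i) a b"
    unfolding slice_def cnj_sum
  proof (intro sum.cong[OF refl])
    fix p q
    show "(\<Sum>i<t. \<Sum>j<t. cnj (x i) * x j * (cnj (V $$ (p, i)) * V $$ (q, j) * A $$ (p * d + a, q * d + b)))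
      = (\<Sum>i<t. cnj (V $$ (p, i) * x i)) * (\<Sum>i<t. V $$ (q, i) * x i) * A $$ (p * d + a, q * d + b)"
      unfolding sum_product sum_distrib_right
      by (intro sum.cong[OF refl]) (simp add: sum_distrib_left sum_distrib_right mult_ac)
  qed
  finally show ?thesis .
qed

lemma zero_Her: "0\<^sub>m n n \<in> Her n"
  by (simp add: Her_iff)

lemma add_Her: "A \<in> Her n \<Longrightarrow> B \<in> Her n \<Longrightarrow> A + B \<in> Her n"
  by (auto simp: Her_iff)

lemma scale_Her: "A \<in> Her n \<Longrightarrow> complex_of_real c \<cdot>\<^sub>m A \<in> Her n"
  by (auto simp: Her_iff)

lemma one_Her: "1\<^sub>m n \<in> Her n"
  by (auto simp: Her_iff)

lemma convex_cone_test_system: "convex_cone_Her (s * d) (test_system d \<T> s)"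
  unfolding convex_cone_Her_def
proof (intro conjI ballI allI impI)
  show "test_system d \<T> s \<subseteq> Her (s * d)" by (auto simp: test_system_def)
  have "test_value s d T x (0\<^sub>m (s * d) (s * d)) = 0" for T x
    using test_value_scale[of "0\<^sub>m (s * d) (s * d)" s d T x 0] by simp
  then show "0\<^sub>m (s * d) (s * d) \<in> test_system d \<T> s" by (simp add: test_system_def zero_Her)
next
  fix A B assume *: "A \<in> test_system d \<T> s" "B \<in> test_system d \<T> s"
  then have "A \<in> carrier_mat (s * d) (s * d)" "B \<in> carrier_mat (s * d) (s * d)"
    by (auto simp: test_system_def Her_iff)
  with * show "A + B \<in> test_system d \<T> s"
    by (simp add: test_system_def add_Her test_value_add)
next
  fix A and c :: real assume *: "A \<in> test_system d \<T> s" "0 \<le> c"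
  then have "A \<in> carrier_mat (s * d) (s * d)" by (auto simp: test_system_def Her_iff)
  with * show "complex_of_real c \<cdot>\<^sub>m A \<in> test_system d \<T> s"
    by (simp add: test_system_def scale_Her test_value_scale)
qed

lemma topspace_Her_topology [simp]: "topspace (Her_topology n) = Her n"
  by (auto simp: Her_topology_def topspace_pullback_topology)

lemma continuous_map_entry:
  assumes "P < n" "Q < n"
  shows "continuous_map (Her_topology n) euclidean (\<lambda>A. A $$ (P, Q))"
proof -
  have "continuous_map (product_topology (\<lambda>_. euclidean) ({..<n} \<times> {..<n})) euclidean
      (\<lambda>f :: nat \<times> nat \<Rightarrow> complex. f (P, Q))"
    using assms by (intro continuous_map_product_projection) auto
  then have "continuous_map (Her_topology n) euclidean
      ((\<lambda>f. f (P, Q)) \<circ> (\<lambda>A. restrict (\<lambda>ij. A $$ ij) ({..<n} \<times> {..<n})))"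
    unfolding Her_topology_def by (rule continuous_map_pullback)
  then show ?thesis using assms by (simp add: o_def)
qed

lemma continuous_map_entry_function:
  fixes g :: "complex \<Rightarrow> real"
  assumes "P < n" "Q < n" "continuous_on UNIV g"
  shows "continuous_map (Her_topology n) euclidean (\<lambda>A. g (A $$ (P, Q)))"
  using continuous_map_compose[OF continuous_map_entry[OF assms(1,2)], of euclidean g] assms(3)
  by (simp add: o_def)

text \<open>
  Each test is a continuous function of the entries, so the system is an intersection of closed sets.
\<close>

lemma closedin_test_system:
  assumes "\<T> \<noteq> {}"
  shows "closedin (Her_topology (s * d)) (test_system d \<T> s)"
proof -
  have "closedin (Her_topology (s * d)) {A \<in> topspace (Her_topology (s * d)). test_value s d T x A \<in> {0..}}"
    for T x
  proof (rule closedin_continuous_map_preimage)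
    show "continuous_map (Her_topology (s * d)) euclidean (test_value s d T x)"
      unfolding test_value_flat
      by (intro continuous_map_sum finite_lessThan continuous_map_entry_function)
         (auto intro!: block_index_less continuous_intros)
  qed simp
  then have "closedin (Her_topology (s * d))
      (\<Inter>(T, x)\<in>\<T> \<times> UNIV. {A \<in> topspace (Her_topology (s * d)). test_value s d T x A \<in> {0..}})"
    using assms by (intro closedin_INT) auto
  also have "(\<Inter>(T, x)\<in>\<T> \<times> UNIV. {A \<in> topspace (Her_topology (s * d)). test_value s d T x A \<in> {0..}})
      = test_system d \<T> s"
    using assms by (auto simp: test_system_def)
  finally show ?thesis .
qed

lemma cmod_product_le_sum_squares:
  fixes x :: cvec
  assumes "p < s" "q < s"
  shows "cmod (x p) * cmod (x q) \<le> (\<Sum>i<s. (cmod (x i))^2)"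
proof -
  define N where "N = (\<Sum>i<s. (cmod (x i))^2)"
  have "(cmod (x p))^2 \<le> N" "(cmod (x q))^2 \<le> N"
    using assms unfolding N_def by (auto intro: member_le_sum)
  moreover have "2 * (cmod (x p) * cmod (x q)) \<le> (cmod (x p))^2 + (cmod (x q))^2"
    using zero_le_power2[of "cmod (x p) - cmod (x q)"] by (simp add: power2_diff)
  ultimately show ?thesis by (simp add: N_def)
qed

lemma test_value_one:
  "test_value s d T x (1\<^sub>m (s * d)) = (\<Sum>i<s. (cmod (x i))^2) * Re (\<Sum>a<d. T a a)"
proof -
  have "slice s d (1\<^sub>m (s * d)) x a b = unit_cvec a b * of_real (\<Sum>i<s. (cmod (x i))^2)"
    if "a < d" "b < d" for a b
  proof -
    have "slice s d (1\<^sub>m (s * d)) x a b = (\<Sum>p<s. \<Sum>q<s. unit_cvec p q * (cnj (x p) * x q * unit_cvec a b))"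
      unfolding slice_def
    proof (intro sum.cong[OF refl])
      fix p q assume "p \<in> {..<s}" "q \<in> {..<s}"
      moreover have "p * d + a = q * d + b \<longleftrightarrow> p = q \<and> a = b"
      proof
        assume eq: "p * d + a = q * d + b"
        have "(p * d + a) div d = p" "(q * d + b) div d = q" "(p * d + a) mod d = a" "(q * d + b) mod d = b"
          using that by simp_all
        with eq show "p = q \<and> a = b" by metis
      qed simp
      ultimately show "cnj (x p) * x q * 1\<^sub>m (s * d) $$ (p * d + a, q * d + b)
          = unit_cvec p q * (cnj (x p) * x q * unit_cvec a b)"
        using that block_index_less[of p s a d] block_index_less[of q s b d]
        by (auto simp: unit_cvec_def)
    qed
    also have "\<dots> = (\<Sum>p<s. cnj (x p) * x p * unit_cvec a b)" by simp
    also have "\<dots> = unit_cvec a b * of_real (\<Sum>i<s. (cmod (x i))^2)"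
      unfolding of_real_sum complex_norm_square by (simp add: sum_distrib_left mult_ac)
    finally show ?thesis .
  qed
  note slice_one = this
  define S where "S = complex_of_real (\<Sum>i<s. (cmod (x i))^2)"
  have "(\<Sum>a<d. \<Sum>b<d. T a b * slice s d (1\<^sub>m (s * d)) x a b)
      = (\<Sum>a<d. \<Sum>b<d. unit_cvec a b * (T a b * S))"
    unfolding S_def by (intro sum.cong[OF refl]) (simp add: slice_one)
  also have "\<dots> = S * (\<Sum>a<d. T a a)"
    by (simp add: sum_distrib_left mult.commute)
  finally show ?thesis unfolding test_value_def S_def by (simp only: Re_of_real_times)
qed

text \<open>
  The identity is an interior point: its slices are multiples of the identity, where a test \<open>T\<close> has its
  trace as value, while a perturbation changes the value by at most a multiple of the sum of the absolute
  values of the entries of \<open>T\<close>. The hypothesis on \<open>\<kappa>\<close> compares the two uniformly in \<open>T\<close>.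
\<close>

lemma interior_test_system:
  assumes "s \<ge> 1" and \<kappa>: "\<kappa> > 0"
    and trace: "\<And>T. T \<in> \<T> \<Longrightarrow> \<kappa> * (\<Sum>a<d. \<Sum>b<d. cmod (T a b)) \<le> Re (\<Sum>a<d. T a a)"
  shows "Her_topology (s * d) interior_of (test_system d \<T> s) \<noteq> {}"
proof -
  define n where "n = s * d"
  define G where "G A = (\<Sum>P<n. \<Sum>Q<n. cmod (A $$ (P, Q) - 1\<^sub>m n $$ (P, Q)))" for A :: "complex mat"
  \<comment> \<open>the \<open>s\<^sup>2\<close> blocks each contribute at most the squared norm of \<open>x\<close> to the error\<close>
  define \<delta> where "\<delta> = \<kappa> / (real s)^2"
  have \<delta>: "\<delta> > 0" using assms by (simp add: \<delta>_def)
  define U where "U = {A \<in> topspace (Her_topology n). G A \<in> {..<\<delta>}}"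
  have "openin (Her_topology n) U"
    unfolding U_def
  proof (rule openin_continuous_map_preimage)
    show "continuous_map (Her_topology n) euclidean G"
      unfolding G_def
      by (intro continuous_map_sum finite_lessThan continuous_map_entry_function)
         (auto intro!: continuous_intros)
  qed simp
  moreover have "U \<subseteq> test_system d \<T> s"
  proof
    fix A assume "A \<in> U"
    then have A: "A \<in> Her (s * d)" "G A < \<delta>" by (auto simp: U_def n_def)
    have near: "cmod (A $$ (P, Q) - 1\<^sub>m n $$ (P, Q)) \<le> \<delta>" if "P < n" "Q < n" for P Q
    proof -
      have "cmod (A $$ (P, Q) - 1\<^sub>m n $$ (P, Q)) \<le> (\<Sum>Q<n. cmod (A $$ (P, Q) - 1\<^sub>m n $$ (P, Q)))"
        using that by (intro member_le_sum) auto
      also have "\<dots> \<le> G A" unfolding G_def using that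
        by (intro member_le_sum[where f = "\<lambda>P. \<Sum>Q<n. cmod (A $$ (P, Q) - 1\<^sub>m n $$ (P, Q))"])
           (auto intro: sum_nonneg)
      finally show ?thesis using A(2) by simp
    qed
    have "0 \<le> test_value s d T x A" if T: "T \<in> \<T>" for T x
    proof -
      define N where "N = (\<Sum>i<s. (cmod (x i))^2)"
      define \<tau> where "\<tau> = (\<Sum>a<d. \<Sum>b<d. cmod (T a b))"
      define H where "H = A + complex_of_real (-1) \<cdot>\<^sub>m 1\<^sub>m n"
      have car: "A \<in> carrier_mat n n" using A(1) by (simp add: Her_iff n_def)
      have "A = 1\<^sub>m n + H" using car by (intro eq_matI) (auto simp: H_def)
      then have split: "test_value s d T x A = N * Re (\<Sum>a<d. T a a) + test_value s d T x H"
        using test_value_add[of "1\<^sub>m n" s d H T x] car test_value_one[of s d T x]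
        by (simp add: N_def n_def H_def)
      have N0: "N \<ge> 0" by (simp add: N_def sum_nonneg)
      have "- test_value s d T x H \<le> (\<Sum>a<d. \<Sum>b<d. \<Sum>p<s. \<Sum>q<s. cmod (T a b) * (N * \<delta>))"
        unfolding test_value_flat sum_negf[symmetric]
      proof (intro sum_mono)
        fix a b p q assume ab: "a \<in> {..<d}" "b \<in> {..<d}" "p \<in> {..<s}" "q \<in> {..<s}"
        have PQ: "p * d + a < n" "q * d + b < n" using ab by (auto simp: n_def intro: block_index_less)
        have "- Re (T a b * (cnj (x p) * x q) * H $$ (p * d + a, q * d + b))
            \<le> cmod (T a b * (cnj (x p) * x q) * H $$ (p * d + a, q * d + b))"
          by (metis abs_Re_le_cmod abs_le_iff)
        also have "\<dots> = cmod (T a b) * ((cmod (x p) * cmod (x q)) * cmod (H $$ (p * d + a, q * d + b)))"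
          by (simp add: norm_mult)
        also have "\<dots> \<le> cmod (T a b) * (N * \<delta>)"
        proof (intro mult_left_mono mult_mono)
          show "cmod (x p) * cmod (x q) \<le> N"
            unfolding N_def using ab by (intro cmod_product_le_sum_squares) auto
          show "cmod (H $$ (p * d + a, q * d + b)) \<le> \<delta>"
            using near[OF PQ] PQ car by (simp add: H_def)
        qed (use N0 in auto)
        finally show "- Re (T a b * (cnj (x p) * x q) * H $$ (p * d + a, q * d + b)) \<le> cmod (T a b) * (N * \<delta>)" .
      qed
      also have "\<dots> = N * (\<kappa> * \<tau>)"
        using assms(1) by (simp add: \<tau>_def \<delta>_def sum_distrib_right sum_distrib_left field_simps power2_eq_square)
      also have "\<dots> \<le> N * Re (\<Sum>a<d. T a a)"
        using trace[OF T] N0 by (intro mult_left_mono) (simp_all add: \<tau>_def)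
      finally show ?thesis using split by simp
    qed
    with A(1) show "A \<in> test_system d \<T> s" by (simp add: test_system_def)
  qed
  ultimately have "U \<subseteq> Her_topology n interior_of (test_system d \<T> s)"
    by (intro interior_of_maximal)
  moreover have "1\<^sub>m n \<in> U" using \<delta> by (simp add: U_def one_Her G_def)
  ultimately show ?thesis by (auto simp: n_def)
qed

lemma nonneg_affine_imp_const:
  fixes \<alpha> \<beta> :: real
  assumes "\<And>t. 0 \<le> \<alpha> + t * \<beta>"
  shows "\<beta> = 0"
proof (rule ccontr)
  assume "\<beta> \<noteq> 0"
  then show False using assms[of "- (\<alpha> + 1) / \<beta>"] by simp
qed

text \<open>
  The tests \<open>cnj (y a) * y b\<close> evaluate the form of \<open>B\<close> at product vectors \<open>x \<otimes> y\<close>. Polarization in each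
  factor recovers all entries.
\<close>

lemma product_tests_detect_zero:
  assumes B: "B \<in> Her (s * d)"
    and zero: "\<And>x y. test_value s d (\<lambda>a b. cnj (y a) * y b) x B = 0"
  shows "B = 0\<^sub>m (s * d) (s * d)"
proof -
  have car: "B \<in> carrier_mat (s * d) (s * d)" using B by (simp add: Her_iff)
  have slice_sym: "cnj (slice s d B x b a) = slice s d B x a b" if "a < d" "b < d" for x a b
  proof -
    have "cnj (slice s d B x b a) = (\<Sum>p<s. \<Sum>q<s. cnj (x q) * x p * B $$ (q * d + a, p * d + b))"
      unfolding slice_def cnj_sum
    proof (intro sum.cong[OF refl])
      fix p q assume "p \<in> {..<s}" "q \<in> {..<s}"
      then have "cnj (B $$ (p * d + b, q * d + a)) = B $$ (q * d + a, p * d + b)"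
        using B that block_index_less[of p s b d] block_index_less[of q s a d] by (simp add: Her_iff)
      then show "cnj (cnj (x p) * x q * B $$ (p * d + b, q * d + a)) = cnj (x q) * x p * B $$ (q * d + a, p * d + b)"
        by simp
    qed
    also have "\<dots> = slice s d B x a b" unfolding slice_def by (rule sum.swap)
    finally show ?thesis .
  qed
  have slice0: "slice s d B x a b = 0" if "a < d" "b < d" for x a b
  proof (rule sesquilinear_zeroD[OF _ that])
    fix y :: cvec
    define S where "S = (\<Sum>a<d. \<Sum>b<d. y a * cnj (y b) * slice s d B x a b)"
    have "cnj S = (\<Sum>a<d. \<Sum>b<d. y b * cnj (y a) * slice s d B x b a)"
      unfolding S_def cnj_sum
      by (intro sum.cong[OF refl]) (simp add: slice_sym mult.commute)
    also have "\<dots> = S" unfolding S_def by (rule sum.swap)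
    finally have "cnj S = S" .
    moreover have "Re S = 0" using zero[of "\<lambda>a. cnj (y a)" x] by (simp add: test_value_def S_def)
    ultimately have "S = 0" by (simp add: complex_eq_iff)
    then show "(\<Sum>a<d. \<Sum>b<d. y a * cnj (y b) * slice s d B x a b) = 0" by (simp add: S_def)
  qed
  have entry0: "B $$ (p * d + a, q * d + b) = 0" if "p < s" "q < s" "a < d" "b < d" for p q a b
  proof (rule sesquilinear_zeroD[where d = s, OF _ that(1,2)])
    fix x :: cvec
    show "(\<Sum>p<s. \<Sum>q<s. x p * cnj (x q) * B $$ (p * d + a, q * d + b)) = 0"
      using slice0[OF that(3,4), of "\<lambda>p. cnj (x p)"] by (simp add: slice_def)
  qed
  show ?thesis
  proof (rule eq_matI)
    fix P Q assume "P < dim_row (0\<^sub>m (s * d) (s * d) :: complex mat)" "Q < dim_col (0\<^sub>m (s * d) (s * d) :: complex mat)"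
    then have "P < s * d" "Q < s * d" by simp_all
    then show "B $$ (P, Q) = 0\<^sub>m (s * d) (s * d) $$ (P, Q)"
      by (metis entry0 block_index_exhaust index_zero_mat(1))
  qed (use car in auto)
qed

lemma abstract_operator_system_test_system:
  assumes products: "\<And>y :: cvec. (\<lambda>a b. cnj (y a) * y b) \<in> \<T>" and \<kappa>: "\<kappa> > 0"
    and trace: "\<And>T. T \<in> \<T> \<Longrightarrow> \<kappa> * (\<Sum>a<d. \<Sum>b<d. cmod (T a b)) \<le> Re (\<Sum>a<d. T a a)"
  shows "abstract_operator_system d (test_system d \<T>)"
  unfolding abstract_operator_system_def
proof (intro conjI allI impI ballI)
  fix s :: nat assume s: "1 \<le> s"
  have noline: "\<not> (\<exists>A\<in>Her (s * d). \<exists>B\<in>Her (s * d). B \<noteq> 0\<^sub>m (s * d) (s * d) \<and>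
      (\<forall>t. A + complex_of_real t \<cdot>\<^sub>m B \<in> test_system d \<T> s))"
  proof (intro notI, elim bexE conjE)
    fix A B assume A: "A \<in> Her (s * d)" and B: "B \<in> Her (s * d)" and nz: "B \<noteq> 0\<^sub>m (s * d) (s * d)"
      and line: "\<forall>t. A + complex_of_real t \<cdot>\<^sub>m B \<in> test_system d \<T> s"
    have car: "A \<in> carrier_mat (s * d) (s * d)" "B \<in> carrier_mat (s * d) (s * d)"
      using A B by (simp_all add: Her_iff)
    have "test_value s d (\<lambda>a b. cnj (y a) * y b) x B = 0" for x y
    proof (rule nonneg_affine_imp_const)
      fix t
      have "0 \<le> test_value s d (\<lambda>a b. cnj (y a) * y b) x (A + complex_of_real t \<cdot>\<^sub>m B)"
        using line products[of y] unfolding test_system_def by blast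
      then show "0 \<le> test_value s d (\<lambda>a b. cnj (y a) * y b) x A + t * test_value s d (\<lambda>a b. cnj (y a) * y b) x B"
        using car by (simp add: test_value_add test_value_scale)
    qed
    then show False using product_tests_detect_zero[OF B] nz by blast
  qed
  show "proper_convex_cone (s * d) (test_system d \<T> s)"
    unfolding proper_convex_cone_def
    using convex_cone_test_system closedin_test_system[of \<T>] products interior_test_system[OF s \<kappa> trace] noline
    by blast
next
  fix s t :: nat and A V :: "complex mat" assume "A \<in> test_system d \<T> s" and V: "V \<in> carrier_mat s t"
  then have A: "A \<in> Her (s * d)" "\<And>T x. T \<in> \<T> \<Longrightarrow> 0 \<le> test_value s d T x A"
    by (auto simp: test_system_def)
  have car: "A \<in> carrier_mat (s * d) (s * d)" using A(1) by (simp add: Her_iff)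
  have "test_value t d T x (compress d V A) = test_value s d T (\<lambda>p. \<Sum>i<t. V $$ (p, i) * x i) A" for T x
    unfolding test_value_def by (simp add: slice_compress[OF V car])
  then have "compress d V A \<in> test_system d \<T> t"
    using A(2) compress_Her[OF V A(1)] by (simp add: test_system_def)
  then show "mat_adjoint (V \<otimes>\<^sub>K 1\<^sub>m d) * A * (V \<otimes>\<^sub>K 1\<^sub>m d) \<in> test_system d \<T> t"
    by (simp add: compress_def)
qed

section \<open>Free numerical ranges\<close>

lemma psd_form_matrix:
  fixes Y :: "nat \<Rightarrow> nat \<Rightarrow> complex"
  assumes herm: "\<And>i j. i < n \<Longrightarrow> j < n \<Longrightarrow> cnj (Y j i) = Y i j"
    and psd: "\<And>v :: cvec. 0 \<le> Re (\<Sum>i<n. \<Sum>j<n. cnj (v i) * v j * Y i j)"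
  shows "psd_form cscale (\<lambda>u v. \<Sum>i<n. cnj (u i) * (\<Sum>j<n. v j * Y i j))"
proof -
  interpret vector_space cscale by (rule vector_space_cscale)
  show ?thesis
  proof unfold_locales
    fix u v w :: cvec and c :: complex
    show "(\<Sum>i<n. cnj (u i) * (\<Sum>j<n. (v + w) j * Y i j)) =
        (\<Sum>i<n. cnj (u i) * (\<Sum>j<n. v j * Y i j)) + (\<Sum>i<n. cnj (u i) * (\<Sum>j<n. w j * Y i j))"
      by (simp add: ring_distribs sum.distrib)
    show "(\<Sum>i<n. cnj (u i) * (\<Sum>j<n. cscale c v j * Y i j)) = c * (\<Sum>i<n. cnj (u i) * (\<Sum>j<n. v j * Y i j))"
      by (simp add: cscale_def sum_distrib_left mult_ac)
    have "cnj (\<Sum>i<n. cnj (u i) * (\<Sum>j<n. v j * Y i j)) = (\<Sum>i<n. \<Sum>j<n. cnj (v j) * (u i * Y j i))"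
      unfolding cnj_sum sum_distrib_left by (intro sum.cong[OF refl]) (simp add: herm)
    also have "\<dots> = (\<Sum>i<n. cnj (v i) * (\<Sum>j<n. u j * Y i j))"
      unfolding sum_distrib_left by (rule sum.swap)
    finally show "(\<Sum>i<n. cnj (v i) * (\<Sum>j<n. u j * Y i j)) = cnj (\<Sum>i<n. cnj (u i) * (\<Sum>j<n. v j * Y i j))"
      by (rule sym)
    show "0 \<le> Re (\<Sum>i<n. cnj (v i) * (\<Sum>j<n. v j * Y i j))"
      using psd[of v] by (simp only: sum_distrib_left mult.assoc)
  qed
qed

text \<open>
  Cholesky decomposition. In the induction step the last row and column are removed by the Schur
  complement. A vanishing pivot needs no separate case in the definitions, because division by zero
  gives zero and the corresponding column vanishes by positivity.
\<close>

lemma positive_function_rank_one_sum: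
  fixes Y :: "nat \<Rightarrow> nat \<Rightarrow> complex"
  assumes "\<And>i j. i < n \<Longrightarrow> j < n \<Longrightarrow> cnj (Y j i) = Y i j"
    and "\<And>v :: cvec. 0 \<le> Re (\<Sum>i<n. \<Sum>j<n. cnj (v i) * v j * Y i j)"
  shows "\<exists>z :: nat \<Rightarrow> cvec. \<forall>i<n. \<forall>j<n. Y i j = (\<Sum>k<n. z k i * cnj (z k j))"
  using assms
proof (induction n arbitrary: Y)
  case 0
  then show ?case by simp
next
  case (Suc n)
  note herm = Suc.prems(1) and psd = Suc.prems(2)
  define a where "a = Re (Y n n)"
  have Ynn: "Y n n = of_real a" using herm[of n n] by (simp add: a_def complex_eq_iff)
  have quad: "(\<Sum>i<Suc n. \<Sum>j<Suc n. cnj (v i) * v j * Y i j) =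
      (\<Sum>i<n. \<Sum>j<n. cnj (v i) * v j * Y i j) + v n * cnj (\<Sum>j<n. v j * Y n j)
      + cnj (v n) * (\<Sum>j<n. v j * Y n j) + of_real ((cmod (v n))^2 * a)" for v :: cvec
  proof -
    have "cnj (\<Sum>j<n. v j * Y n j) = (\<Sum>i<n. cnj (v i) * Y i n)"
      unfolding cnj_sum by (intro sum.cong[OF refl]) (simp add: herm)
    then show ?thesis
      by (simp add: sum.distrib sum_distrib_left Ynn complex_norm_square algebra_simps del: of_real_power)
  qed
  have a0: "a \<ge> 0"
    using psd[of "unit_cvec n"] unfolding quad by (simp add: unit_cvec_def)
  interpret Y: psd_form cscale "\<lambda>u v. \<Sum>i<Suc n. cnj (u i) * (\<Sum>j<Suc n. v j * Y i j)"
    using herm psd by (rule psd_form_matrix)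
  have column_zero: "Y i n = 0" if "i < n" "a = 0" for i
    using Y.isotropic_right[where w = "unit_cvec n" and u = "unit_cvec i"] that Ynn
    by (simp del: sum.lessThan_Suc)
  define Y' where "Y' i j = Y i j - Y i n * Y n j / of_real a" for i j
  have "\<exists>z :: nat \<Rightarrow> cvec. \<forall>i<n. \<forall>j<n. Y' i j = (\<Sum>k<n. z k i * cnj (z k j))"
  proof (rule Suc.IH)
    show "cnj (Y' j i) = Y' i j" if "i < n" "j < n" for i j
      using that herm[of i j] herm[of n i] herm[of j n] herm[of i n] herm[of n j] by (simp add: Y'_def mult.commute)
    fix v :: cvec
    define L where "L = (\<Sum>j<n. v j * Y n j)"
    \<comment> \<open>the extension of \<open>v\<close> that minimises the form, whose minimum is the form of the Schur complement\<close>
    define u where "u = (\<lambda>j. if j = n then - L / of_real a else v j)"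
    have uv: "(\<Sum>i<n. \<Sum>j<n. cnj (u i) * u j * Y i j) = (\<Sum>i<n. \<Sum>j<n. cnj (v i) * v j * Y i j)"
      "(\<Sum>j<n. u j * Y n j) = L"
      by (auto simp: u_def L_def intro!: sum.cong)
    have Lc: "cnj L = (\<Sum>i<n. cnj (v i) * Y i n)"
      unfolding L_def cnj_sum by (intro sum.cong[OF refl]) (simp add: herm)
    have "(\<Sum>i<n. \<Sum>j<n. cnj (v i) * v j * (Y i n * Y n j / of_real a)) = cnj L * L / of_real a"
      unfolding Lc unfolding L_def sum_product sum_divide_distrib by (simp add: mult_ac)
    then have "(\<Sum>i<n. \<Sum>j<n. cnj (v i) * v j * Y' i j) =
        (\<Sum>i<n. \<Sum>j<n. cnj (v i) * v j * Y i j) - cnj L * L / of_real a"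
      by (simp add: Y'_def right_diff_distrib sum_subtractf)
    also have "\<dots> = (\<Sum>i<Suc n. \<Sum>j<Suc n. cnj (u i) * u j * Y i j)"
    proof (cases "a = 0")
      case False
      have "of_real ((cmod (u n))^2 * a) = L * cnj L / complex_of_real a"
        using False unfolding of_real_mult complex_norm_square by (simp add: u_def)
      then show ?thesis unfolding quad uv using False by (simp add: u_def mult.commute)
    qed (simp add: quad uv u_def)
    finally show "0 \<le> Re (\<Sum>i<n. \<Sum>j<n. cnj (v i) * v j * Y' i j)" using psd[of u] by simp
  qed
  then obtain z :: "nat \<Rightarrow> cvec" where z: "\<And>i j. i < n \<Longrightarrow> j < n \<Longrightarrow> Y' i j = (\<Sum>k<n. z k i * cnj (z k j))" by blast
  define z' where "z' k = (if k < n then (z k)(n := 0) else (\<lambda>i. Y i n / of_real (sqrt a)))" for k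
  have "Y i j = (\<Sum>k<Suc n. z' k i * cnj (z' k j))" if ij: "i < Suc n" "j < Suc n" for i j
  proof -
    have ss: "complex_of_real (sqrt a) * of_real (sqrt a) = of_real a"
      using a0 by (simp flip: of_real_mult)
    have "(\<Sum>k<Suc n. z' k i * cnj (z' k j)) = (\<Sum>k<n. z' k i * cnj (z' k j)) + Y i n * Y n j / of_real a"
      using ij herm[of n j] herm[of j n] by (simp add: z'_def ss)
    also have "(\<Sum>k<n. z' k i * cnj (z' k j)) = (if i < n \<and> j < n then Y' i j else 0)"
      using ij z[of i j] by (auto simp: z'_def intro!: sum.cong sum.neutral)
    also have "(if i < n \<and> j < n then Y' i j else 0) + Y i n * Y n j / of_real a = Y i j"
    proof (cases "i < n \<and> j < n")
      case False
      then consider "i = n" | "j = n" using ij by linarith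
      then show ?thesis
      proof cases
        case 1
        have "Y n j = 0" if "a = 0"
          using column_zero[of j] that ij herm[of n j] Ynn by (cases "j = n") auto
        with 1 show ?thesis by (cases "a = 0") (simp_all add: Ynn)
      next
        case 2
        have "Y i n = 0" if "a = 0" using column_zero[of i] that ij Ynn by (cases "i = n") auto
        with 2 show ?thesis by (cases "a = 0") (simp_all add: Ynn)
      qed
    qed (simp add: Y'_def)
    finally show ?thesis by simp
  qed
  then show ?case by blast
qed

text \<open>
  The test \<open>(\<Sum>i\<in>I. f\<^sub>i f\<^sub>i\<^sup>*) - \<epsilon> v v\<^sup>*\<close> may have negative trace, and then the system it cuts out may
  have empty interior. Adding \<open>c p p\<^sup>*\<close> with \<open>p\<close> orthogonal to \<open>z\<close> makes the trace positive for large
  \<open>c\<close> and does not affect the value at \<open>z z\<^sup>*\<close>.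
\<close>

lemma separating_test_system:
  assumes "d \<ge> 2" and I: "finite I"
    and zf: "\<And>i. i \<in> I \<Longrightarrow> cinner d z (f i) = 0" and zv: "cinner d z v \<noteq> 0" and \<epsilon>: "0 < \<epsilon>"
  shows "\<exists>\<T> p c. abstract_operator_system d (test_system d \<T>) \<and> c \<ge> 0 \<and>
     \<T> = insert (\<lambda>a b. rank_one_combination I f \<epsilon> v a b + of_real c * (p a * cnj (p b)))
           (range (\<lambda>(y :: cvec) a b. cnj (y a) * y b)) \<and> cinner d z p = 0"
proof -
  obtain p :: cvec where p: "cinner d z p = 0" "\<exists>a<d. p a \<noteq> 0"
  proof (cases "z 0 = 0")
    case True
    then have "cinner d z (unit_cvec 0) = 0" by simp
    moreover have "\<exists>a<d. unit_cvec 0 a \<noteq> 0"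
      using assms(1) by (intro exI[of _ 0]) (simp add: unit_cvec_def)
    ultimately show ?thesis by (rule that)
  next
    case False
    define p where "p i = cnj (z 1) * unit_cvec 0 i - cnj (z 0) * unit_cvec 1 i" for i
    have "cinner d z p = (\<Sum>a<d. unit_cvec 0 a * (cnj (z a) * cnj (z 1))) - (\<Sum>a<d. unit_cvec 1 a * (cnj (z a) * cnj (z 0)))"
      by (simp add: cinner_def p_def algebra_simps sum_subtractf del: sum_unit_cvec)
    then have "cinner d z p = 0" using assms(1) by simp
    moreover have "\<exists>a<d. p a \<noteq> 0"
      using assms(1) False by (intro exI[of _ 1]) (simp add: p_def unit_cvec_def)
    ultimately show ?thesis by (rule that)
  qed
  define N where "N = (\<Sum>a<d. (cmod (p a))^2)"
  have N: "N > 0"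
  proof -
    obtain a where a: "a < d" "p a \<noteq> 0" using p(2) by blast
    have "0 < (cmod (p a))^2" using a by simp
    also have "\<dots> \<le> N" unfolding N_def using a by (intro member_le_sum) auto
    finally show ?thesis .
  qed
  \<comment> \<open>the negative part of the trace is at most \<open>\<epsilon>\<close> times the squared norm of \<open>v\<close>\<close>
  define c where "c = (\<epsilon> * (\<Sum>a<d. (cmod (v a))^2) + 1) / N"
  have c: "c \<ge> 0" using N \<epsilon> by (auto simp: c_def intro!: divide_nonneg_pos add_nonneg_nonneg mult_nonneg_nonneg sum_nonneg)
  define T where "T a b = rank_one_combination I f \<epsilon> v a b + of_real c * (p a * cnj (p b))" for a b
  define \<T> where "\<T> = insert T (range (\<lambda>(y :: cvec) a b. cnj (y a) * y b))"
  have "Re (\<Sum>a<d. T a a) = (\<Sum>a<d. (\<Sum>i\<in>I. (cmod (f i a))^2)) - \<epsilon> * (\<Sum>a<d. (cmod (v a))^2) + c * N"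
  proof -
    have "T a a = of_real ((\<Sum>i\<in>I. (cmod (f i a))^2) - \<epsilon> * (cmod (v a))^2 + c * (cmod (p a))^2)" for a
      unfolding T_def rank_one_combination_def of_real_add of_real_diff of_real_mult of_real_sum complex_norm_square ..
    then show ?thesis by (simp add: sum.distrib sum_subtractf sum_distrib_left N_def)
  qed
  also have "\<dots> \<ge> 1"
  proof -
    have "c * N = \<epsilon> * (\<Sum>a<d. (cmod (v a))^2) + 1" using N by (simp add: c_def)
    moreover have "(\<Sum>a<d. (\<Sum>i\<in>I. (cmod (f i a))^2)) \<ge> 0" by (intro sum_nonneg) auto
    ultimately show ?thesis by simp
  qed
  finally have trace: "1 \<le> Re (\<Sum>a<d. T a a)" .
  define \<tau> where "\<tau> = (\<Sum>a<d. \<Sum>b<d. cmod (T a b))"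
  have \<tau>: "\<tau> \<ge> 0" by (simp add: \<tau>_def sum_nonneg)
  \<comment> \<open>the first bound serves the product tests, the second one the separating test\<close>
  define \<kappa> where "\<kappa> = min (1 / (real d)^2) (1 / (\<tau> + 1))"
  have "abstract_operator_system d (test_system d \<T>)"
  proof (rule abstract_operator_system_test_system)
    show "(\<lambda>a b. cnj (y a) * y b) \<in> \<T>" for y :: cvec by (auto simp: \<T>_def)
    show "\<kappa> > 0" using assms(1) \<tau> by (simp add: \<kappa>_def)
    fix T' assume "T' \<in> \<T>"
    then consider "T' = T" | y :: cvec where "T' = (\<lambda>a b. cnj (y a) * y b)" by (auto simp: \<T>_def)
    then show "\<kappa> * (\<Sum>a<d. \<Sum>b<d. cmod (T' a b)) \<le> Re (\<Sum>a<d. T' a a)"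
    proof cases
      case 1
      have "\<kappa> * \<tau> \<le> 1 / (\<tau> + 1) * \<tau>" using \<tau> by (intro mult_right_mono) (auto simp: \<kappa>_def)
      also have "\<dots> \<le> 1" using \<tau> by (simp add: field_simps)
      finally show ?thesis using trace 1 by (simp add: \<tau>_def)
    next
      case 2
      define S where "S = (\<Sum>a<d. (cmod (y a))^2)"
      have S: "S \<ge> 0" by (simp add: S_def sum_nonneg)
      have "(\<Sum>a<d. \<Sum>b<d. cmod (T' a b)) \<le> (\<Sum>a<d. \<Sum>b<d. S)"
        unfolding 2 S_def by (intro sum_mono) (simp add: norm_mult cmod_product_le_sum_squares)
      also have "\<dots> = (real d)^2 * S" by (simp add: power2_eq_square)
      finally have "\<kappa> * (\<Sum>a<d. \<Sum>b<d. cmod (T' a b)) \<le> 1 / (real d)^2 * ((real d)^2 * S)"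
        using S by (intro mult_mono) (auto simp: \<kappa>_def sum_nonneg)
      also have "\<dots> = S" using assms(1) by simp
      also have "S = Re (\<Sum>a<d. T' a a)"
      proof -
        have "T' a a = of_real ((cmod (y a))^2)" for a
          unfolding 2 complex_norm_square by (rule mult.commute)
        then show ?thesis by (simp add: S_def)
      qed
      finally show ?thesis .
    qed
  qed
  moreover have "\<T> = insert (\<lambda>a b. rank_one_combination I f \<epsilon> v a b + of_real c * (p a * cnj (p b)))
           (range (\<lambda>(y :: cvec) a b. cnj (y a) * y b))" by (simp add: \<T>_def T_def[abs_def])
  ultimately show ?thesis using c p(1) by blast
qed

lemma compress_mem:
  assumes "abstract_operator_system d C" "s \<ge> 1" "t \<ge> 1" "A \<in> C s" "V \<in> carrier_mat s t"
  shows "compress d V A \<in> C t"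
  using assms unfolding abstract_operator_system_def compress_def by blast

lemma cone_contains_sum:
  fixes m :: nat
  assumes "convex_cone_Her n K" and R: "\<And>k. R k \<in> K"
  shows "mat n n (\<lambda>(P, Q). \<Sum>k<m. R k $$ (P, Q)) \<in> K"
proof (induction m)
  case 0
  have "mat n n (\<lambda>(P, Q). \<Sum>k<0. R k $$ (P, Q)) = 0\<^sub>m n n" by (intro eq_matI) auto
  also have "\<dots> \<in> K" using assms(1) by (simp add: convex_cone_Her_def)
  finally show ?case .
next
  case (Suc m)
  have "R m \<in> Her n" using assms by (auto simp: convex_cone_Her_def)
  then have "R m \<in> carrier_mat n n" by (simp add: Her_iff)
  then have "mat n n (\<lambda>(P, Q). \<Sum>k<Suc m. R k $$ (P, Q)) = mat n n (\<lambda>(P, Q). \<Sum>k<m. R k $$ (P, Q)) + R m"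
    by (intro eq_matI) auto
  also have "\<dots> \<in> K" using assms Suc.IH unfolding convex_cone_Her_def by blast
  finally show ?case .
qed

text \<open>
  If the form of \<open>M\<close> violated separation, the generator would pass the tests of
  \<open>separating_test_system\<close>, so by minimality all of \<open>C\<close> would; but the positive matrix \<open>Z\<close> fails them.
  The section \<open>W\<close> then compresses \<open>M\<close> to \<open>\<Omega> \<in> C d\<close>, which is \<open>\<Sum>a b. E\<^sub>a\<^sub>b \<otimes> E\<^sub>a\<^sub>b\<close> in the linear case and
  its partial transpose, the flip, in the antilinear one. Every rank-one positive matrix, or its partial
  transpose, is a compression of \<open>\<Omega>\<close>.
\<close>

theorem free_numerical_range_contains:
  assumes C1: "C 1 = {A \<in> Her d. positive_semidefinite A}"
    and r: "r < 2 * d - 1" and range: "free_numerical_range d r M C"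
  shows "system_contained (Psd d) C \<or> system_contained (Psd_Gamma d) C"
proof -
  have r1: "r \<ge> 1" and C: "abstract_operator_system d C" and M: "M \<in> C r"
    and least: "\<And>D. abstract_operator_system d D \<Longrightarrow> M \<in> D r \<Longrightarrow> system_contained C D"
    using range unfolding free_numerical_range_def by blast+
  have d: "d \<ge> 2" using r r1 by linarith
  have cone: "convex_cone_Her (s * d) (C s)" if "s \<ge> 1" for s
    using C that unfolding abstract_operator_system_def proper_convex_cone_def by blast
  have MH: "M \<in> Her (r * d)" using cone[OF r1] M by (auto simp: convex_cone_Her_def)
  then have Mcar: "M \<in> carrier_mat (r * d) (r * d)" by (simp add: Her_iff)
  define \<Phi> where "\<Phi> i j a b = M $$ (i * d + a, j * d + b)" for i j a b
  have form_slice: "tensor_form r d \<Phi> w w x y = (\<Sum>a<d. \<Sum>b<d. x a * cnj (y b) * slice r d M w a b)" for w x y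
    by (simp add: tensor_form_by_matrix slice_def \<Phi>_def)
  have nonneg: "0 \<le> Re (tensor_form r d \<Phi> w w x x)" for w x
  proof -
    define V where "V = mat r 1 (\<lambda>(i, j). w i)"
    have V: "V \<in> carrier_mat r 1" by (simp add: V_def)
    have "compress d V M \<in> C 1" using compress_mem[OF C r1 _ M V] by simp
    then have H: "compress d V M \<in> Her d" and "positive_semidefinite (compress d V M)" using C1 by auto
    then have "0 \<le> Re (quadratic_form d (compress d V M) (\<lambda>a. cnj (x a)))"
      using positive_semidefinite_iff by blast
    also have "quadratic_form d (compress d V M) (\<lambda>a. cnj (x a)) = tensor_form r d \<Phi> w w x x"
      unfolding quadratic_form_def form_slice
    proof (intro sum.cong[OF refl])
      fix a b assume "a \<in> {..<d}" "b \<in> {..<d}"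
      then have "compress d V M $$ (a, b) = slice r d M w a b"
        using compress_index[OF V Mcar, of 0 0 a b] by (simp add: slice_def V_def)
      then show "cnj (cnj (x a)) * cnj (x b) * compress d V M $$ (a, b) = x a * cnj (x b) * slice r d M w a b"
        by simp
    qed
    finally show ?thesis .
  qed
  have "\<exists>\<sigma> (W :: nat \<Rightarrow> cvec). \<forall>a<d. \<forall>b<d. \<forall>c<d. \<forall>e<d.
    (\<Sum>i<r. \<Sum>j<r. cnj (W a i) * W b j * \<Phi> i j c e) =
      (if \<sigma> then of_bool (c = a \<and> e = b) else of_bool (c = b \<and> e = a))"
  proof (rule tensor_linear_or_antilinear_section[OF _ nonneg _ r])
    show "\<Phi> j i b a = cnj (\<Phi> i j a b)" if "i < r" "j < r" "a < d" "b < d" for i j a b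
      using MH that block_index_less[of i r a d] block_index_less[of j r b d] by (simp add: \<Phi>_def Her_iff)
  next
    fix I :: "nat set" and z v :: cvec and f :: "nat \<Rightarrow> cvec" and \<epsilon> :: real
    assume I: "finite I" and zf: "\<And>i. i \<in> I \<Longrightarrow> cinner d z (f i) = 0" and zv: "cinner d z v \<noteq> 0" and \<epsilon>: "0 < \<epsilon>"
    show "\<exists>w. (\<Sum>i\<in>I. Re (tensor_form r d \<Phi> w w (f i) (f i))) < \<epsilon> * Re (tensor_form r d \<Phi> w w v v)"
    proof (rule ccontr)
      assume neg: "\<not> ?thesis"
      obtain \<T> p c where T: "abstract_operator_system d (test_system d \<T>)" "c \<ge> 0"
        "\<T> = insert (\<lambda>a b. rank_one_combination I f \<epsilon> v a b + of_real c * (p a * cnj (p b)))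
           (range (\<lambda>(y :: cvec) a b. cnj (y a) * y b))" "cinner d z p = 0"
        using separating_test_system[of d I z f v \<epsilon>] d I zf zv \<epsilon> by blast
      define T0 where "T0 a b = rank_one_combination I f \<epsilon> v a b + of_real c * (p a * cnj (p b))" for a b
      have expand: "(\<Sum>a<d. \<Sum>b<d. T0 a b * G a b) =
        (\<Sum>i\<in>I. \<Sum>a<d. \<Sum>b<d. f i a * cnj (f i b) * G a b) - of_real \<epsilon> * (\<Sum>a<d. \<Sum>b<d. v a * cnj (v b) * G a b)
          + of_real c * (\<Sum>a<d. \<Sum>b<d. p a * cnj (p b) * G a b)" for G
        unfolding sum_rank_one_combination[symmetric]
        by (simp add: T0_def distrib_right sum.distrib sum_distrib_left mult.assoc)
      have "M \<in> test_system d \<T> r"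
        unfolding test_system_def
      proof (intro CollectI conjI ballI allI)
        show "M \<in> Her (r * d)" by (rule MH)
        fix T x assume "T \<in> \<T>"
        then consider "T = T0" | y :: cvec where "T = (\<lambda>a b. cnj (y a) * y b)"
          by (auto simp: T(3) T0_def[abs_def])
        then show "0 \<le> test_value r d T x M"
        proof cases
          case 1
          have "test_value r d T x M = (\<Sum>i\<in>I. Re (tensor_form r d \<Phi> x x (f i) (f i)))
              - \<epsilon> * Re (tensor_form r d \<Phi> x x v v) + c * Re (tensor_form r d \<Phi> x x p p)"
            unfolding 1 test_value_def expand form_slice by simp
          moreover have "\<epsilon> * Re (tensor_form r d \<Phi> x x v v) \<le> (\<Sum>i\<in>I. Re (tensor_form r d \<Phi> x x (f i) (f i)))"
            using neg by (meson not_less)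
          ultimately show ?thesis using T(2) nonneg[of x p] by simp
        next
          case 2
          have "test_value r d T x M = Re (tensor_form r d \<Phi> x x (\<lambda>a. cnj (y a)) (\<lambda>a. cnj (y a)))"
            unfolding 2 test_value_def form_slice by simp
          then show ?thesis using nonneg by simp
        qed
      qed
      then have contained: "C 1 \<subseteq> test_system d \<T> 1"
        using least[OF T(1)] unfolding system_contained_def by blast
      define Z where "Z = mat d d (\<lambda>(a, b). cnj (z a) * z b)"
      have ZH: "Z \<in> Her d" by (auto simp: Z_def Her_iff)
      have "quadratic_form d Z x = of_real ((cmod (cinner d (\<lambda>a. cnj (z a)) x))^2)" for x
        unfolding rank_one_quadratic[symmetric] quadratic_form_def Z_def
        by (subst sum.swap) (auto intro!: sum.cong)
      then have "positive_semidefinite Z" using positive_semidefinite_iff[OF ZH] by simp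
      with ZH contained C1 have "Z \<in> test_system d \<T> 1" by blast
      then have "0 \<le> test_value 1 d T0 (\<lambda>_. 1) Z" unfolding test_system_def T(3) T0_def[abs_def] by blast
      also have "test_value 1 d T0 (\<lambda>_. 1) Z = Re (\<Sum>a<d. \<Sum>b<d. T0 a b * (cnj (z a) * z b))"
        unfolding test_value_def slice_def Z_def by simp
      also have "\<dots> = - \<epsilon> * (cmod (cinner d z v))^2"
        unfolding expand rank_one_quadratic using zf T(4) by simp
      finally show False using mult_pos_pos[OF \<epsilon>, of "(cmod (cinner d z v))^2"] zv by simp
    qed
  qed
  then obtain \<sigma> and W :: "nat \<Rightarrow> cvec" where W: "\<And>a b c e. a < d \<Longrightarrow> b < d \<Longrightarrow> c < d \<Longrightarrow> e < d \<Longrightarrow>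
    (\<Sum>i<r. \<Sum>j<r. cnj (W a i) * W b j * \<Phi> i j c e) =
      (if \<sigma> then of_bool (c = a \<and> e = b) else of_bool (c = b \<and> e = a))"
    by blast
  define V where "V = mat r d (\<lambda>(i, a). W a i)"
  define \<Omega> where "\<Omega> = compress d V M"
  have V: "V \<in> carrier_mat r d" by (simp add: V_def)
  have \<Omega>: "\<Omega> \<in> C d" unfolding \<Omega>_def using compress_mem[OF C r1 _ M V] d by simp
  have \<Omega>car: "\<Omega> \<in> carrier_mat (d * d) (d * d)" unfolding \<Omega>_def by (rule compress_carrier[OF V Mcar])
  have \<Omega>_index: "\<Omega> $$ (a * d + c, b * d + e) = (if \<sigma> then of_bool (c = a \<and> e = b) else of_bool (c = b \<and> e = a))"
    if "a < d" "b < d" "c < d" "e < d" for a b c e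
    using compress_index[OF V Mcar that] W[OF that] that by (simp add: \<Omega>_def V_def \<Phi>_def)
  have mem: "A \<in> C s"
    if s: "s \<ge> 1" and A: "A \<in> carrier_mat (s * d) (s * d)"
      and B: "B \<in> Her (s * d)" "positive_semidefinite B"
      and AB: "\<And>p q a b. p < s \<Longrightarrow> q < s \<Longrightarrow> a < d \<Longrightarrow> b < d \<Longrightarrow>
        A $$ (p * d + a, q * d + b) = (if \<sigma> then B $$ (p * d + a, q * d + b) else B $$ (p * d + b, q * d + a))"
    for s A B
  proof -
    define n where "n = s * d"
    have "\<exists>z :: nat \<Rightarrow> cvec. \<forall>i<n. \<forall>j<n. B $$ (i, j) = (\<Sum>k<n. z k i * cnj (z k j))"
    proof (rule positive_function_rank_one_sum)
      show "cnj (B $$ (j, i)) = B $$ (i, j)" if "i < n" "j < n" for i j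
        using B(1) that by (simp add: Her_iff n_def)
      show "0 \<le> Re (\<Sum>i<n. \<Sum>j<n. cnj (v i) * v j * B $$ (i, j))" for v
        using positive_semidefinite_iff[OF B(1)] B(2) unfolding quadratic_form_def n_def by blast
    qed
    then obtain z :: "nat \<Rightarrow> cvec" where z: "\<And>i j. i < n \<Longrightarrow> j < n \<Longrightarrow> B $$ (i, j) = (\<Sum>k<n. z k i * cnj (z k j))"
      by blast
    \<comment> \<open>the rows of the adjoint are the blocks of \<open>z k\<close>\<close>
    define U where "U k = mat d s (\<lambda>(c, p). cnj (z k (p * d + c)))" for k
    have U: "U k \<in> carrier_mat d s" for k by (simp add: U_def)
    define R where "R k = compress d (U k) \<Omega>" for k
    have R: "R k \<in> C s" for k unfolding R_def using compress_mem[OF C _ s \<Omega> U] d by simp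
    have R_index: "R k $$ (p * d + a, q * d + b) =
        (if \<sigma> then z k (p * d + a) * cnj (z k (q * d + b)) else z k (p * d + b) * cnj (z k (q * d + a)))"
      if pq: "p < s" "q < s" and ab: "a < d" "b < d" for k p q a b
    proof -
      define m n' where "m = (if \<sigma> then a else b)" and "n' = (if \<sigma> then b else a)"
      have mn: "m < d" "n' < d" using ab by (auto simp: m_def n'_def)
      have "R k $$ (p * d + a, q * d + b) =
          (\<Sum>c<d. \<Sum>e<d. z k (p * d + c) * cnj (z k (q * d + e)) * \<Omega> $$ (c * d + a, e * d + b))"
        unfolding R_def compress_index[OF U \<Omega>car pq ab]
        using pq by (intro sum.cong[OF refl]) (simp add: U_def)
      also have "\<dots> = (\<Sum>c<d. unit_cvec m c * (\<Sum>e<d. unit_cvec n' e * (z k (p * d + c) * cnj (z k (q * d + e)))))"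
        unfolding sum_distrib_left
      proof (intro sum.cong[OF refl])
        fix c e assume ce: "c \<in> {..<d}" "e \<in> {..<d}"
        have "\<Omega> $$ (c * d + a, e * d + b) = unit_cvec m c * unit_cvec n' e"
          using \<Omega>_index[of c e a b] ce ab by (cases \<sigma>) (auto simp: m_def n'_def unit_cvec_def)
        then show "z k (p * d + c) * cnj (z k (q * d + e)) * \<Omega> $$ (c * d + a, e * d + b) =
          unit_cvec m c * (unit_cvec n' e * (z k (p * d + c) * cnj (z k (q * d + e))))"
          by simp
      qed
      also have "\<dots> = z k (p * d + m) * cnj (z k (q * d + n'))" using mn by simp
      finally show ?thesis by (simp add: m_def n'_def)
    qed
    have "mat n n (\<lambda>(P, Q). \<Sum>k<n. R k $$ (P, Q)) \<in> C s"
      unfolding n_def by (rule cone_contains_sum[OF cone[OF s] R])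
    also have "mat n n (\<lambda>(P, Q). \<Sum>k<n. R k $$ (P, Q)) = A"
    proof (rule eq_matI)
      fix P Q assume "P < dim_row A" "Q < dim_col A"
      then have PQ: "P < s * d" "Q < s * d" using A by auto
      then obtain p a q b where *: "p < s" "a < d" "P = p * d + a" "q < s" "b < d" "Q = q * d + b"
        by (metis block_index_exhaust)
      have "(\<Sum>k<n. R k $$ (P, Q)) = (if \<sigma> then B $$ (p * d + a, q * d + b) else B $$ (p * d + b, q * d + a))"
        using * block_index_less[of p s _ d] block_index_less[of q s _ d]
        by (simp add: R_index z n_def)
      then show "mat n n (\<lambda>(P, Q). \<Sum>k<n. R k $$ (P, Q)) $$ (P, Q) = A $$ (P, Q)"
        using PQ AB * by (simp add: n_def)
    qed (use A in \<open>auto simp: n_def\<close>)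
    finally show ?thesis .
  qed
  show ?thesis
  proof (cases \<sigma>)
    case True
    have "system_contained (Psd d) C"
      unfolding system_contained_def
    proof (intro allI impI subsetI)
      fix s A assume s: "1 \<le> s" and "A \<in> Psd d s"
      then have A: "A \<in> Her (s * d)" "positive_semidefinite A" by (auto simp: Psd_def)
      show "A \<in> C s" by (rule mem[OF s _ A]) (use A(1) True in \<open>auto simp: Her_iff\<close>)
    qed
    then show ?thesis ..
  next
    case False
    have "system_contained (Psd_Gamma d) C"
      unfolding system_contained_def
    proof (intro allI impI subsetI)
      fix s A assume s: "1 \<le> s" and "A \<in> Psd_Gamma d s"
      then have A: "A \<in> Her (s * d)" "positive_semidefinite (id_tensor s d d transpose_mat A)"
        by (auto simp: Psd_Gamma_def)
      have "A \<in> carrier_mat (s * d) (s * d)" using A(1) by (simp add: Her_iff)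
      then show "A \<in> C s"
        by (rule mem[OF s _ id_tensor_transpose_Her[OF A(1)] A(2)])
           (use False in \<open>simp add: id_tensor_transpose_index\<close>)
    qed
    then show ?thesis ..
  qed
qed

section \<open>Systems over the positive semidefinite cone\<close>

theorem theorem3p10:
  fixes d :: nat and C :: "nat \<Rightarrow> complex mat set"
  assumes "d \<ge> 1"
    and "abstract_operator_system d C"
    and "C 1 = {A \<in> Her d. positive_semidefinite A}"
  shows "((\<exists>r \<le> 2 * d - 2. free_spectrahedron d r C) \<longrightarrow>
            system_contained C (Psd d) \<or> system_contained C (Psd_Gamma d))
       \<and> ((\<exists>M \<in> C (2 * d - 2). free_numerical_range d (2 * d - 2) M C) \<longrightarrow>
            system_contained (Psd d) C \<or> system_contained (Psd_Gamma d) C)"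
proof (intro conjI impI)
  assume "\<exists>r \<le> 2 * d - 2. free_spectrahedron d r C"
  then obtain r where "r \<le> 2 * d - 2" and free: "free_spectrahedron d r C" by blast
  then have "r < 2 * d - 1" using assms(1) by linarith
  then show "system_contained C (Psd d) \<or> system_contained C (Psd_Gamma d)"
    using free_spectrahedron_contained[OF assms(2,3)] free by blast
next
  assume "\<exists>M \<in> C (2 * d - 2). free_numerical_range d (2 * d - 2) M C"
  moreover have "2 * d - 2 < 2 * d - 1" using assms(1) by linarith
  ultimately show "system_contained (Psd d) C \<or> system_contained (Psd_Gamma d) C"
    using free_numerical_range_contains[of C d] assms(3) by blast
qed

end
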